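(* Let $k$ be a field, $n\ge1$, and let $q\in k^\times$ be a primitive $r$-th root of unity with $q^2\ne1$. Then quantum symplectic space satisfies $$\operatorname{PIdeg}\mathcal O_q(\mathfrak{sp}(k^{2n}))=\begin{cases}r^n,&r\text{ odd},\\ r^n/2^{\lfloor\frac{n+1}2\rfloor},&r\text{ even},\ r\notin4\mathbb Z,\\ r^n/2^n,&r\in4\mathbb Z.\end{cases}$$
   Context: $k$ has arbitrary characteristic. $\mathcal O_q(\mathfrak{sp}(k^{2n}))$ is the $k$-algebra $K_{n,\Gamma}^{P,Q}(k)$ with $q_i=q^{-2}$ and $p_i=1$ for all $i$, and $\gamma_{ij}=q$ for $i<j$, $\gamma_{ii}=1$, $\gamma_{ij}=q^{-1}$ for $i>j$. Here, for $P=(p_1,\dots,p_n)$, $Q=(q_1,\dots,q_n)\in(k^\times)^n$ with $p_i\ne q_i$ and $\Gamma=(\gamma_{ij})\in M_n(k^\times)$ with $\gamma_{ii}=1$, $\gamma_{ji}=\gamma_{ij}^{-1}$, $K_{n,\Gamma}^{P,Q}(k)$ has generators $x_i,y_i$ ($1\le i\le n$) and relations $y_iy_j=\gamma_{ij}y_jy_i$ (all $i,j$); $x_ix_j=q_ip_j^{-1}\gamma_{ij}x_jx_i$ ($i<j$); $x_iy_j=p_j\gamma_{ji}y_jx_i$ ($i<j$); $x_iy_j=q_j\gamma_{ji}y_jx_i$ ($i>j$); $x_iy_i=q_iy_ix_i+\sum_{\ell<i}(q_\ell-p_\ell)y_\ell x_\ell$ (all $i$). $\operatorname{PIdeg}$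 is the PI degree of a prime PI ring. *)

theory Defs
  imports "HOL-Algebra.Algebra" "HOL-Library.Poly_Mapping"
begin

section \<open>Free algebras\<close>

text \<open>
  With concatenation of lists as (non-commutative) addition of exponents, the convolution product
  of \<^theory>\<open>HOL-Library.Poly_Mapping\<close> makes \<open>'x list \<Rightarrow>\<^sub>0 'k\<close> the free associative unital
  algebra over \<open>'k\<close> on the letters \<open>'x\<close>: the word \<open>w\<close> is \<open>Poly_Mapping.single w 1\<close>.
\<close>

instantiation list :: (type) monoid_add
begin

definition zero_list :: "'a list" where "zero_list = []"

definition plus_list :: "'a list \<Rightarrow> 'a list \<Rightarrow> 'a list" where "plus_list = (@)"

instance
  by standard (simp_all add: zero_list_def plus_list_def)

end

definition free_algebra :: "'x set \<Rightarrow> ('x list \<Rightarrow>\<^sub>0 'k::field) ring" where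
  "free_algebra V =
    \<lparr>carrier = {f. \<forall>w \<in> Poly_Mapping.keys f. set w \<subseteq> V},
     monoid.mult = (*), one = 1, ring.zero = 0, ring.add = (+)\<rparr>"


section \<open>The algebras \<open>K\<close> and quantum symplectic space\<close>

datatype generator = Gx nat | Gy nat

definition generators :: "nat \<Rightarrow> generator set" where
  "generators n = Gx ` {1..n} \<union> Gy ` {1..n}"

text \<open>\<open>c \<star> w\<close> is the scalar multiple \<open>c w\<close> of the word \<open>w\<close>.\<close>

abbreviation scaled_word :: "'k \<Rightarrow> 'x list \<Rightarrow> ('x list \<Rightarrow>\<^sub>0 'k::field)" (infix \<open>\<star>\<close> 75) where
  "c \<star> w \<equiv> Poly_Mapping.single w c"

text \<open>Each relation \<open>u = v\<close> is represented by the element \<open>u - v\<close>.\<close>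

definition K_relations ::
  "nat \<Rightarrow> (nat \<Rightarrow> 'k::field) \<Rightarrow> (nat \<Rightarrow> 'k) \<Rightarrow> (nat \<Rightarrow> nat \<Rightarrow> 'k) \<Rightarrow> (generator list \<Rightarrow>\<^sub>0 'k) set" where
  "K_relations n p q \<gamma> =
     {1 \<star> [Gy i, Gy j] - \<gamma> i j \<star> [Gy j, Gy i] | i j. i \<in> {1..n} \<and> j \<in> {1..n}}
   \<union> {1 \<star> [Gx i, Gx j] - (q i * inverse (p j) * \<gamma> i j) \<star> [Gx j, Gx i] | i j.
        i \<in> {1..n} \<and> j \<in> {1..n} \<and> i < j}
   \<union> {1 \<star> [Gx i, Gy j] - (p j * \<gamma> j i) \<star> [Gy j, Gx i] | i j.
        i \<in> {1..n} \<and> j \<in> {1..n} \<and> i < j}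
   \<union> {1 \<star> [Gx i, Gy j] - (q j * \<gamma> j i) \<star> [Gy j, Gx i] | i j.
        i \<in> {1..n} \<and> j \<in> {1..n} \<and> i > j}
   \<union> {1 \<star> [Gx i, Gy i] - (q i \<star> [Gy i, Gx i] + (\<Sum>l\<in>{1..<i}. (q l - p l) \<star> [Gy l, Gx l])) | i.
        i \<in> {1..n}}"

text \<open>
  Only the ring structure is recorded, as the PI degree does not depend on anything else.
  The ideal generated is two-sided, and it is stable under scalars because the scalars are the
  elements \<open>c \<star> []\<close> of the free algebra.
\<close>

definition K_algebra ::
  "nat \<Rightarrow> (nat \<Rightarrow> 'k::field) \<Rightarrow> (nat \<Rightarrow> 'k) \<Rightarrow> (nat \<Rightarrow> nat \<Rightarrow> 'k) \<Rightarrow> (generator list \<Rightarrow>\<^sub>0 'k) set ring" where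
  "K_algebra n p q \<gamma> =
     free_algebra (generators n) Quot
       (Idl\<^bsub>free_algebra (generators n)\<^esub> (K_relations n p q \<gamma>))"

definition quantum_symplectic_space ::
  "nat \<Rightarrow> 'k::field \<Rightarrow> (generator list \<Rightarrow>\<^sub>0 'k) set ring" where
  "quantum_symplectic_space n q =
     K_algebra n (\<lambda>i. 1) (\<lambda>i. inverse (q ^ 2))
       (\<lambda>i j. if i < j then q else if i = j then 1 else inverse q)"


section \<open>Prime PI rings and the PI degree\<close>

definition prime_ring :: "('a, 'b) ring_scheme \<Rightarrow> bool" where
  "prime_ring R \<longleftrightarrow> ring R \<and> \<one>\<^bsub>R\<^esub> \<noteq> \<zero>\<^bsub>R\<^esub> \<and>
     (\<forall>a \<in> carrier R. \<forall>b \<in> carrier R.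
        (\<forall>x \<in> carrier R. a \<otimes>\<^bsub>R\<^esub> x \<otimes>\<^bsub>R\<^esub> b = \<zero>\<^bsub>R\<^esub>) \<longrightarrow> a = \<zero>\<^bsub>R\<^esub> \<or> b = \<zero>\<^bsub>R\<^esub>)"

text \<open>
  A PI ring satisfies a monic polynomial of the free ring over the integers on countably many
  letters, where monic means that some word of maximal length has coefficient 1.
\<close>

definition eval_word :: "('a, 'b) ring_scheme \<Rightarrow> (nat \<Rightarrow> 'a) \<Rightarrow> nat list \<Rightarrow> 'a" where
  "eval_word R a w = foldr (\<lambda>i b. a i \<otimes>\<^bsub>R\<^esub> b) w \<one>\<^bsub>R\<^esub>"

definition eval_free :: "('a, 'b) ring_scheme \<Rightarrow> (nat \<Rightarrow> 'a) \<Rightarrow> (nat list \<Rightarrow>\<^sub>0 int) \<Rightarrow> 'a" where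
  "eval_free R a f =
     (\<Oplus>\<^bsub>R\<^esub> w \<in> Poly_Mapping.keys f. [Poly_Mapping.lookup f w] \<cdot>\<^bsub>R\<^esub> eval_word R a w)"

definition monic_free :: "(nat list \<Rightarrow>\<^sub>0 int) \<Rightarrow> bool" where
  "monic_free f \<longleftrightarrow>
     (\<exists>w. Poly_Mapping.lookup f w = 1 \<and> (\<forall>v \<in> Poly_Mapping.keys f. length v \<le> length w))"

definition PI_ring :: "('a, 'b) ring_scheme \<Rightarrow> bool" where
  "PI_ring R \<longleftrightarrow> ring R \<and>
     (\<exists>f. monic_free f \<and> (\<forall>a. range a \<subseteq> carrier R \<longrightarrow> eval_free R a f = \<zero>\<^bsub>R\<^esub>))"

definition ring_center :: "('a, 'b) ring_scheme \<Rightarrow> 'a set" where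
  "ring_center R = {z \<in> carrier R. \<forall>x \<in> carrier R. z \<otimes>\<^bsub>R\<^esub> x = x \<otimes>\<^bsub>R\<^esub> z}"

text \<open>
  The central localization of \<open>R\<close> at the nonzero central elements, as classes of pairs
  \<open>(a, s)\<close> standing for \<open>a s\<inverse>\<close>. It is meant for prime \<open>R\<close>, where nonzero central elements are
  regular; hence no additional factor occurs in the definition of equality of fractions.
\<close>

definition central_denominators :: "('a, 'b) ring_scheme \<Rightarrow> 'a set" where
  "central_denominators R = ring_center R - {\<zero>\<^bsub>R\<^esub>}"

definition central_frac :: "('a, 'b) ring_scheme \<Rightarrow> 'a \<Rightarrow> 'a \<Rightarrow> ('a \<times> 'a) set" where
  "central_frac R a s =
     {(b, t). b \<in> carrier R \<and> t \<in> central_denominators R \<and> a \<otimes>\<^bsub>R\<^esub> t = b \<otimes>\<^bsub>R\<^esub> s}"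

definition central_quotient_ring :: "('a, 'b) ring_scheme \<Rightarrow> ('a \<times> 'a) set ring" where
  "central_quotient_ring R =
    \<lparr>carrier = {central_frac R a s | a s. a \<in> carrier R \<and> s \<in> central_denominators R},
     monoid.mult = (\<lambda>U V. \<Union>(a, s) \<in> U. \<Union>(b, t) \<in> V. central_frac R (a \<otimes>\<^bsub>R\<^esub> b) (s \<otimes>\<^bsub>R\<^esub> t)),
     one = central_frac R \<one>\<^bsub>R\<^esub> \<one>\<^bsub>R\<^esub>,
     ring.zero = central_frac R \<zero>\<^bsub>R\<^esub> \<one>\<^bsub>R\<^esub>,
     ring.add = (\<lambda>U V. \<Union>(a, s) \<in> U. \<Union>(b, t) \<in> V.
              central_frac R (a \<otimes>\<^bsub>R\<^esub> t \<oplus>\<^bsub>R\<^esub> b \<otimes>\<^bsub>R\<^esub> s) (s \<otimes>\<^bsub>R\<^esub> t))\<rparr>"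

text \<open>
  By Posner's theorem the central localization of a prime PI ring is a central simple algebra,
  of finite dimension \<open>d\<^sup>2\<close> over its center; the PI degree of the ring is \<open>d\<close>.
  It is only meaningful for prime PI rings.
\<close>

definition PI_degree :: "('a, 'b) ring_scheme \<Rightarrow> nat" where
  "PI_degree R =
     (THE d. ring.dimension (central_quotient_ring R) (d ^ 2)
               (ring_center (central_quotient_ring R)) (carrier (central_quotient_ring R)))"

end

theory Submission
  imports Defs
begin

text \<open>
  Put \<open>\<Omega>\<^sub>i = \<Sum>l\<le>i. (q\<^sub>l - p\<^sub>l) y\<^sub>l x\<^sub>l\<close>. The elements \<open>y\<^sub>i\<close> and \<open>\<Omega>\<^sub>i\<close> commute up to scalars,
  and \<open>x\<^sub>i = (q\<^sub>i - p\<^sub>i)\<inverse> y\<^sub>i\<inverse> (\<Omega>\<^sub>i - \<Omega>\<^sub>i\<^sub>-\<^sub>1)\<close> once the \<open>y\<^sub>i\<close> are inverted. This formula maps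
  the algebra to the quantum torus on the \<open>y\<^sub>i\<close> and \<open>\<Omega>\<^sub>i\<close>. The map is injective: modulo the relations
  the sorted words span, and their images have distinct leading monomials for the weight that is \<open>i\<close>
  on \<open>\<Omega>\<^sub>i\<close> and \<open>0\<close> on \<open>y\<^sub>i\<close>. So the algebra is a domain. The center of the torus is spanned by the
  monomials whose exponents lie in the radical of the commutation form, and the monomials with
  exponents in a transversal of the radical form a basis over the center. The square of the PI degree
  is therefore the index of the radical, which is computed with an explicit box of representatives.
  The polynomial identity is the standard identity in more variables than that index.
\<close>

section \<open>Central localizations of noncommutative domains\<close>

text \<open>Origin of the three cases: an exponent with \<open>y\<close>-part \<open>x\<close> and
  \<open>W\<close>-part \<open>b\<close> lies in the radical iff \<open>r\<close> divides every
  \<open>2 x_j\<close> and every \<open>skew x j - 2 b_j\<close>. For odd \<open>r\<close> the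
  factor 2 cancels and the radical is \<open>r\<close> times the lattice. For \<open>r = 2 h\<close>
  the first condition reads \<open>h dvd x_j\<close>, and the second can be solved for
  \<open>b\<close> iff all \<open>skew x j\<close> are even. This is automatic for even
  \<open>h\<close>; for odd \<open>h\<close> it forces every \<open>x_j\<close> to have the parity
  of the sum of all of them, a condition that depends on the parity of \<open>n\<close> and produces
  the floor in the formula. Coordinates \<open>W_i\<close> replace \<open>Omega_i\<close> because
  \<open>W_i\<close> commutes with every \<open>y_j\<close> except \<open>y_i\<close>. Torus
  monomials with negative exponents need not lie in the algebra. Since \<open>r\<close>-fold
  multiples of exponents are in the radical, finitely many of them can be moved into the algebra by
  one central monomial, which becomes a unit in the central localization. No confluence of the
  rewriting is checked: the independence of the sorted words is read off in the torus. Posner's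
  theorem is bypassed as well, since a basis over the center is exhibited.\<close>

locale noncommutative_domain = ring R for R (structure) +
  assumes one_not_zero: "\<one> \<noteq> \<zero>"
    and integral:
      "\<lbrakk>a \<in> carrier R; b \<in> carrier R; a \<otimes> b = \<zero>\<rbrakk> \<Longrightarrow> a = \<zero> \<or> b = \<zero>"
begin

lemma prime_ring: "prime_ring R"
  unfolding prime_ring_def
proof (intro conjI ballI impI)
  fix a b
  assume ab: "a \<in> carrier R" "b \<in> carrier R"
    and "\<forall>x\<in>carrier R. a \<otimes> x \<otimes> b = \<zero>"
  then have "a \<otimes> \<one> \<otimes> b = \<zero>" by blast
  then show "a = \<zero> \<or> b = \<zero>"
    using ab integral by simp
qed (use ring_axioms one_not_zero in auto)

abbreviation Z where "Z \<equiv> ring_center R"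
abbreviation S where "S \<equiv> central_denominators R"
abbreviation Q where "Q \<equiv> central_quotient_ring R"
abbreviation frac where "frac \<equiv> central_frac R"

lemma centerI: "\<lbrakk>z \<in> carrier R; \<And>x. x \<in> carrier R \<Longrightarrow> z \<otimes> x = x \<otimes> z\<rbrakk> \<Longrightarrow> z \<in> Z"
  unfolding ring_center_def by blast

lemma center_closed: "z \<in> Z \<Longrightarrow> z \<in> carrier R"
  unfolding ring_center_def by blast

lemma center_commutes: "z \<in> Z \<Longrightarrow> x \<in> carrier R \<Longrightarrow> x \<otimes> z = z \<otimes> x"
  unfolding ring_center_def by (rule sym) blast

lemma center_mult:
  assumes "y \<in> Z" "z \<in> Z"
  shows "y \<otimes> z \<in> Z"
proof (rule centerI)
  fix x assume "x \<in> carrier R"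
  then show "y \<otimes> z \<otimes> x = x \<otimes> (y \<otimes> z)"
    using assms by (metis center_closed center_commutes m_assoc)
qed (use assms center_closed in simp)

lemma center_add:
  assumes "y \<in> Z" "z \<in> Z"
  shows "y \<oplus> z \<in> Z"
proof (rule centerI)
  fix x assume "x \<in> carrier R"
  then show "(y \<oplus> z) \<otimes> x = x \<otimes> (y \<oplus> z)"
    using assms by (simp add: l_distr r_distr center_closed center_commutes[of _ x])
qed (use assms center_closed in simp)

lemma center_minus:
  assumes "z \<in> Z"
  shows "\<ominus> z \<in> Z"
proof (rule centerI)
  fix x assume "x \<in> carrier R"
  then show "\<ominus> z \<otimes> x = x \<otimes> \<ominus> z"
    using assms by (simp add: l_minus r_minus center_closed center_commutes[of _ x])
qed (use assms center_closed in simp)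

lemma center_one: "\<one> \<in> Z"
  by (simp add: ring_center_def)

lemma denom_center: "s \<in> S \<Longrightarrow> s \<in> Z" and denom_nonzero: "s \<in> S \<Longrightarrow> s \<noteq> \<zero>"
  by (auto simp: central_denominators_def)

lemma denom_closed [simp]: "s \<in> S \<Longrightarrow> s \<in> carrier R"
  using denom_center center_closed by blast

lemma denom_mult [simp]: "s \<in> S \<Longrightarrow> t \<in> S \<Longrightarrow> s \<otimes> t \<in> S"
  using center_mult integral by (auto simp: central_denominators_def dest!: center_closed)

lemma denom_one [simp]: "\<one> \<in> S"
  using center_one one_not_zero by (simp add: central_denominators_def)

lemma denom_commutes: "s \<in> S \<Longrightarrow> x \<in> carrier R \<Longrightarrow> x \<otimes> s = s \<otimes> x"
  using denom_center center_commutes by blast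

lemma denom_lcommutes:
  assumes "s \<in> S" "x \<in> carrier R" "y \<in> carrier R"
  shows "x \<otimes> (s \<otimes> y) = s \<otimes> (x \<otimes> y)"
  using assms denom_commutes by (metis denom_closed m_assoc)

lemma denom_cancel:
  assumes "s \<in> S" "x \<in> carrier R" "y \<in> carrier R" "s \<otimes> x = s \<otimes> y"
  shows "x = y"
proof -
  have "s \<otimes> (x \<ominus> y) = \<zero>"
    using assms by (simp add: minus_eq r_distr r_minus r_neg)
  then have "x \<ominus> y = \<zero>"
    using integral[of s "x \<ominus> y"] assms denom_nonzero by auto
  then show ?thesis
    using assms by simp
qed

section \<open>The ring of fractions with central denominators\<close>

lemma frac_mem_iff:
  assumes "a \<in> carrier R" "s \<in> S"
  shows "(b, t) \<in> frac a s \<longleftrightarrow> b \<in> carrier R \<and> t \<in> S \<and> t \<otimes> a = s \<otimes> b"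
  unfolding central_frac_def
  using assms by (simp add: denom_commutes[of t a] denom_commutes[of s b] cong: conj_cong)

lemma frac_eq_iff:
  assumes [simp]: "a \<in> carrier R" "b \<in> carrier R" "s \<in> S" "t \<in> S"
  shows "frac a s = frac b t \<longleftrightarrow> t \<otimes> a = s \<otimes> b"
proof
  assume "frac a s = frac b t"
  moreover have "(b, t) \<in> frac b t"
    by (simp add: central_frac_def)
  ultimately have "(b, t) \<in> frac a s" by simp
  then show "t \<otimes> a = s \<otimes> b"
    by (simp add: frac_mem_iff)
next
  have sub: "frac a s \<subseteq> frac b t"
    if [simp]: "a \<in> carrier R" "b \<in> carrier R" "s \<in> S" "t \<in> S" and e: "t \<otimes> a = s \<otimes> b" for a b s t
  proof -
    have "u \<otimes> b = t \<otimes> c"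
      if [simp]: "c \<in> carrier R" "u \<in> S" and h: "u \<otimes> a = s \<otimes> c" for c u
    proof -
      have "s \<otimes> (u \<otimes> b) = u \<otimes> (t \<otimes> a)"
        by (simp add: e denom_lcommutes)
      also have "\<dots> = t \<otimes> (u \<otimes> a)"
        by (simp add: denom_lcommutes)
      also have "\<dots> = s \<otimes> (t \<otimes> c)"
        by (simp add: h denom_lcommutes)
      finally show ?thesis
        by (rule denom_cancel[rotated -1]) auto
    qed
    then show ?thesis
      by (auto simp: frac_mem_iff)
  qed
  assume "t \<otimes> a = s \<otimes> b"
  then show "frac a s = frac b t"
    using sub[of a b s t] sub[of b a t s] by simp
qed

lemma frac_self: "a \<in> carrier R \<Longrightarrow> s \<in> S \<Longrightarrow> (a, s) \<in> frac a s"
  by (simp add: central_frac_def)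

text \<open>The operations of \<open>Q\<close> are unions over all representatives. Well-definedness
  therefore means that every member of the union is the same class \<open>c\<close>; the given
  representatives show that the union is not empty.\<close>

lemma UN_frac_const:
  assumes "a \<in> carrier R" "s \<in> S" "b \<in> carrier R" "t \<in> S"
    and "\<And>a' s' b' t'. \<lbrakk>a' \<in> carrier R; s' \<in> S; s' \<otimes> a = s \<otimes> a';
      b' \<in> carrier R; t' \<in> S; t' \<otimes> b = t \<otimes> b'\<rbrakk> \<Longrightarrow> F a' s' b' t' = c"
  shows "(\<Union>(a, s) \<in> frac a s. \<Union>(b, t) \<in> frac b t. F a s b t) = c"
proof -
  have "F a' s' b' t' = c" if "(a', s') \<in> frac a s" "(b', t') \<in> frac b t" for a' s' b' t'
    using that assms(1-4) by (intro assms(5)) (simp_all add: frac_mem_iff)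
  then show ?thesis
    using frac_self[OF assms(1,2)] frac_self[OF assms(3,4)] by fast
qed

lemma Q_mult:
  assumes [simp]: "a \<in> carrier R" "b \<in> carrier R" "s \<in> S" "t \<in> S"
  shows "frac a s \<otimes>\<^bsub>Q\<^esub> frac b t = frac (a \<otimes> b) (s \<otimes> t)"
  unfolding central_quotient_ring_def monoid.simps
proof (rule UN_frac_const)
  fix a' s' b' t'
  assume [simp]: "a' \<in> carrier R" "s' \<in> S" "b' \<in> carrier R" "t' \<in> S"
    and h: "s' \<otimes> a = s \<otimes> a'" "t' \<otimes> b = t \<otimes> b'"
  have "s \<otimes> t \<otimes> (a' \<otimes> b') = (s \<otimes> a') \<otimes> (t \<otimes> b')"
    by (simp add: m_assoc denom_lcommutes)
  also have "\<dots> = (s' \<otimes> a) \<otimes> (t' \<otimes> b)"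
    by (simp only: h)
  also have "\<dots> = s' \<otimes> t' \<otimes> (a \<otimes> b)"
    by (simp add: m_assoc denom_lcommutes)
  finally show "frac (a' \<otimes> b') (s' \<otimes> t') = frac (a \<otimes> b) (s \<otimes> t)"
    by (simp add: frac_eq_iff)
qed auto

lemma Q_add_general:
  assumes [simp]: "a \<in> carrier R" "b \<in> carrier R" "s \<in> S" "t \<in> S"
  shows "frac a s \<oplus>\<^bsub>Q\<^esub> frac b t = frac (a \<otimes> t \<oplus> b \<otimes> s) (s \<otimes> t)"
  unfolding central_quotient_ring_def ring_record_simps
proof (rule UN_frac_const)
  fix a' s' b' t'
  assume [simp]: "a' \<in> carrier R" "s' \<in> S" "b' \<in> carrier R" "t' \<in> S"
    and h: "s' \<otimes> a = s \<otimes> a'" "t' \<otimes> b = t \<otimes> b'"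
  have "s \<otimes> t \<otimes> (a' \<otimes> t' \<oplus> b' \<otimes> s') = t \<otimes> t' \<otimes> (s \<otimes> a') \<oplus> s \<otimes> s' \<otimes> (t \<otimes> b')"
    by (simp add: r_distr m_assoc denom_lcommutes denom_commutes[of t' a'] denom_commutes[of s' b'])
  also have "\<dots> = t \<otimes> t' \<otimes> (s' \<otimes> a) \<oplus> s \<otimes> s' \<otimes> (t' \<otimes> b)"
    by (simp only: h)
  also have "\<dots> = s' \<otimes> t' \<otimes> (a \<otimes> t \<oplus> b \<otimes> s)"
    by (simp add: r_distr m_assoc denom_lcommutes denom_commutes[of t a] denom_commutes[of s b])
  finally show "frac (a' \<otimes> t' \<oplus> b' \<otimes> s') (s' \<otimes> t') = frac (a \<otimes> t \<oplus> b \<otimes> s) (s \<otimes> t)"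
    by (simp add: frac_eq_iff)
qed auto

lemma Q_add:
  assumes [simp]: "a \<in> carrier R" "b \<in> carrier R" "s \<in> S"
  shows "frac a s \<oplus>\<^bsub>Q\<^esub> frac b s = frac (a \<oplus> b) s"
proof -
  have "a \<otimes> s \<oplus> b \<otimes> s = s \<otimes> (a \<oplus> b)"
    using denom_commutes[of s "a \<oplus> b"] by (simp add: l_distr)
  then have "frac a s \<oplus>\<^bsub>Q\<^esub> frac b s = frac (s \<otimes> (a \<oplus> b)) (s \<otimes> s)"
    using Q_add_general[of a b s s] by simp
  also have "\<dots> = frac (a \<oplus> b) s"
    by (subst frac_eq_iff) (simp_all add: m_assoc)
  finally show ?thesis .
qed

lemma Q_one: "\<one>\<^bsub>Q\<^esub> = frac \<one> \<one>" and Q_zero: "\<zero>\<^bsub>Q\<^esub> = frac \<zero> \<one>"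
  by (simp_all add: central_quotient_ring_def)

lemma Q_carrier: "carrier Q = {frac a s | a s. a \<in> carrier R \<and> s \<in> S}"
  by (simp add: central_quotient_ring_def)

lemma frac_closed: "a \<in> carrier R \<Longrightarrow> s \<in> S \<Longrightarrow> frac a s \<in> carrier Q"
  by (auto simp: Q_carrier)

lemma frac_expand:
  "\<lbrakk>a \<in> carrier R; s \<in> S; t \<in> S\<rbrakk> \<Longrightarrow> frac a s = frac (t \<otimes> a) (t \<otimes> s)"
  by (simp add: frac_eq_iff m_assoc denom_lcommutes)

lemma Q_zero': "s \<in> S \<Longrightarrow> \<zero>\<^bsub>Q\<^esub> = frac \<zero> s"
  by (simp add: Q_zero frac_eq_iff)

lemma Q_one': "s \<in> S \<Longrightarrow> \<one>\<^bsub>Q\<^esub> = frac s s"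
  by (simp add: Q_one frac_eq_iff)

text \<open>Over one common denominator the ring axioms of \<open>Q\<close> reduce to those of
  \<open>R\<close>. Three fractions suffice for every axiom.\<close>

lemma common_denominator:
  assumes "U \<in> carrier Q" "V \<in> carrier Q" "W \<in> carrier Q"
  obtains a b c s where "a \<in> carrier R" "b \<in> carrier R" "c \<in> carrier R" "s \<in> S"
    "U = frac a s" "V = frac b s" "W = frac c s"
proof -
  obtain a s b t c u where *: "a \<in> carrier R" "s \<in> S" "b \<in> carrier R" "t \<in> S"
      "c \<in> carrier R" "u \<in> S" and UVW: "U = frac a s" "V = frac b t" "W = frac c u"
    using assms by (auto simp: Q_carrier)
  have e: "s \<otimes> u \<otimes> t = t \<otimes> u \<otimes> s" "s \<otimes> t \<otimes> u = t \<otimes> u \<otimes> s"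
    using * by (simp_all add: m_assoc denom_commutes denom_lcommutes)
  show ?thesis
  proof (rule that)
    show "U = frac (t \<otimes> u \<otimes> a) (t \<otimes> u \<otimes> s)"
      unfolding UVW using * by (intro frac_expand) auto
    show "V = frac (s \<otimes> u \<otimes> b) (t \<otimes> u \<otimes> s)"
      unfolding UVW e(1)[symmetric] using * by (intro frac_expand) auto
    show "W = frac (s \<otimes> t \<otimes> c) (t \<otimes> u \<otimes> s)"
      unfolding UVW e(2)[symmetric] using * by (intro frac_expand) auto
  qed (use * in auto)
qed

lemma Q_ring: "ring Q"
proof (rule ringI)
  show "abelian_group Q"
  proof (rule abelian_groupI)
    fix U V W assume h: "U \<in> carrier Q" "V \<in> carrier Q" "W \<in> carrier Q"
    from common_denominator[OF h] obtain a b c s where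
      [simp]: "a \<in> carrier R" "b \<in> carrier R" "c \<in> carrier R" "s \<in> S"
      and e: "U = frac a s" "V = frac b s" "W = frac c s" .
    show "U \<oplus>\<^bsub>Q\<^esub> V \<oplus>\<^bsub>Q\<^esub> W = U \<oplus>\<^bsub>Q\<^esub> (V \<oplus>\<^bsub>Q\<^esub> W)"
      unfolding e by (simp add: Q_add a_assoc)
  next
    fix U V assume h: "U \<in> carrier Q" "V \<in> carrier Q"
    from common_denominator[OF h(1) h] obtain a b s where
      [simp]: "a \<in> carrier R" "b \<in> carrier R" "s \<in> S" and e: "U = frac a s" "V = frac b s" .
    show "U \<oplus>\<^bsub>Q\<^esub> V \<in> carrier Q"
      unfolding e by (simp add: Q_add frac_closed)
    show "U \<oplus>\<^bsub>Q\<^esub> V = V \<oplus>\<^bsub>Q\<^esub> U"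
      unfolding e by (simp add: Q_add a_comm)
  next
    show "\<zero>\<^bsub>Q\<^esub> \<in> carrier Q"
      by (simp add: Q_zero frac_closed)
  next
    fix U assume h: "U \<in> carrier Q"
    then obtain a s where [simp]: "a \<in> carrier R" "s \<in> S" and e: "U = frac a s"
      by (auto simp: Q_carrier)
    show "\<zero>\<^bsub>Q\<^esub> \<oplus>\<^bsub>Q\<^esub> U = U"
      unfolding e Q_zero'[OF \<open>s \<in> S\<close>] by (simp add: Q_add)
    show "\<exists>V\<in>carrier Q. V \<oplus>\<^bsub>Q\<^esub> U = \<zero>\<^bsub>Q\<^esub>"
      unfolding e Q_zero'[OF \<open>s \<in> S\<close>]
      by (rule bexI[of _ "frac (\<ominus> a) s"]) (simp_all add: Q_add l_neg frac_closed)
  qed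
  show "monoid Q"
  proof (rule monoidI)
    fix U V W assume h: "U \<in> carrier Q" "V \<in> carrier Q" "W \<in> carrier Q"
    from common_denominator[OF h] obtain a b c s where
      [simp]: "a \<in> carrier R" "b \<in> carrier R" "c \<in> carrier R" "s \<in> S"
      and e: "U = frac a s" "V = frac b s" "W = frac c s" .
    show "U \<otimes>\<^bsub>Q\<^esub> V \<otimes>\<^bsub>Q\<^esub> W = U \<otimes>\<^bsub>Q\<^esub> (V \<otimes>\<^bsub>Q\<^esub> W)"
      unfolding e by (simp add: Q_mult m_assoc)
    show "U \<otimes>\<^bsub>Q\<^esub> V \<in> carrier Q"
      unfolding e by (simp add: Q_mult frac_closed)
    show "\<one>\<^bsub>Q\<^esub> \<otimes>\<^bsub>Q\<^esub> U = U" "U \<otimes>\<^bsub>Q\<^esub> \<one>\<^bsub>Q\<^esub> = U"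
      unfolding e Q_one by (simp_all add: Q_mult)
  next
    show "\<one>\<^bsub>Q\<^esub> \<in> carrier Q"
      by (simp add: Q_one frac_closed)
  qed
next
  fix U V W assume h: "U \<in> carrier Q" "V \<in> carrier Q" "W \<in> carrier Q"
  from common_denominator[OF h] obtain a b c s where
    [simp]: "a \<in> carrier R" "b \<in> carrier R" "c \<in> carrier R" "s \<in> S"
    and e: "U = frac a s" "V = frac b s" "W = frac c s" .
  show "(U \<oplus>\<^bsub>Q\<^esub> V) \<otimes>\<^bsub>Q\<^esub> W = U \<otimes>\<^bsub>Q\<^esub> W \<oplus>\<^bsub>Q\<^esub> V \<otimes>\<^bsub>Q\<^esub> W"
    unfolding e by (simp add: Q_mult Q_add l_distr)
  show "W \<otimes>\<^bsub>Q\<^esub> (U \<oplus>\<^bsub>Q\<^esub> V) = W \<otimes>\<^bsub>Q\<^esub> U \<oplus>\<^bsub>Q\<^esub> W \<otimes>\<^bsub>Q\<^esub> V"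
    unfolding e by (simp add: Q_mult Q_add r_distr)
qed

sublocale Q: ring Q
  by (rule Q_ring)

section \<open>The center of the localization and its field structure\<close>

lemma Q_center: "ring_center Q = {frac z s | z s. z \<in> Z \<and> s \<in> S}" (is "?L = ?R")
proof (intro equalityI subsetI)
  fix U assume U: "U \<in> ?L"
  then obtain a s where [simp]: "a \<in> carrier R" "s \<in> S" and e: "U = frac a s"
    unfolding ring_center_def Q_carrier by blast
  have "a \<otimes> x = x \<otimes> a" if [simp]: "x \<in> carrier R" for x
  proof -
    have "U \<otimes>\<^bsub>Q\<^esub> frac x \<one> = frac x \<one> \<otimes>\<^bsub>Q\<^esub> U"
      using U frac_closed[of x \<one>] unfolding ring_center_def by simp
    then have "s \<otimes> (a \<otimes> x) = s \<otimes> (x \<otimes> a)"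
      by (simp add: e Q_mult frac_eq_iff)
    then show ?thesis
      by (rule denom_cancel[rotated -1]) auto
  qed
  then have "a \<in> Z"
    by (simp add: ring_center_def)
  then show "U \<in> ?R"
    using e \<open>s \<in> S\<close> by blast
next
  fix U assume "U \<in> ?R"
  then obtain z s where z: "z \<in> Z" and [simp]: "s \<in> S" and e: "U = frac z s"
    by blast
  have [simp]: "z \<in> carrier R"
    using z by (rule center_closed)
  have "frac z s \<otimes>\<^bsub>Q\<^esub> frac x t = frac x t \<otimes>\<^bsub>Q\<^esub> frac z s"
    if [simp]: "x \<in> carrier R" "t \<in> S" for x t
    using denom_commutes[of t s] center_commutes[OF z, of x] by (simp add: Q_mult)
  then show "U \<in> ?L"
    unfolding ring_center_def Q_carrier e using \<open>z \<in> carrier R\<close> \<open>s \<in> S\<close> by blast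
qed

lemma Q_center_subfield: "subfield (ring_center Q) Q"
proof (rule Q.subfieldI)
  let ?K = "ring_center Q"
  have neg: "\<ominus>\<^bsub>Q\<^esub> frac a s = frac (\<ominus> a) s" if "a \<in> carrier R" "s \<in> S" for a s
    by (rule Q.minus_equality)
       (use that in \<open>simp_all add: Q_add frac_closed l_neg Q_zero'[of s]\<close>)
  have "subring ?K Q"
  proof (rule Q.subringI)
    show "?K \<subseteq> carrier Q" unfolding ring_center_def by blast
    show "\<one>\<^bsub>Q\<^esub> \<in> ?K"
      unfolding Q_center Q_one using center_one denom_one by blast
    show "\<ominus>\<^bsub>Q\<^esub> U \<in> ?K" if "U \<in> ?K" for U
    proof -
      obtain z s where *: "U = frac z s" "z \<in> Z" "s \<in> S"
        using \<open>U \<in> ?K\<close> unfolding Q_center by blast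
      then have "\<ominus>\<^bsub>Q\<^esub> U = frac (\<ominus> z) s"
        by (simp add: neg center_closed)
      then show ?thesis
        unfolding Q_center using * center_minus by blast
    qed
    fix U V assume UV: "U \<in> ?K" "V \<in> ?K"
    then obtain y t z s where *: "U = frac z s" "V = frac y t" "z \<in> Z" "s \<in> S" "y \<in> Z" "t \<in> S"
      by (auto simp: Q_center)
    have "U \<otimes>\<^bsub>Q\<^esub> V = frac (z \<otimes> y) (s \<otimes> t)"
      using * by (simp add: Q_mult center_closed)
    moreover have "z \<otimes> y \<in> Z" "s \<otimes> t \<in> S"
      using * center_mult by auto
    ultimately show "U \<otimes>\<^bsub>Q\<^esub> V \<in> ?K"
      unfolding Q_center by blast
    have "U \<oplus>\<^bsub>Q\<^esub> V = frac (z \<otimes> t \<oplus> y \<otimes> s) (s \<otimes> t)"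
      using * by (simp add: Q_add_general center_closed)
    moreover have "z \<otimes> t \<oplus> y \<otimes> s \<in> Z"
      using * by (simp add: center_add center_mult denom_center)
    ultimately show "U \<oplus>\<^bsub>Q\<^esub> V \<in> ?K"
      unfolding Q_center using \<open>s \<otimes> t \<in> S\<close> by blast
  qed
  then show "subcring ?K Q"
    by (rule Q.subcringI) (unfold ring_center_def, blast)
  show "Units (Q\<lparr>carrier := ?K\<rparr>) = ?K - {\<zero>\<^bsub>Q\<^esub>}"
  proof (intro equalityI subsetI)
    have nz: "\<one>\<^bsub>Q\<^esub> \<noteq> \<zero>\<^bsub>Q\<^esub>"
      by (simp add: Q_one Q_zero frac_eq_iff one_not_zero)
    fix U assume "U \<in> Units (Q\<lparr>carrier := ?K\<rparr>)"
    then obtain V where "U \<in> ?K" "V \<in> ?K" "V \<otimes>\<^bsub>Q\<^esub> U = \<one>\<^bsub>Q\<^esub>"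
      by (auto simp: Units_def)
    moreover have "V \<in> carrier Q"
      using \<open>V \<in> ?K\<close> unfolding ring_center_def by blast
    ultimately show "U \<in> ?K - {\<zero>\<^bsub>Q\<^esub>}"
      using nz Q.r_null by (metis DiffI singletonD)
  next
    fix U assume U: "U \<in> ?K - {\<zero>\<^bsub>Q\<^esub>}"
    then obtain z s where *: "U = frac z s" "z \<in> Z" "s \<in> S"
      unfolding Q_center by blast
    have "z \<noteq> \<zero>"
      using U * Q_zero'[of s] by blast
    then have z: "z \<in> S"
      using * by (simp add: central_denominators_def)
    have "frac s z \<in> ?K"
      unfolding Q_center using * z denom_center by blast
    moreover have "U \<otimes>\<^bsub>Q\<^esub> frac s z = \<one>\<^bsub>Q\<^esub>" "frac s z \<otimes>\<^bsub>Q\<^esub> U = \<one>\<^bsub>Q\<^esub>"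
      using * z by (simp_all add: Q_mult denom_commutes[of s z] Q_one'[of "s \<otimes> z"])
    ultimately show "U \<in> Units (Q\<lparr>carrier := ?K\<rparr>)"
      using U unfolding Units_def by simp blast
  qed
qed

section \<open>The PI degree from a basis over the center\<close>

lemma common_denominator_center:
  assumes "set Ks \<subseteq> ring_center Q"
  obtains zs s where "s \<in> S" "set zs \<subseteq> Z" "Ks = map (\<lambda>z. frac z s) zs"
  using assms
proof (induction Ks arbitrary: thesis)
  case Nil
  show ?case by (rule Nil(1)[of \<one> "[]"]) auto
next
  case (Cons U Ks)
  then obtain zs s where 1: "s \<in> S" "set zs \<subseteq> Z" "Ks = map (\<lambda>z. frac z s) zs"
    by (metis set_subset_Cons subset_trans)
  from Cons.prems obtain z t where 2: "z \<in> Z" "t \<in> S" "U = frac z t"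
    unfolding Q_center by force
  show ?case
  proof (rule Cons.prems(1))
    show "t \<otimes> s \<in> S" using 1 2 by simp
    show "set (s \<otimes> z # map (\<lambda>z. t \<otimes> z) zs) \<subseteq> Z"
      using 1 2 by (auto simp: center_mult denom_center subset_iff)
    show "U # Ks = map (\<lambda>z. frac z (t \<otimes> s)) (s \<otimes> z # map (\<lambda>z. t \<otimes> z) zs)"
    proof -
      have "frac w s = frac (t \<otimes> w) (t \<otimes> s)" if "w \<in> set zs" for w
        using 1 2 that by (intro frac_expand) (auto intro: center_closed)
      moreover have "frac z t = frac (s \<otimes> z) (t \<otimes> s)"
        using 1 2 frac_expand[of z t s] denom_commutes[of t s] center_closed by simp
      ultimately show ?thesis
        using 1 2 by simp
    qed
  qed
qed

lemma Q_combine: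
  assumes "s \<in> S" "set zs \<subseteq> carrier R" "set us \<subseteq> carrier R"
  shows "Q.combine (map (\<lambda>z. frac z s) zs) (map (\<lambda>u. frac u \<one>) us) = frac (combine zs us) s"
  using assms
  by (induction zs us rule: combine.induct) (auto simp: Q_mult Q_add Q_zero' combine_in_carrier)

text \<open>All hypotheses concern \<open>R\<close> itself: clearing a common central denominator
  turns independence and spanning in \<open>Q\<close> over its center into independence over
  \<open>Z\<close> and spanning up to a factor in \<open>S\<close>. Uniqueness of the dimension over
  a field and injectivity of squaring settle the definite description.\<close>

theorem PI_degree_eqI:
  assumes len: "length us = d ^ 2" and us: "set us \<subseteq> carrier R"
    and indep: "\<And>zs. \<lbrakk>set zs \<subseteq> Z; length zs = length us; combine zs us = \<zero>\<rbrakk> \<Longrightarrow> set zs \<subseteq> {\<zero>}"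
    and span: "\<And>a. a \<in> carrier R \<Longrightarrow> \<exists>s\<in>S. \<exists>zs. set zs \<subseteq> Z \<and> s \<otimes> a = combine zs us"
  shows "PI_degree R = d"
proof -
  let ?K = "ring_center Q" and ?us = "map (\<lambda>u. frac u \<one>) us"
  have K: "?K \<subseteq> carrier Q"
    unfolding ring_center_def by blast
  have us': "set ?us \<subseteq> carrier Q"
    using us by (auto intro!: frac_closed)
  have "Q.independent ?K ?us"
  proof (rule Q.trivial_combine_imp_independent[OF Q_center_subfield us'])
    fix Ks0 assume Ks0: "set Ks0 \<subseteq> ?K" "Q.combine Ks0 ?us = \<zero>\<^bsub>Q\<^esub>"
    \<comment> \<open>Coefficient lists in the library's criterion may have any length, and
      \<open>combine\<close> stops at the shorter list. Normalization truncates or pads with zeros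
      to the length of \<open>us\<close>.\<close>
    then obtain Ks where Ks: "set (take (length us) Ks0) \<subseteq> set Ks" "set Ks \<subseteq> ?K"
      "length Ks = length us" "Q.combine Ks ?us = \<zero>\<^bsub>Q\<^esub>"
    proof -
      obtain Ks where Ks: "set (take (length ?us) Ks0) \<subseteq> set Ks"
          "set Ks \<subseteq> set (take (length ?us) Ks0) \<union> {\<zero>\<^bsub>Q\<^esub>}"
          "length Ks = length ?us" "Q.combine Ks ?us = \<zero>\<^bsub>Q\<^esub>"
        using Q.combine_normalize[OF subset_trans[OF Ks0(1) K] us' Ks0(2)] by metis
      have "\<zero>\<^bsub>Q\<^esub> \<in> ?K"
        using subringE(2)[OF subfieldE(1)[OF Q_center_subfield]] .
      then have "set Ks \<subseteq> ?K"
        using Ks0(1) Ks(2) set_take_subset[of "length ?us" Ks0] by blast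
      then show thesis
        using Ks by (intro that) simp_all
    qed
    obtain zs s where zs: "s \<in> S" "set zs \<subseteq> Z" "Ks = map (\<lambda>z. frac z s) zs"
      by (rule common_denominator_center[OF Ks(2)])
    have zs': "set zs \<subseteq> carrier R"
      using zs center_closed by auto
    have "frac (combine zs us) s = frac \<zero> s"
      using Ks(4) Q_combine[OF zs(1) zs' us] unfolding zs(3) Q_zero'[OF zs(1)] by simp
    then have "s \<otimes> combine zs us = s \<otimes> \<zero>"
      using zs(1) zs' us by (subst (asm) frac_eq_iff) simp_all
    then have "combine zs us = \<zero>"
      using denom_cancel[OF zs(1), of "combine zs us" \<zero>] zs' us by simp
    then have "set zs \<subseteq> {\<zero>}"
      using zs(2) Ks(3) by (intro indep) (simp_all add: zs(3))
    then have "set Ks \<subseteq> {\<zero>\<^bsub>Q\<^esub>}"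
      unfolding zs(3) Q_zero'[OF zs(1)] by auto
    then show "set (take (length ?us) Ks0) \<subseteq> {\<zero>\<^bsub>Q\<^esub>}"
      using Ks(1) by auto
  qed
  then have "Q.dimension (length ?us) ?K (Q.Span ?K ?us)"
    by (rule Q.dimension_independent)
  moreover have "Q.Span ?K ?us = carrier Q"
  proof
    show "Q.Span ?K ?us \<subseteq> carrier Q"
      by (rule Q.Span_in_carrier[OF K us'])
    show "carrier Q \<subseteq> Q.Span ?K ?us"
    proof
      fix U assume "U \<in> carrier Q"
      then obtain a t where a: "a \<in> carrier R" "t \<in> S" "U = frac a t"
        unfolding Q_carrier by blast
      obtain s zs where zs: "s \<in> S" "set zs \<subseteq> Z" "s \<otimes> a = combine zs us"
        using span[OF a(1)] by blast
      have "U = frac (combine zs us) (s \<otimes> t)"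
        using a zs(1) by (simp add: frac_expand[of a t s] flip: zs(3))
      also have "\<dots> = Q.combine (map (\<lambda>z. frac z (s \<otimes> t)) zs) ?us"
        using a zs us center_closed by (intro Q_combine[symmetric] subsetI) auto
      finally have "U = Q.combine (map (\<lambda>z. frac z (s \<otimes> t)) zs) ?us" .
      moreover have "s \<otimes> t \<in> S"
        using zs(1) a(2) by simp
      then have "set (map (\<lambda>z. frac z (s \<otimes> t)) zs) \<subseteq> ?K"
        unfolding Q_center using zs(2) by auto
      ultimately show "U \<in> Q.Span ?K ?us"
        unfolding Q.Span_eq_combine_set[OF Q_center_subfield us'] by blast
    qed
  qed
  ultimately have dim: "Q.dimension (d ^ 2) ?K (carrier Q)"
    using len by simp
  show ?thesis
    unfolding PI_degree_def
  proof (rule the_equality)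
    show "Q.dimension (d ^ 2) ?K (carrier Q)"
      by (rule dim)
    fix e assume "Q.dimension (e ^ 2) ?K (carrier Q)"
    then have "e ^ 2 = d ^ 2"
      by (rule Q.dimension_is_inj[OF Q_center_subfield _ dim])
    then show "e = d" by simp
  qed
qed

end

section \<open>Twisted group algebras\<close>

lemma poly_mapping_sum_singles:
  fixes f :: "'a \<Rightarrow>\<^sub>0 'b::comm_monoid_add"
  assumes "finite A" "Poly_Mapping.keys f \<subseteq> A"
  shows "f = (\<Sum>u\<in>A. Poly_Mapping.single u (Poly_Mapping.lookup f u))"
proof (rule poly_mapping_eqI)
  fix k
  have "Poly_Mapping.lookup (\<Sum>u\<in>A. Poly_Mapping.single u (Poly_Mapping.lookup f u)) k
      = (\<Sum>u\<in>A. if k = u then Poly_Mapping.lookup f u else 0)"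
    by (auto simp: lookup_sum lookup_single when_def intro!: sum.cong)
  also have "\<dots> = Poly_Mapping.lookup f k"
    using assms by (auto simp: in_keys_iff subset_iff)
  finally show "Poly_Mapping.lookup f k
      = Poly_Mapping.lookup (\<Sum>u\<in>A. Poly_Mapping.single u (Poly_Mapping.lookup f u)) k" ..
qed

lemma poly_mapping_single_induct [case_names zero single add]:
  fixes f :: "'a \<Rightarrow>\<^sub>0 'b::comm_monoid_add"
  assumes zero: "P 0" and single: "\<And>u c. P (Poly_Mapping.single u c)"
    and add: "\<And>f g. P f \<Longrightarrow> P g \<Longrightarrow> P (f + g)"
  shows "P f"
proof -
  have "P (\<Sum>u\<in>A. Poly_Mapping.single u (Poly_Mapping.lookup f u))" if "finite A" for A
    using that by induction (use assms in auto)
  then show ?thesis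
    using poly_mapping_sum_singles[of "Poly_Mapping.keys f" f] by (metis finite_keys order_refl)
qed

text \<open>A bimultiplicative \<open>\<chi>\<close> is a 2-cocycle, which makes the twisted product
  associative. The total order on the exponents provides leading terms.\<close>

locale twisted_group_algebra =
  fixes \<chi> :: "'e::linordered_ab_group_add \<Rightarrow> 'e \<Rightarrow> 'k::field"
  assumes chi_add_left: "\<chi> (u + v) w = \<chi> u w * \<chi> v w"
    and chi_add_right: "\<chi> u (v + w) = \<chi> u v * \<chi> u w"
    and chi_nonzero [simp]: "\<chi> u v \<noteq> 0"
begin

abbreviation single where "single \<equiv> Poly_Mapping.single :: 'e \<Rightarrow> 'k \<Rightarrow> 'e \<Rightarrow>\<^sub>0 'k"
abbreviation lookup where "lookup \<equiv> Poly_Mapping.lookup :: ('e \<Rightarrow>\<^sub>0 'k) \<Rightarrow> 'e \<Rightarrow> 'k"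
abbreviation keys where "keys \<equiv> Poly_Mapping.keys :: ('e \<Rightarrow>\<^sub>0 'k) \<Rightarrow> 'e set"

definition tmult :: "('e \<Rightarrow>\<^sub>0 'k) \<Rightarrow> ('e \<Rightarrow>\<^sub>0 'k) \<Rightarrow> ('e \<Rightarrow>\<^sub>0 'k)" (infixl "\<diamondop>" 70) where
  "f \<diamondop> g = (\<Sum>u\<in>keys f. \<Sum>v\<in>keys g. single (u + v) (lookup f u * lookup g v * \<chi> u v))"

lemma chi_zero_left [simp]: "\<chi> 0 v = 1"
  using chi_add_left[of 0 0 v] by simp

lemma chi_zero_right [simp]: "\<chi> v 0 = 1"
  using chi_add_right[of v 0 0] by simp

text \<open>Supports shrink under cancellation, so identities between products are proved by summing
  over common finite supersets of the supports.\<close>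

lemma tmult_superset:
  assumes "finite A" "finite B" "keys f \<subseteq> A" "keys g \<subseteq> B"
  shows "f \<diamondop> g = (\<Sum>u\<in>A. \<Sum>v\<in>B. single (u + v) (lookup f u * lookup g v * \<chi> u v))"
proof -
  have "f \<diamondop> g = (\<Sum>u\<in>keys f. \<Sum>v\<in>B. single (u + v) (lookup f u * lookup g v * \<chi> u v))"
    unfolding tmult_def using assms
    by (intro sum.cong sum.mono_neutral_left) (auto simp: in_keys_iff)
  also have "\<dots> = (\<Sum>u\<in>A. \<Sum>v\<in>B. single (u + v) (lookup f u * lookup g v * \<chi> u v))"
    using assms by (intro sum.mono_neutral_left) (auto simp: in_keys_iff)
  finally show ?thesis .
qed

lemma tmult_add_left: "(f + g) \<diamondop> h = f \<diamondop> h + g \<diamondop> h"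
  using keys_add[of f g]
  by (simp add: tmult_superset[of "keys f \<union> keys g" "keys h"] lookup_add algebra_simps
      single_add sum.distrib)

lemma tmult_add_right: "h \<diamondop> (f + g) = h \<diamondop> f + h \<diamondop> g"
  using keys_add[of f g]
  by (simp add: tmult_superset[of "keys h" "keys f \<union> keys g"] lookup_add algebra_simps
      single_add sum.distrib)

lemma tmult_zero_left [simp]: "0 \<diamondop> f = 0" and tmult_zero_right [simp]: "f \<diamondop> 0 = 0"
  by (simp_all add: tmult_def)

lemma tmult_sum_left: "(\<Sum>i\<in>I. F i) \<diamondop> g = (\<Sum>i\<in>I. F i \<diamondop> g)"
  by (induction I rule: infinite_finite_induct) (auto simp: tmult_add_left)

lemma tmult_sum_right: "g \<diamondop> (\<Sum>i\<in>I. F i) = (\<Sum>i\<in>I. g \<diamondop> F i)"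
  by (induction I rule: infinite_finite_induct) (auto simp: tmult_add_right)

lemma tmult_minus_left: "(- f) \<diamondop> g = - (f \<diamondop> g)"
  using tmult_add_left[of "- f" f g] by (simp add: eq_neg_iff_add_eq_0)

lemma tmult_minus_right: "g \<diamondop> (- f) = - (g \<diamondop> f)"
  using tmult_add_right[of g "- f" f] by (simp add: eq_neg_iff_add_eq_0)

lemma tmult_diff_left: "(f - g) \<diamondop> h = f \<diamondop> h - g \<diamondop> h"
  using tmult_add_left[of f "- g" h] by (simp add: tmult_minus_left)

lemma tmult_diff_right: "h \<diamondop> (f - g) = h \<diamondop> f - h \<diamondop> g"
  using tmult_add_right[of h f "- g"] by (simp add: tmult_minus_right)

lemma tmult_single: "single u a \<diamondop> single v b = single (u + v) (a * b * \<chi> u v)"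
  by (simp add: tmult_superset[of "{u}" "{v}"])

lemma tmult_assoc: "f \<diamondop> g \<diamondop> h = f \<diamondop> (g \<diamondop> h)"
proof (induction f rule: poly_mapping_single_induct)
  case (single u a)
  show ?case
  proof (induction g rule: poly_mapping_single_induct)
    case (single v b)
    show ?case
      by (induction h rule: poly_mapping_single_induct)
         (simp_all add: tmult_single tmult_add_right chi_add_left chi_add_right algebra_simps)
  qed (simp_all add: tmult_add_left tmult_add_right)
qed (simp_all add: tmult_add_left)

lemma one_tmult [simp]: "1 \<diamondop> f = f"
  by (induction f rule: poly_mapping_single_induct)
     (simp_all add: tmult_single tmult_add_right flip: single_one)

lemma tmult_one [simp]: "f \<diamondop> 1 = f"
  by (induction f rule: poly_mapping_single_induct)
     (simp_all add: tmult_single tmult_add_left flip: single_one)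

lemma scalar_central: "single 0 c \<diamondop> f = f \<diamondop> single 0 c"
  by (induction f rule: poly_mapping_single_induct)
     (simp_all add: tmult_single tmult_add_left tmult_add_right mult.commute)

section \<open>The twisted group algebra as a ring without zero divisors\<close>

definition T :: "('e \<Rightarrow>\<^sub>0 'k) ring" where
  "T = \<lparr>carrier = UNIV, monoid.mult = (\<diamondop>), one = 1, ring.zero = 0, ring.add = (+)\<rparr>"

lemma T_simps [simp]:
  "carrier T = UNIV" "monoid.mult T = (\<diamondop>)" "one T = 1" "ring.zero T = 0" "ring.add T = (+)"
  by (simp_all add: T_def)

lemma T_ring: "ring T"
proof (rule ringI)
  show "abelian_group T"
    by (rule abelian_groupI) (auto simp: add_ac intro: exI[of _ "- _"])
  show "monoid T"
    by (rule monoidI) (auto simp: tmult_assoc)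
qed (auto simp: tmult_add_left tmult_add_right)

sublocale T: ring T
  by (rule T_ring)

lemma lookup_single_tmult: "lookup (single u c \<diamondop> f) (u + v) = c * lookup f v * \<chi> u v"
  by (induction f rule: poly_mapping_single_induct)
     (auto simp: tmult_single tmult_add_right lookup_single lookup_add when_def algebra_simps)

lemma lookup_tmult_single: "lookup (f \<diamondop> single u c) (u + v) = c * lookup f v * \<chi> v u"
  by (induction f rule: poly_mapping_single_induct)
     (auto simp: tmult_single tmult_add_left lookup_single lookup_add when_def algebra_simps)

lemma keys_tmult: "keys (f \<diamondop> g) \<subseteq> {u + v | u v. u \<in> keys f \<and> v \<in> keys g}"
proof -
  have *: "lookup (f \<diamondop> g) w = 0" if "\<And>u v. u \<in> keys f \<Longrightarrow> v \<in> keys g \<Longrightarrow> w \<noteq> u + v" for w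
    unfolding tmult_def lookup_sum by (intro sum.neutral ballI) (use that in \<open>auto simp: lookup_single when_def\<close>)
  show ?thesis
  proof (rule subsetI, rule ccontr)
    fix w assume w: "w \<in> keys (f \<diamondop> g)" "w \<notin> {u + v | u v. u \<in> keys f \<and> v \<in> keys g}"
    have "lookup (f \<diamondop> g) w = 0"
      by (rule *) (use w(2) in blast)
    then show False
      using w(1) by (simp add: in_keys_iff)
  qed
qed

text \<open>Separated out because it serves two notions of leading term: the largest exponent in the
  group order (\<open>tmult_eq_zero\<close>), and later the exponent of largest weight
  (\<open>leads_mult\<close>).\<close>

lemma lookup_tmult_unique:
  assumes "m \<in> keys f" "n \<in> keys g"
    and unique: "\<And>u v. \<lbrakk>u \<in> keys f; v \<in> keys g; u + v = m + n\<rbrakk> \<Longrightarrow> u = m \<and> v = n"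
  shows "lookup (f \<diamondop> g) (m + n) = lookup f m * lookup g n * \<chi> m n"
proof -
  have "lookup (f \<diamondop> g) (m + n)
      = (\<Sum>u\<in>keys f. \<Sum>v\<in>keys g. if u = m \<and> v = n then lookup f m * lookup g n * \<chi> m n else 0)"
    unfolding tmult_def lookup_sum
  proof (intro sum.cong refl)
    fix u v assume "u \<in> keys f" "v \<in> keys g"
    then have "u + v = m + n \<longleftrightarrow> u = m \<and> v = n"
      using unique[of u v] by blast
    then show "lookup (single (u + v) (lookup f u * lookup g v * \<chi> u v)) (m + n)
        = (if u = m \<and> v = n then lookup f m * lookup g n * \<chi> m n else 0)"
      by (simp add: lookup_single when_def)
  qed
  also have "\<dots> = (\<Sum>u\<in>keys f. if u = m then lookup f m * lookup g n * \<chi> m n else 0)"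
    using assms(2) by (intro sum.cong refl) auto
  also have "\<dots> = lookup f m * lookup g n * \<chi> m n"
    using assms(1) by simp
  finally show ?thesis .
qed

text \<open>The leading exponents of two factors add up.\<close>

lemma tmult_eq_zero:
  assumes "f \<diamondop> g = 0"
  shows "f = 0 \<or> g = 0"
proof (rule ccontr)
  assume "\<not> ?thesis"
  then have nz: "keys f \<noteq> {}" "keys g \<noteq> {}"
    by simp_all
  define m where "m = Max (keys f)"
  define n where "n = Max (keys g)"
  have mn: "m \<in> keys f" "n \<in> keys g"
    using nz by (simp_all add: m_def n_def)
  have "u = m \<and> v = n" if "u \<in> keys f" "v \<in> keys g" "u + v = m + n" for u v
  proof -
    have "u \<le> m" "v \<le> n"
      using that by (simp_all add: m_def n_def)
    then show ?thesis
      using that(3) add_less_le_mono[of u m v n] add_le_less_mono[of u m v n]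
      by (auto simp: order.order_iff_strict)
  qed
  then have "lookup (f \<diamondop> g) (m + n) = lookup f m * lookup g n * \<chi> m n"
    by (intro lookup_tmult_unique mn)
  then show False
    using assms mn by (simp add: in_keys_iff)
qed

text \<open>Reduces a \<open>q\<close>-commutation relation to a check on exponents, also for
  elements with several terms, as long as all pairs of terms share one factor
  \<open>k\<close>.\<close>

lemma tmult_commute_scalar:
  assumes "\<And>u v. \<lbrakk>u \<in> keys f; v \<in> keys g\<rbrakk> \<Longrightarrow> \<chi> u v = k * \<chi> v u"
  shows "f \<diamondop> g = single 0 k \<diamondop> (g \<diamondop> f)"
proof -
  have "f \<diamondop> g = (\<Sum>u\<in>keys f. \<Sum>v\<in>keys g.
      single 0 k \<diamondop> single (v + u) (lookup g v * lookup f u * \<chi> v u))"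
    unfolding tmult_def
    by (intro sum.cong refl) (simp add: tmult_single add.commute assms mult_ac)
  also have "\<dots> = single 0 k \<diamondop> (\<Sum>v\<in>keys g. \<Sum>u\<in>keys f.
      single (v + u) (lookup g v * lookup f u * \<chi> v u))"
    unfolding tmult_sum_right by (rule sum.swap)
  finally show ?thesis
    by (simp only: tmult_def[of g f])
qed

section \<open>The standard identity\<close>

definition tprod :: "('e \<Rightarrow>\<^sub>0 'k) list \<Rightarrow> ('e \<Rightarrow>\<^sub>0 'k)" where
  "tprod fs = foldr (\<diamondop>) fs 1"

lemma tprod_simps [simp]: "tprod [] = 1" "tprod (f # fs) = f \<diamondop> tprod fs"
  by (simp_all add: tprod_def)

abbreviation perm_word :: "nat \<Rightarrow> (nat \<Rightarrow> nat) \<Rightarrow> nat list" where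
  "perm_word N \<sigma> \<equiv> map \<sigma> [0..<Suc N]"

text \<open>The standard polynomial of degree \<open>N + 1\<close>, as the positions are
  \<open>0\<close> to \<open>N\<close>. The sign is a case distinction, so that only additive
  structure is involved.\<close>

definition std :: "nat \<Rightarrow> (nat \<Rightarrow> 'e \<Rightarrow>\<^sub>0 'k) \<Rightarrow> ('e \<Rightarrow>\<^sub>0 'k)" where
  "std N a = (\<Sum>\<sigma> | \<sigma> permutes {..N}.
     if evenperm \<sigma> then tprod (map a (perm_word N \<sigma>)) else - tprod (map a (perm_word N \<sigma>)))"

lemma tprod_update_add:
  assumes "distinct xs" "k \<in> set xs"
  shows "tprod (map (a(k := f + g)) xs) = tprod (map (a(k := f)) xs) + tprod (map (a(k := g)) xs)"
  using assms
proof (induction xs)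
  case (Cons x xs)
  show ?case
  proof (cases "x = k")
    case True
    then have k: "k \<notin> set xs"
      using Cons.prems by simp
    show ?thesis
      unfolding True by (simp only: list.map tprod_simps map_fun_upd[OF k] fun_upd_same tmult_add_left)
  next
    case False
    then have "tprod (map (a(k := f + g)) xs)
        = tprod (map (a(k := f)) xs) + tprod (map (a(k := g)) xs)"
      by (intro Cons.IH) (use Cons.prems in simp_all)
    then show ?thesis
      by (simp only: list.map tprod_simps fun_upd_other[OF False] tmult_add_right)
  qed
qed simp

lemma tprod_update_scale:
  assumes "distinct xs" "k \<in> set xs" "\<And>l. l \<in> set xs \<Longrightarrow> z \<diamondop> a l = a l \<diamondop> z"
  shows "tprod (map (a(k := z \<diamondop> a k)) xs) = z \<diamondop> tprod (map a xs)"
  using assms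
proof (induction xs)
  case (Cons x xs)
  show ?case
  proof (cases "x = k")
    case True
    then have k: "k \<notin> set xs"
      using Cons.prems by simp
    show ?thesis
      unfolding True by (simp only: list.map tprod_simps map_fun_upd[OF k] fun_upd_same tmult_assoc)
  next
    case False
    then have "tprod (map (a(k := z \<diamondop> a k)) xs) = z \<diamondop> tprod (map a xs)"
      by (intro Cons.IH) (use Cons.prems in simp_all)
    then have "tprod (map (a(k := z \<diamondop> a k)) (x # xs)) = a x \<diamondop> (z \<diamondop> tprod (map a xs))"
      by (simp only: list.map tprod_simps fun_upd_other[OF False])
    also have "\<dots> = z \<diamondop> (a x \<diamondop> tprod (map a xs))"
      using Cons.prems(3)[of x] by (simp flip: tmult_assoc)
    finally show ?thesis
      by (simp only: list.map tprod_simps)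
  qed
qed simp

lemma perm_word_props:
  assumes "\<sigma> permutes {..N}"
  shows "distinct (perm_word N \<sigma>)" "set (perm_word N \<sigma>) = {..N}" "length (perm_word N \<sigma>) = Suc N"
proof -
  have "{0..<Suc N} = {..N}" by auto
  then show "distinct (perm_word N \<sigma>)" "set (perm_word N \<sigma>) = {..N}"
    using permutes_inj_on[OF assms] permutes_image[OF assms]
    by (simp_all only: distinct_map distinct_upt set_map set_upt)
qed simp

lemma std_update_add:
  assumes "k \<le> N"
  shows "std N (a(k := f + g)) = std N (a(k := f)) + std N (a(k := g))"
proof -
  have "tprod (map (a(k := f + g)) (perm_word N \<sigma>))
      = tprod (map (a(k := f)) (perm_word N \<sigma>)) + tprod (map (a(k := g)) (perm_word N \<sigma>))"
    if "\<sigma> permutes {..N}" for \<sigma>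
    using perm_word_props[OF that] assms by (intro tprod_update_add) auto
  then show ?thesis
    unfolding std_def sum.distrib[symmetric] by (intro sum.cong) auto
qed

lemma std_update_zero:
  assumes "k \<le> N"
  shows "std N (a(k := 0)) = 0"
  using std_update_add[OF assms, of a 0 0] by (metis add.right_neutral add_left_imp_eq)

lemma std_update_sum:
  assumes "k \<le> N"
  shows "std N (a(k := (\<Sum>i\<in>I. F i))) = (\<Sum>i\<in>I. std N (a(k := F i)))"
  by (induction I rule: infinite_finite_induct)
     (simp_all only: sum.infinite sum.empty sum.insert std_update_add[OF assms]
       std_update_zero[OF assms] not_False_eq_True)

text \<open>It is enough that \<open>z\<close> commutes with the arguments, and this matters:
  monomials with exponents in the radical of a sublattice need not be central in the whole
  torus.\<close>

lemma std_update_scale: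
  assumes "k \<le> N" "\<And>l. l \<le> N \<Longrightarrow> z \<diamondop> a l = a l \<diamondop> z"
  shows "std N (a(k := z \<diamondop> a k)) = z \<diamondop> std N a"
proof -
  have "tprod (map (a(k := z \<diamondop> a k)) (perm_word N \<sigma>)) = z \<diamondop> tprod (map a (perm_word N \<sigma>))"
    if "\<sigma> permutes {..N}" for \<sigma>
    using perm_word_props[OF that] assms by (intro tprod_update_scale) auto
  then show ?thesis
    unfolding std_def tmult_sum_right by (intro sum.cong) (auto simp: tmult_minus_right)
qed

text \<open>Composition with the transposition of \<open>i\<close> and \<open>j\<close> pairs even
  with odd permutations and leaves the product unchanged, because \<open>a i = a j\<close>. The even
  and odd sums thus agree term by term, so no division by 2 occurs and characteristic 2 is
  covered.\<close>

lemma std_alternating: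
  assumes ij: "i \<le> N" "j \<le> N" "i \<noteq> j" and eq: "a i = a j"
  shows "std N a = 0"
proof -
  let ?P = "\<lambda>\<sigma>. tprod (map a (perm_word N \<sigma>))"
  let ?E = "{\<sigma>. \<sigma> permutes {..N} \<and> evenperm \<sigma>}" and ?O = "{\<sigma>. \<sigma> permutes {..N} \<and> \<not> evenperm \<sigma>}"
  let ?\<tau> = "Transposition.transpose i j"
  have \<tau>: "?\<tau> permutes {..N}"
    using ij by (intro permutes_swap_id) auto
  have fin: "finite {\<sigma>. \<sigma> permutes {..N}}"
    by (rule finite_permutations) simp
  have P: "?P (?\<tau> \<circ> \<sigma>) = ?P \<sigma>" for \<sigma>
  proof -
    have "a (?\<tau> k) = a k" for k
      using eq by (auto simp: Transposition.transpose_def)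
    then show ?thesis by (simp add: comp_def)
  qed
  have par: "evenperm (?\<tau> \<circ> \<sigma>) \<longleftrightarrow> \<not> evenperm \<sigma>" if "\<sigma> permutes {..N}" for \<sigma>
    using evenperm_comp[of ?\<tau> \<sigma>] that \<tau> ij
    by (auto simp: evenperm_swap permutes_imp_permutation[of "{..N}"])
  have EO: "{\<sigma>. \<sigma> permutes {..N}} \<inter> {\<sigma>. evenperm \<sigma>} = ?E"
      "{\<sigma>. \<sigma> permutes {..N}} \<inter> - {\<sigma>. evenperm \<sigma>} = ?O"
    by auto
  have invol: "?\<tau> \<circ> (?\<tau> \<circ> \<sigma>) = \<sigma>" for \<sigma>
    by (simp add: fun_eq_iff)
  have closed: "?\<tau> \<circ> \<sigma> permutes {..N}" if "\<sigma> permutes {..N}" for \<sigma>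
    using permutes_compose[OF that \<tau>] .
  have "std N a = (\<Sum>\<sigma>\<in>?E. ?P \<sigma>) + (\<Sum>\<sigma>\<in>?O. - ?P \<sigma>)"
    unfolding std_def sum.If_cases[OF fin] EO ..
  also have "(\<Sum>\<sigma>\<in>?O. - ?P \<sigma>) = - (\<Sum>\<sigma>\<in>?O. ?P \<sigma>)"
    by (rule sum_negf)
  also have "(\<Sum>\<sigma>\<in>?O. ?P \<sigma>) = (\<Sum>\<sigma>\<in>?E. ?P \<sigma>)"
  proof (rule sum.reindex_bij_witness[of _ "\<lambda>\<sigma>. ?\<tau> \<circ> \<sigma>" "\<lambda>\<sigma>. ?\<tau> \<circ> \<sigma>"])
    show "?P (?\<tau> \<circ> \<sigma>) = ?P \<sigma>" for \<sigma>
      by (rule P)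
  qed (use closed in \<open>simp_all only: invol mem_Collect_eq par not_not simp_thms\<close>)
  finally show ?thesis by simp
qed

text \<open>
  The alternating multilinear map \<open>std\<close> vanishes on a module with fewer than \<open>N + 1\<close> generators
  over the center, here the monomials with exponents in a transversal of the radical.
\<close>

lemma std_eq_zero:
  assumes D: "finite D" "card D \<le> N"
    and rep: "\<And>u. u \<in> L \<Longrightarrow> rep u \<in> D"
    and rad: "\<And>u v w. \<lbrakk>u \<in> L; v \<in> L; w \<in> L; rep u = rep v\<rbrakk> \<Longrightarrow> \<chi> (u - v) w = \<chi> w (u - v)"
    and a: "\<And>i. i \<le> N \<Longrightarrow> keys (a i) \<subseteq> L"
  shows "std N a = 0"
proof -
  \<comment> \<open>Case of monomial arguments: by the pigeonhole principle two of the
    \<open>N + 1\<close> exponents have the same representative, so they differ by a radical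
    exponent.\<close>
  have mono: "std N (\<lambda>i. single (g i) (c i)) = 0" if g: "\<And>i. i \<le> N \<Longrightarrow> g i \<in> L" for g c
  proof -
    have "(\<lambda>i. rep (g i)) ` {..N} \<subseteq> D"
      using g rep by auto
    then have "card ((\<lambda>i. rep (g i)) ` {..N}) \<le> card D"
      by (rule card_mono[OF D(1)])
    also have "\<dots> < card {..N}"
      using D(2) by simp
    finally have "card ((\<lambda>i. rep (g i)) ` {..N}) < card {..N}" .
    then have "\<not> inj_on (\<lambda>i. rep (g i)) {..N}"
      by (rule pigeonhole)
    then obtain i j where ij: "i \<le> N" "j \<le> N" "i \<noteq> j" "rep (g i) = rep (g j)"
      by (auto simp: inj_on_def)
    \<comment> \<open>In \<open>b\<close> the arguments at \<open>i\<close> and \<open>j\<close> are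
      made equal, so \<open>std N b = 0\<close>. The original arguments are recovered by multiplying
      the entry at \<open>j\<close> by \<open>single w d\<close>, which commutes with all arguments,
      and the entry at \<open>i\<close> by the scalar \<open>c i\<close>; \<open>d\<close> contains
      the inverse of the twist that the first product creates. Scaling up from coefficient 1 also
      covers zero coefficients.\<close>
    define b where "b = (\<lambda>i. single (g i) (c i))(j := single (g i) 1, i := single (g i) 1)"
    have bi: "b i = single (g i) 1" and bj: "b j = single (g i) 1"
      using ij by (simp_all add: b_def)
    define w where "w = g j - g i"
    define d where "d = c j / \<chi> w (g i)"
    define b' where "b' = b(j := single w d \<diamondop> b j)"
    have bL: "\<exists>v e. b l = single v e \<and> v \<in> L" if "l \<le> N" for l
    proof (cases "l = i \<or> l = j")
      case True
      then show ?thesis using bi bj g[OF ij(1)] by blast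
    next
      case False
      then have "b l = single (g l) (c l)" by (simp add: b_def)
      then show ?thesis using g[OF that] by blast
    qed
    have comm: "single w d \<diamondop> b l = b l \<diamondop> single w d" if l: "l \<le> N" for l
    proof -
      obtain v e where v: "b l = single v e" "v \<in> L"
        using bL[OF l] by blast
      have "\<chi> w v = \<chi> v w"
        unfolding w_def using ij g v(2) by (intro rad) simp_all
      then show ?thesis
        by (simp add: v(1) tmult_single add.commute mult.commute)
    qed
    have "std N b' = single w d \<diamondop> std N b"
      unfolding b'_def using ij(2) comm by (rule std_update_scale)
    also have "std N b = 0"
      by (rule std_alternating[OF ij(1-3)]) (simp add: bi bj)
    finally have b'0: "std N b' = 0" by simp
    have "std N (b'(i := single 0 (c i) \<diamondop> b' i)) = single 0 (c i) \<diamondop> std N b'"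
      using ij(1) scalar_central by (rule std_update_scale)
    also have "b'(i := single 0 (c i) \<diamondop> b' i) = (\<lambda>i. single (g i) (c i))"
    proof
      fix l
      consider "l = i" | "l = j" "l \<noteq> i" | "l \<noteq> i" "l \<noteq> j" by blast
      then show "(b'(i := single 0 (c i) \<diamondop> b' i)) l = single (g l) (c l)"
      proof cases
        case 1
        then show ?thesis
          using ij(3) bi by (simp add: b'_def tmult_single)
      next
        case 2
        then show ?thesis
          using bj by (simp add: b'_def tmult_single d_def w_def)
      next
        case 3
        then show ?thesis
          by (simp add: b'_def b_def)
      qed
    qed
    finally show ?thesis
      unfolding b'0 by simp
  qed
  \<comment> \<open>General arguments by multilinearity: \<open>K\<close> contains the positions
    whose entries have not yet been split into monomials.\<close>
  have "std N a = 0" if "finite K" "K \<subseteq> {..N}" "\<And>i. i \<le> N \<Longrightarrow> keys (a i) \<subseteq> L"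
    "\<And>i. i \<notin> K \<Longrightarrow> \<exists>v c. a i = single v c \<and> (i \<le> N \<longrightarrow> v \<in> L)" for K a
    using that
  proof (induction K arbitrary: a)
    case empty
    then have "\<forall>i. \<exists>v c. a i = single v c \<and> (i \<le> N \<longrightarrow> v \<in> L)"
      by blast
    then obtain g c where gc: "\<And>i. a i = single (g i) (c i)" "\<And>i. i \<le> N \<Longrightarrow> g i \<in> L"
      by metis
    have "a = (\<lambda>i. single (g i) (c i))"
      using gc(1) by (rule ext)
    then show ?case
      using mono[OF gc(2)] by simp
  next
    case (insert k K)
    have k: "k \<le> N" using insert by auto
    have "std N a = std N (a(k := (\<Sum>v\<in>keys (a k). single v (lookup (a k) v))))"
      using poly_mapping_sum_singles[of "keys (a k)" "a k"] by simp
    also have "\<dots> = (\<Sum>v\<in>keys (a k). std N (a(k := single v (lookup (a k) v))))"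
      by (rule std_update_sum[OF k])
    also have "\<dots> = 0"
    proof (intro sum.neutral ballI insert.IH)
      fix v assume v: "v \<in> keys (a k)"
      then have vL: "v \<in> L"
        using insert.prems(2)[OF k] by auto
      show "K \<subseteq> {..N}" using insert.prems by auto
      show "keys ((a(k := single v (lookup (a k) v))) i) \<subseteq> L" if "i \<le> N" for i
        using insert.prems(2)[OF that] vL by auto
      show "\<exists>va c. (a(k := single v (lookup (a k) v))) i = single va c \<and> (i \<le> N \<longrightarrow> va \<in> L)"
        if "i \<notin> K" for i
        using insert.prems(3)[of i] that vL by (cases "i = k") auto
    qed
    finally show ?case .
  qed
  note * = this
  \<comment> \<open>Positions beyond \<open>N\<close> do not enter \<open>std\<close>; setting them
    to zero makes them monomials, as the induction demands of every position outside
    \<open>K\<close>.\<close>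
  define a' where "a' = (\<lambda>i. if i \<le> N then a i else 0)"
  have "std N a' = 0"
    by (rule *[of "{..N}"]) (use a in \<open>auto simp: a'_def intro!: exI[of _ 0]\<close>)
  moreover have "std N a = std N a'"
    unfolding std_def by (intro sum.cong refl if_cong arg_cong[of _ _ tprod] arg_cong[of _ _ uminus] map_cong)
      (use perm_word_props(2) in \<open>auto simp: a'_def permutes_in_image\<close>)
  ultimately show ?thesis by simp
qed

end

section \<open>The standard polynomial over the integers\<close>

definition std_poly :: "nat \<Rightarrow> (nat list \<Rightarrow>\<^sub>0 int)" where
  "std_poly N = (\<Sum>\<sigma> | \<sigma> permutes {..N}.
     Poly_Mapping.single (map \<sigma> [0..<Suc N]) (if evenperm \<sigma> then 1 else - 1))"

lemma perm_word_inj: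
  assumes "\<sigma> permutes {..N}" "\<tau> permutes {..N}" "map \<sigma> [0..<Suc N] = map \<tau> [0..<Suc N]"
  shows "\<sigma> = \<tau>"
proof
  fix k
  have "\<sigma> k = \<tau> k" if "k \<le> N"
    using assms(3) that unfolding map_eq_conv by (simp del: upt_Suc)
  moreover have "\<sigma> k = \<tau> k" if "\<not> k \<le> N"
    using that permutes_not_in[OF assms(1), of k] permutes_not_in[OF assms(2), of k] by simp
  ultimately show "\<sigma> k = \<tau> k" by blast
qed

lemma lookup_std_poly:
  assumes "\<sigma> permutes {..N}"
  shows "Poly_Mapping.lookup (std_poly N) (map \<sigma> [0..<Suc N]) = (if evenperm \<sigma> then 1 else - 1)"
proof -
  have "Poly_Mapping.lookup (std_poly N) (map \<sigma> [0..<Suc N])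
      = (\<Sum>\<tau> | \<tau> permutes {..N}. if \<tau> = \<sigma> then if evenperm \<sigma> then 1 else - 1 else 0)"
    unfolding std_poly_def lookup_sum
  proof (intro sum.cong refl)
    fix \<tau> assume "\<tau> \<in> {\<tau>. \<tau> permutes {..N}}"
    then have "map \<tau> [0..<Suc N] = map \<sigma> [0..<Suc N] \<longleftrightarrow> \<tau> = \<sigma>"
      using perm_word_inj[OF _ assms, of \<tau>] by blast
    then show "Poly_Mapping.lookup (Poly_Mapping.single (map \<tau> [0..<Suc N])
        (if evenperm \<tau> then 1 else - 1)) (map \<sigma> [0..<Suc N])
      = (if \<tau> = \<sigma> then if evenperm \<sigma> then 1 else - 1 else (0 :: int))"
      unfolding lookup_single when_def by simp
  qed
  then show ?thesis
    using assms by (simp add: finite_permutations del: map_map upt_Suc)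
qed

lemma keys_std_poly:
  "Poly_Mapping.keys (std_poly N) = (\<lambda>\<sigma>. map \<sigma> [0..<Suc N]) ` {\<sigma>. \<sigma> permutes {..N}}"
proof
  show "Poly_Mapping.keys (std_poly N) \<subseteq> (\<lambda>\<sigma>. map \<sigma> [0..<Suc N]) ` {\<sigma>. \<sigma> permutes {..N}}"
    unfolding std_poly_def by (rule order.trans[OF keys_sum]) (auto split: if_splits)
  show "(\<lambda>\<sigma>. map \<sigma> [0..<Suc N]) ` {\<sigma>. \<sigma> permutes {..N}} \<subseteq> Poly_Mapping.keys (std_poly N)"
    using lookup_std_poly[of _ N] by (auto simp: in_keys_iff simp del: upt_Suc split: if_splits)
qed

text \<open>The identity permutation is even, so its word has coefficient 1, and all words have the
  same length.\<close>

lemma monic_std_poly: "monic_free (std_poly N)"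
  unfolding monic_free_def
proof (intro exI[of _ "map id [0..<Suc N]"] conjI ballI)
  show "Poly_Mapping.lookup (std_poly N) (map id [0..<Suc N]) = 1"
    by (subst lookup_std_poly) (simp_all add: permutes_id)
qed (auto simp: keys_std_poly)

section \<open>Domains embedded into a quantum torus\<close>

context twisted_group_algebra
begin

definition rad :: "'e set \<Rightarrow> 'e set" where
  "rad L = {u \<in> L. \<forall>v\<in>L. \<chi> u v = \<chi> v u}"

lemma chi_diff_right: "\<chi> u (v - w) = \<chi> u v / \<chi> u w"
  using chi_add_right[of u "v - w" w] by (simp add: field_simps)

lemma chi_diff_left: "\<chi> (v - w) u = \<chi> v u / \<chi> w u"
  using chi_add_left[of "v - w" w u] by (simp add: field_simps)

lemma rad_central:
  assumes "keys f \<subseteq> rad L" "keys g \<subseteq> L"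
  shows "f \<diamondop> g = g \<diamondop> f"
  using tmult_commute_scalar[of f g 1] assms by (auto simp: rad_def subset_iff)

end

text \<open>
  A ring \<open>R\<close> between the monoid algebra of \<open>C\<close> and the torus with exponent lattice \<open>L\<close>,
  where \<open>L\<close> is the group of differences of \<open>C\<close>, and a transversal \<open>D\<close> of the radical in \<open>L\<close>.
\<close>

locale torus_embedding = twisted_group_algebra \<chi> + R: ring R
  for \<chi> :: "'e::linordered_ab_group_add \<Rightarrow> 'e \<Rightarrow> 'k::field" and R :: "('a, 'b) ring_scheme" (structure) +
  fixes \<psi> :: "'a \<Rightarrow> 'e \<Rightarrow>\<^sub>0 'k" and L C D :: "'e set"
  assumes hom: "\<psi> \<in> ring_hom R T" and inj: "inj_on \<psi> (carrier R)"
    and L_zero: "0 \<in> L" and L_diff: "u \<in> L \<Longrightarrow> v \<in> L \<Longrightarrow> u - v \<in> L"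
    and image_keys: "a \<in> carrier R \<Longrightarrow> keys (\<psi> a) \<subseteq> L"
    and C_zero: "0 \<in> C" and C_add: "u \<in> C \<Longrightarrow> v \<in> C \<Longrightarrow> u + v \<in> C"
    and C_image: "u \<in> C \<Longrightarrow> single u c \<in> \<psi> ` carrier R"
    and fractions: "u \<in> L \<Longrightarrow> \<exists>v\<in>C. \<exists>w\<in>C. u = v - w"
    and torsion: "v \<in> C \<Longrightarrow> \<exists>w\<in>C. v + w \<in> rad L"
    and D_finite: "finite D" and D_L: "D \<subseteq> L"
    and D_transversal: "u \<in> L \<Longrightarrow> \<exists>!\<delta>. \<delta> \<in> D \<and> u - \<delta> \<in> rad L"
begin

lemma hom_mult: "a \<in> carrier R \<Longrightarrow> b \<in> carrier R \<Longrightarrow> \<psi> (a \<otimes> b) = \<psi> a \<diamondop> \<psi> b"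
  and hom_add: "a \<in> carrier R \<Longrightarrow> b \<in> carrier R \<Longrightarrow> \<psi> (a \<oplus> b) = \<psi> a + \<psi> b"
  and hom_one: "\<psi> \<one> = 1"
  using ring_hom_memE[OF hom] by simp_all

lemma hom_zero: "\<psi> \<zero> = 0"
  using hom_add[of \<zero> \<zero>] by (metis R.zero_closed R.l_zero add.right_neutral add_left_imp_eq)

lemma hom_minus: "a \<in> carrier R \<Longrightarrow> \<psi> (\<ominus> a) = - \<psi> a"
  using hom_add[of "\<ominus> a" a] by (simp add: R.l_neg hom_zero eq_neg_iff_add_eq_0)

lemma hom_eq_zero_iff: "a \<in> carrier R \<Longrightarrow> \<psi> a = 0 \<longleftrightarrow> a = \<zero>"
  using inj_onD[OF inj, of a \<zero>] hom_zero by auto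

sublocale R: noncommutative_domain R
proof
  show "\<one> \<noteq> \<zero>"
    using hom_one hom_zero by auto
  show "a = \<zero> \<or> b = \<zero>" if "a \<in> carrier R" "b \<in> carrier R" "a \<otimes> b = \<zero>" for a b
    using tmult_eq_zero[of "\<psi> a" "\<psi> b"] that hom_mult hom_zero hom_eq_zero_iff by metis
qed

lemma L_uminus: "u \<in> L \<Longrightarrow> - u \<in> L"
  using L_diff[OF L_zero] by simp

lemma L_add: "u \<in> L \<Longrightarrow> v \<in> L \<Longrightarrow> u + v \<in> L"
  using L_diff[of u "- v"] L_uminus by simp

lemma rad_L: "u \<in> rad L \<Longrightarrow> u \<in> L"
  by (simp add: rad_def)

lemma rad_diff: "u \<in> rad L \<Longrightarrow> v \<in> rad L \<Longrightarrow> u - v \<in> rad L"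
  by (auto simp: rad_def L_diff chi_diff_left chi_diff_right)

lemma rad_zero: "0 \<in> rad L"
  by (simp add: rad_def L_zero)

lemma rad_add: "u \<in> rad L \<Longrightarrow> v \<in> rad L \<Longrightarrow> u + v \<in> rad L"
  using rad_diff[of u "0 - v"] rad_diff[OF rad_zero, of v] by simp

lemma C_L: "u \<in> C \<Longrightarrow> u \<in> L"
  using C_image[of u 1] image_keys by (metis imageE insert_subset keys_single zero_neq_one)

definition rep :: "'e \<Rightarrow> 'e" where
  "rep u = (THE \<delta>. \<delta> \<in> D \<and> u - \<delta> \<in> rad L)"

lemma rep_D: "u \<in> L \<Longrightarrow> rep u \<in> D" and rep_rad: "u \<in> L \<Longrightarrow> u - rep u \<in> rad L"
  using theI'[OF D_transversal, of u] by (simp_all add: rep_def)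

lemma D_unique: "\<lbrakk>\<delta> \<in> D; \<delta>' \<in> D; \<delta> - \<delta>' \<in> rad L\<rbrakk> \<Longrightarrow> \<delta> = \<delta>'"
  using D_transversal[of \<delta>] D_L rad_zero by (metis diff_self subsetD)

text \<open>Write \<open>u = v - w\<close> with \<open>v\<close>, \<open>w\<close> in
  \<open>C\<close> and complete \<open>w\<close> to a radical element \<open>w + w'\<close> by
  \<open>torsion\<close>. Adding \<open>w + w'\<close> to \<open>u\<close> gives
  \<open>v + w'\<close>, which lies in \<open>C\<close>; the translations for finitely many
  \<open>u\<close> are added up.\<close>

lemma deep_translate:
  assumes "finite U" "U \<subseteq> L"
  shows "\<exists>t. t \<in> C \<and> t \<in> rad L \<and> (\<forall>u\<in>U. u + t \<in> C)"
  using assms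
proof induction
  case empty
  show ?case using C_zero rad_zero by blast
next
  case (insert u U)
  then obtain t where t: "t \<in> C" "t \<in> rad L" "\<forall>u\<in>U. u + t \<in> C" by blast
  obtain v w where vw: "v \<in> C" "w \<in> C" "u = v - w"
    using fractions[of u] insert.prems by blast
  obtain w' where w': "w' \<in> C" "w + w' \<in> rad L"
    using torsion[OF vw(2)] by blast
  have "u + (t + (w + w')) = v + (t + w')"
    by (simp add: vw(3) algebra_simps)
  moreover have "u' + (t + (w + w')) \<in> C" if "u' \<in> U" for u'
    using C_add[of "u' + t" "w + w'"] C_add[OF vw(2) w'(1)] t(3) that by (simp add: add.assoc)
  ultimately show ?case
    using t vw w' by (intro exI[of _ "t + (w + w')"]) (simp add: C_add rad_add)
qed

text \<open>Only monomials with exponents in \<open>C\<close> are known to lie in the image. They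
  suffice as test elements, because every exponent in \<open>L\<close> is a difference of two in
  \<open>C\<close> and \<open>\<chi>\<close> is multiplicative.\<close>

lemma center_iff:
  assumes z: "z \<in> carrier R"
  shows "z \<in> ring_center R \<longleftrightarrow> keys (\<psi> z) \<subseteq> rad L"
proof
  assume zc: "z \<in> ring_center R"
  show "keys (\<psi> z) \<subseteq> rad L"
  proof
    fix u assume u: "u \<in> keys (\<psi> z)"
    have C: "\<chi> u v = \<chi> v u" if v: "v \<in> C" for v
    proof -
      obtain x where x: "x \<in> carrier R" "\<psi> x = single v 1"
        using C_image[OF v, of 1] by force
      have "\<psi> z \<diamondop> single v 1 = single v 1 \<diamondop> \<psi> z"
        using R.center_commutes[OF zc x(1)] hom_mult[OF x(1) z] hom_mult[OF z x(1)] x(2) by simp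
      then have "lookup (\<psi> z \<diamondop> single v 1) (v + u) = lookup (single v 1 \<diamondop> \<psi> z) (v + u)"
        by simp
      then show ?thesis
        using u unfolding lookup_tmult_single lookup_single_tmult by (simp add: in_keys_iff)
    qed
    have "\<chi> u v = \<chi> v u" if "v \<in> L" for v
      using fractions[OF that] C by (auto simp: chi_diff_left chi_diff_right)
    moreover have "u \<in> L"
      using u image_keys[OF z] by blast
    ultimately show "u \<in> rad L"
      by (simp add: rad_def)
  qed
next
  assume k: "keys (\<psi> z) \<subseteq> rad L"
  show "z \<in> ring_center R"
  proof (rule R.centerI[OF z])
    fix x assume x: "x \<in> carrier R"
    have "\<psi> (z \<otimes> x) = \<psi> (x \<otimes> z)"
      unfolding hom_mult[OF z x] hom_mult[OF x z] by (rule rad_central[OF k image_keys[OF x]])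
    then show "z \<otimes> x = x \<otimes> z"
      by (rule inj_onD[OF inj]) (use z x in simp_all)
  qed
qed

lemma hom_finsum:
  assumes "finite A" "F \<in> A \<rightarrow> carrier R"
  shows "\<psi> (finsum R F A) = (\<Sum>x\<in>A. \<psi> (F x))"
  using assms
proof induction
  case empty
  then show ?case by (simp add: hom_zero)
next
  case (insert x A)
  then have "F x \<in> carrier R" "F \<in> A \<rightarrow> carrier R" by auto
  then show ?case
    using insert by (simp add: R.finsum_insert hom_add R.finsum_closed)
qed

lemma eval_word_hom:
  assumes "range a \<subseteq> carrier R"
  shows "eval_word R a w \<in> carrier R" "\<psi> (eval_word R a w) = tprod (map (\<lambda>i. \<psi> (a i)) w)"
proof (induction w)
  case Nil
  show "eval_word R a [] \<in> carrier R" "\<psi> (eval_word R a []) = tprod (map (\<lambda>i. \<psi> (a i)) [])"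
    by (simp_all add: eval_word_def hom_one)
next
  case (Cons i w)
  have "a i \<in> carrier R" using assms by blast
  moreover have "eval_word R a (i # w) = a i \<otimes> eval_word R a w"
    by (simp add: eval_word_def)
  ultimately show "eval_word R a (i # w) \<in> carrier R"
      "\<psi> (eval_word R a (i # w)) = tprod (map (\<lambda>i. \<psi> (a i)) (i # w))"
    using Cons by (simp_all add: hom_mult)
qed

lemma eval_free_std_poly:
  assumes a: "range a \<subseteq> carrier R"
  shows "eval_free R a (std_poly N) \<in> carrier R"
    "\<psi> (eval_free R a (std_poly N)) = std N (\<lambda>i. \<psi> (a i))"
proof -
  let ?W = "\<lambda>\<sigma>. map \<sigma> [0..<Suc N]" and ?P = "{\<sigma>. \<sigma> permutes {..N}}"
  let ?F = "\<lambda>w. [Poly_Mapping.lookup (std_poly N) w] \<cdot>\<^bsub>R\<^esub> eval_word R a w"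
  have closed: "?F \<in> Poly_Mapping.keys (std_poly N) \<rightarrow> carrier R"
    using eval_word_hom(1)[OF a] by simp
  then show "eval_free R a (std_poly N) \<in> carrier R"
    unfolding eval_free_def by (rule R.finsum_closed)
  have inj: "inj_on ?W ?P"
    by (rule inj_onI) (use perm_word_inj in blast)
  have F: "\<psi> (?F (?W \<sigma>)) = (if evenperm \<sigma> then tprod (map (\<lambda>i. \<psi> (a i)) (?W \<sigma>))
      else - tprod (map (\<lambda>i. \<psi> (a i)) (?W \<sigma>)))" if "\<sigma> \<in> ?P" for \<sigma>
  proof -
    have "[(- 1 :: int)] \<cdot>\<^bsub>R\<^esub> eval_word R a (?W \<sigma>) = \<ominus> eval_word R a (?W \<sigma>)"
      using eval_word_hom(1)[OF a] R.add.int_pow_neg[of "eval_word R a (?W \<sigma>)" 1]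
        R.add.int_pow_1[of "eval_word R a (?W \<sigma>)"] by simp
    moreover have "[(1 :: int)] \<cdot>\<^bsub>R\<^esub> eval_word R a (?W \<sigma>) = eval_word R a (?W \<sigma>)"
      using eval_word_hom(1)[OF a] by (rule R.add.int_pow_1)
    ultimately show ?thesis
      using lookup_std_poly[of \<sigma> N] that
      by (simp only: mem_Collect_eq hom_minus[OF eval_word_hom(1)[OF a]] eval_word_hom(2)[OF a]
          split: if_split) simp
  qed
  have "\<psi> (eval_free R a (std_poly N)) = (\<Sum>w\<in>?W ` ?P. \<psi> (?F w))"
    unfolding eval_free_def using hom_finsum[OF _ closed] by (simp only: keys_std_poly[symmetric] finite_keys)
  also have "\<dots> = (\<Sum>\<sigma>\<in>?P. \<psi> (?F (?W \<sigma>)))"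
    by (subst sum.reindex[OF inj]) (simp only: comp_def)
  also have "\<dots> = std N (\<lambda>i. \<psi> (a i))"
    unfolding std_def by (rule sum.cong[OF refl F])
  finally show "\<psi> (eval_free R a (std_poly N)) = std N (\<lambda>i. \<psi> (a i))" .
qed

lemma PI_ring: "PI_ring R"
  unfolding PI_ring_def
proof (intro conjI exI[of _ "std_poly (card D)"] allI impI monic_std_poly)
  show "ring R" by (rule R.ring_axioms)
  fix a :: "nat \<Rightarrow> 'a" assume a: "range a \<subseteq> carrier R"
  have "std (card D) (\<lambda>i. \<psi> (a i)) = 0"
  proof (rule std_eq_zero[OF D_finite order_refl rep_D])
    fix u v w assume uv: "u \<in> L" "v \<in> L" "w \<in> L" "rep u = rep v"
    have "u - v = (u - rep u) - (v - rep v)"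
      using uv(4) by simp
    then have "u - v \<in> rad L"
      using rad_diff[OF rep_rad[OF uv(1)] rep_rad[OF uv(2)]] by simp
    then show "\<chi> (u - v) w = \<chi> w (u - v)"
      using uv(3) by (simp add: rad_def)
  qed (use a image_keys in auto)
  then show "eval_free R a (std_poly (card D)) = \<zero>"
    using eval_free_std_poly[OF a] hom_eq_zero_iff by metis
qed

section \<open>A basis over the center\<close>

lemma hom_combine:
  assumes "distinct ds" "\<And>\<delta>. \<delta> \<in> set ds \<Longrightarrow> z \<delta> \<in> carrier R" "\<And>\<delta>. \<delta> \<in> set ds \<Longrightarrow> m \<delta> \<in> carrier R"
  shows "\<psi> (R.combine (map z ds) (map m ds)) = (\<Sum>\<delta>\<in>set ds. \<psi> (z \<delta>) \<diamondop> \<psi> (m \<delta>))"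
  using assms
proof (induction ds)
  case Nil
  then show ?case by (simp add: hom_zero)
next
  case (Cons \<delta> ds)
  have "R.combine (map z ds) (map m ds) \<in> carrier R"
    using Cons.prems by (intro R.combine_in_carrier) auto
  then show ?case
    using Cons by (simp add: hom_add hom_mult)
qed

lemma image_sum:
  assumes "finite A" "\<And>x. x \<in> A \<Longrightarrow> F x \<in> \<psi> ` carrier R"
  shows "(\<Sum>x\<in>A. F x) \<in> \<psi> ` carrier R"
  using assms
proof induction
  case empty
  show ?case
    using imageI[OF R.zero_closed, of \<psi>] by (simp add: hom_zero)
next
  case (insert x A)
  then have "F x \<in> \<psi> ` carrier R" "(\<Sum>x\<in>A. F x) \<in> \<psi> ` carrier R"
    by simp_all
  then obtain a b where ab: "a \<in> carrier R" "b \<in> carrier R" "F x = \<psi> a" "(\<Sum>x\<in>A. F x) = \<psi> b"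
    by (elim imageE) blast
  then have "(\<Sum>x\<in>insert x A. F x) = \<psi> (a \<oplus> b)"
    using insert.hyps by (simp add: hom_add)
  then show ?case
    using ab(1,2) by simp
qed

text \<open>The basis consists of the monomials with exponents \<open>\<delta> + t0\<close>. The
  radical element \<open>t0\<close> moves the transversal into \<open>C\<close>, where monomials
  lift to \<open>R\<close>, without changing the classes modulo the radical. Central elements have
  exponents in the radical, so multiplication by them preserves each class: this gives independence,
  and sorting the terms of an element by class gives spanning.\<close>

theorem PI_degree:
  assumes d: "card D = d ^ 2"
  shows "PI_degree R = d"
proof -
  obtain t0 where t0: "t0 \<in> rad L" "\<And>\<delta>. \<delta> \<in> D \<Longrightarrow> \<delta> + t0 \<in> C"
    using deep_translate[OF D_finite D_L] by blast
  define pre where "pre = inv_into (carrier R) \<psi>"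
  have pre: "pre f \<in> carrier R" "\<psi> (pre f) = f" if "f \<in> \<psi> ` carrier R" for f
    using that unfolding pre_def by (simp_all add: inv_into_into f_inv_into_f)
  define m where "m \<delta> = pre (single (\<delta> + t0) 1)" for \<delta>
  have m: "m \<delta> \<in> carrier R" "\<psi> (m \<delta>) = single (\<delta> + t0) 1" if "\<delta> \<in> D" for \<delta>
    using pre[OF C_image[OF t0(2)[OF that]]] by (simp_all add: m_def)
  obtain ds where ds: "set ds = D" "distinct ds"
    using finite_distinct_list[OF D_finite] by blast
  show ?thesis
  proof (rule R.PI_degree_eqI[of "map m ds"])
    show "length (map m ds) = d ^ 2"
      using ds d distinct_card by fastforce
    show "set (map m ds) \<subseteq> carrier R"
      using ds m by auto
  next
    fix zs assume zs: "set zs \<subseteq> ring_center R" "length zs = length (map m ds)"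
      "R.combine zs (map m ds) = \<zero>"
    define z where "z \<delta> = the (map_of (zip ds zs) \<delta>)" for \<delta>
    have zs_eq: "zs = map z ds"
      using zs(2) by (intro nth_equalityI) (simp_all add: z_def map_of_zip_nth ds(2))
    have zc: "z \<delta> \<in> ring_center R" if "\<delta> \<in> D" for \<delta>
      using zs(1) that ds(1) unfolding zs_eq by auto
    note zR = R.center_closed[OF zc]
    have sum0: "(\<Sum>\<delta>\<in>D. \<psi> (z \<delta>) \<diamondop> single (\<delta> + t0) 1) = 0"
      using hom_combine[OF ds(2), of z m] zs(3) zR m hom_zero unfolding zs_eq ds(1) by simp
    have "z \<epsilon> = \<zero>" if \<epsilon>: "\<epsilon> \<in> D" for \<epsilon>
    proof -
      have "lookup (\<psi> (z \<epsilon>)) \<rho> = 0" for \<rho>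
      proof (cases "\<rho> \<in> rad L")
        case False
        then show ?thesis
          using zc[OF \<epsilon>] center_iff[OF zR[OF \<epsilon>]] by (auto simp: in_keys_iff)
      next
        case True
        \<comment> \<open>At this exponent only the summand for \<open>\<epsilon>\<close> can
          contribute, since the exponents in the other summands lie in other classes modulo the
          radical.\<close>
        let ?w = "\<epsilon> + t0 + \<rho>"
        have other: "lookup (\<psi> (z \<delta>) \<diamondop> single (\<delta> + t0) 1) ?w = 0" if \<delta>: "\<delta> \<in> D" "\<delta> \<noteq> \<epsilon>" for \<delta>
        proof -
          have w: "?w = \<delta> + t0 + (\<rho> + \<epsilon> - \<delta>)"
            by (simp add: algebra_simps)
          have "\<rho> + \<epsilon> - \<delta> \<notin> rad L"
          proof
            assume "\<rho> + \<epsilon> - \<delta> \<in> rad L"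
            then have "\<rho> + \<epsilon> - \<delta> - \<rho> \<in> rad L"
              using True by (rule rad_diff)
            then have "\<epsilon> - \<delta> \<in> rad L" by (simp add: algebra_simps)
            then show False
              using D_unique \<delta> \<epsilon> by blast
          qed
          then have "lookup (\<psi> (z \<delta>)) (\<rho> + \<epsilon> - \<delta>) = 0"
            using zc[OF \<delta>(1)] center_iff[OF zR[OF \<delta>(1)]] by (auto simp: in_keys_iff)
          then show ?thesis
            unfolding w lookup_tmult_single by simp
        qed
        have "0 = lookup (\<Sum>\<delta>\<in>D. \<psi> (z \<delta>) \<diamondop> single (\<delta> + t0) 1) ?w"
          by (simp add: sum0)
        also have "\<dots> = (\<Sum>\<delta>\<in>D. lookup (\<psi> (z \<delta>) \<diamondop> single (\<delta> + t0) 1) ?w)"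
          by (rule lookup_sum)
        also have "\<dots> = lookup (\<psi> (z \<epsilon>) \<diamondop> single (\<epsilon> + t0) 1) ?w"
          using sum.remove[OF D_finite \<epsilon>, of "\<lambda>\<delta>. lookup (\<psi> (z \<delta>) \<diamondop> single (\<delta> + t0) 1) ?w"] other
          by simp
        also have "\<dots> = 1 * lookup (\<psi> (z \<epsilon>)) \<rho> * \<chi> \<rho> (\<epsilon> + t0)"
          by (rule lookup_tmult_single)
        finally show ?thesis by simp
      qed
      then have "\<psi> (z \<epsilon>) = 0"
        by (intro poly_mapping_eqI) simp
      then show ?thesis
        using hom_eq_zero_iff zR[OF \<epsilon>] by blast
    qed
    then show "set zs \<subseteq> {\<zero>}"
      unfolding zs_eq using ds(1) by auto
  next
    fix a assume a: "a \<in> carrier R"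
    define f where "f = \<psi> a"
    define U where "U = keys f"
    have U: "finite U" "U \<subseteq> L"
      using image_keys[OF a] by (simp_all add: U_def f_def)
    \<comment> \<open>The term at \<open>u\<close> is to become a central coefficient times the
      basis monomial at \<open>rep u + t0\<close>. The exponent of that coefficient is already in
      the radical, but perhaps not in \<open>C\<close>; the central factor with exponent
      \<open>t\<close> repairs this for all terms at once.\<close>
    have "finite ((\<lambda>u. u - (rep u + t0)) ` U)" "(\<lambda>u. u - (rep u + t0)) ` U \<subseteq> L"
      using U rep_D D_L rad_L[OF t0(1)] by (auto intro!: L_diff L_add)
    from deep_translate[OF this] obtain t where t: "t \<in> C" "t \<in> rad L"
      and tU: "\<And>u. u \<in> U \<Longrightarrow> u - (rep u + t0) + t \<in> C" by blast
    define e where "e u = u - (rep u + t0) + t" for u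
    have eC: "e u \<in> C" if "u \<in> U" for u
      using tU[OF that] by (simp add: e_def)
    have eR: "e u \<in> rad L" if "u \<in> U" for u
    proof -
      have "e u = (u - rep u) - t0 + t"
        by (simp add: e_def algebra_simps)
      moreover have "u - rep u \<in> rad L"
        using rep_rad U(2) that by blast
      ultimately show ?thesis
        using rad_add[OF rad_diff[OF _ t0(1)] t(2)] by simp
    qed
    \<comment> \<open>The scalar is dictated by the target: multiplying by the basis monomial
      introduces \<open>\<chi> (e u) (rep u + t0)\<close>, which is divided out, and the
      corresponding term of \<open>single t 1 \<diamondop> f\<close> has coefficient
      \<open>\<chi> t u * lookup f u\<close>.\<close>
    define h where "h \<delta> = (\<Sum>u\<in>{u \<in> U. rep u = \<delta>}.
      single (e u) (\<chi> t u * lookup f u / \<chi> (e u) (rep u + t0)))" for \<delta>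
    have h_image: "h \<delta> \<in> \<psi> ` carrier R" for \<delta>
      unfolding h_def by (intro image_sum C_image eC) (use U in auto)
    have h_keys: "keys (h \<delta>) \<subseteq> rad L" for \<delta>
      unfolding h_def by (rule order.trans[OF keys_sum]) (use eR in auto)
    define z where "z \<delta> = pre (h \<delta>)" for \<delta>
    have z: "z \<delta> \<in> carrier R" "\<psi> (z \<delta>) = h \<delta>" for \<delta>
      using pre[OF h_image] by (simp_all add: z_def)
    have zc: "z \<delta> \<in> ring_center R" for \<delta>
      using center_iff[OF z(1)] h_keys z(2) by simp
    define s where "s = pre (single t 1)"
    have s: "s \<in> carrier R" "\<psi> s = single t 1"
      using pre[OF C_image[OF t(1)]] by (simp_all add: s_def)
    have "s \<in> ring_center R"
      using center_iff[OF s(1)] t(2) s(2) by simp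
    moreover have "s \<noteq> \<zero>"
      using s hom_zero by (metis keys_single keys_zero insert_not_empty zero_neq_one)
    ultimately have sS: "s \<in> central_denominators R"
      by (simp add: central_denominators_def)
    have "\<psi> (R.combine (map z ds) (map m ds)) = (\<Sum>\<delta>\<in>D. h \<delta> \<diamondop> single (\<delta> + t0) 1)"
      using hom_combine[OF ds(2), of z m] z m ds(1) by simp
    also have "\<dots> = (\<Sum>\<delta>\<in>D. \<Sum>u\<in>{u \<in> U. rep u = \<delta>}. single (t + u) (\<chi> t u * lookup f u))"
    proof (intro sum.cong refl)
      fix \<delta>
      have "e u + (\<delta> + t0) = t + u" if "rep u = \<delta>" for u
        using that by (simp add: e_def algebra_simps)
      then show "h \<delta> \<diamondop> single (\<delta> + t0) 1
          = (\<Sum>u\<in>{u \<in> U. rep u = \<delta>}. single (t + u) (\<chi> t u * lookup f u))"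
        unfolding h_def tmult_sum_left by (intro sum.cong refl) (auto simp: tmult_single)
    qed
    also have "\<dots> = (\<Sum>u\<in>U. single (t + u) (\<chi> t u * lookup f u))"
      by (rule sum.group) (use U D_finite rep_D in auto)
    also have "\<dots> = single t 1 \<diamondop> (\<Sum>u\<in>U. single u (lookup f u))"
      unfolding tmult_sum_right by (simp add: tmult_single mult.commute)
    also have "(\<Sum>u\<in>U. single u (lookup f u)) = f"
      using poly_mapping_sum_singles[of U f] by (simp add: U_def)
    also have "single t 1 \<diamondop> f = \<psi> (s \<otimes> a)"
      using hom_mult[OF s(1) a] s(2) by (simp add: f_def)
    finally have eq: "\<psi> (s \<otimes> a) = \<psi> (R.combine (map z ds) (map m ds))" by simp
    have "s \<otimes> a = R.combine (map z ds) (map m ds)"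
    proof (rule inj_onD[OF inj eq])
      show "R.combine (map z ds) (map m ds) \<in> carrier R"
        using z(1) m(1) ds(1) by (intro R.combine_in_carrier) auto
    qed (use s(1) a in simp)
    moreover have "set (map z ds) \<subseteq> ring_center R"
      using zc by (simp add: image_subset_iff)
    ultimately show "\<exists>s\<in>central_denominators R. \<exists>zs. set zs \<subseteq> ring_center R \<and> s \<otimes> a = R.combine zs (map m ds)"
      using sS by blast
  qed
qed

end

section \<open>Homomorphisms from free algebras\<close>

lemma free_algebra_simps [simp]:
  "carrier (free_algebra V) = {f. \<forall>w\<in>Poly_Mapping.keys f. set w \<subseteq> V}"
  "monoid.mult (free_algebra V) = (*)" "one (free_algebra V) = 1"
  "ring.zero (free_algebra V) = 0" "ring.add (free_algebra V) = (+)"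
  by (simp_all add: free_algebra_def)

lemma free_algebra_ring: "ring (free_algebra V :: ('x list \<Rightarrow>\<^sub>0 'k::field) ring)"
proof (rule ringI)
  have minus: "Poly_Mapping.keys (- f) = Poly_Mapping.keys f" for f :: "'x list \<Rightarrow>\<^sub>0 'k"
    by (auto simp: in_keys_iff)
  show "abelian_group (free_algebra V :: ('x list \<Rightarrow>\<^sub>0 'k) ring)"
  proof (rule abelian_groupI)
    fix f g :: "'x list \<Rightarrow>\<^sub>0 'k"
    assume "f \<in> carrier (free_algebra V)" "g \<in> carrier (free_algebra V)"
    then show "f \<oplus>\<^bsub>free_algebra V\<^esub> g \<in> carrier (free_algebra V)"
      using keys_add[of f g] by auto
  next
    fix f :: "'x list \<Rightarrow>\<^sub>0 'k"
    assume "f \<in> carrier (free_algebra V)"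
    then show "\<exists>g\<in>carrier (free_algebra V). g \<oplus>\<^bsub>free_algebra V\<^esub> f = \<zero>\<^bsub>free_algebra V\<^esub>"
      by (intro bexI[of _ "- f"]) (simp_all add: minus)
  qed (simp_all add: add_ac)
  show "monoid (free_algebra V :: ('x list \<Rightarrow>\<^sub>0 'k) ring)"
  proof (rule monoidI)
    fix f g :: "'x list \<Rightarrow>\<^sub>0 'k"
    assume "f \<in> carrier (free_algebra V)" "g \<in> carrier (free_algebra V)"
    then show "f \<otimes>\<^bsub>free_algebra V\<^esub> g \<in> carrier (free_algebra V)"
      using keys_mult[of f g] by (fastforce simp: plus_list_def)
  qed (simp_all add: mult.assoc zero_list_def)
qed (simp_all add: distrib_left distrib_right)

context twisted_group_algebra
begin

lemma tprod_append: "tprod (fs @ gs) = tprod fs \<diamondop> tprod gs"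
  by (induction fs) (simp_all add: tmult_assoc)

definition free_hom :: "('x \<Rightarrow> 'e \<Rightarrow>\<^sub>0 'k) \<Rightarrow> ('x list \<Rightarrow>\<^sub>0 'k) \<Rightarrow> 'e \<Rightarrow>\<^sub>0 'k" where
  "free_hom \<gamma> f = (\<Sum>w\<in>Poly_Mapping.keys f. single 0 (Poly_Mapping.lookup f w) \<diamondop> tprod (map \<gamma> w))"

lemma free_hom_superset:
  assumes "finite A" "Poly_Mapping.keys f \<subseteq> A"
  shows "free_hom \<gamma> f = (\<Sum>w\<in>A. single 0 (Poly_Mapping.lookup f w) \<diamondop> tprod (map \<gamma> w))"
  unfolding free_hom_def using assms
  by (intro sum.mono_neutral_left) (auto simp: in_keys_iff)

lemma free_hom_add: "free_hom \<gamma> (f + g) = free_hom \<gamma> f + free_hom \<gamma> g"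
  using keys_add[of f g]
  by (simp add: free_hom_superset[of "Poly_Mapping.keys f \<union> Poly_Mapping.keys g"] lookup_add
      single_add tmult_add_left sum.distrib)

lemma free_hom_single: "free_hom \<gamma> (Poly_Mapping.single w c) = single 0 c \<diamondop> tprod (map \<gamma> w)"
  by (simp add: free_hom_superset[of "{w}"])

lemma free_hom_zero [simp]: "free_hom \<gamma> 0 = 0"
  by (simp add: free_hom_def)

lemma free_hom_minus: "free_hom \<gamma> (- f) = - free_hom \<gamma> f"
  using free_hom_add[of \<gamma> "- f" f] by (simp add: eq_neg_iff_add_eq_0)

lemma free_hom_diff: "free_hom \<gamma> (f - g) = free_hom \<gamma> f - free_hom \<gamma> g"
  using free_hom_add[of \<gamma> f "- g"] by (simp add: free_hom_minus)

lemma free_hom_sum: "free_hom \<gamma> (\<Sum>i\<in>I. F i) = (\<Sum>i\<in>I. free_hom \<gamma> (F i))"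
  by (induction I rule: infinite_finite_induct) (simp_all add: free_hom_add)

text \<open>On words this rests on the centrality of the scalars \<open>single 0 b\<close> in the
  torus, which lets them pass the image of the first word.\<close>

lemma free_hom_mult: "free_hom \<gamma> (f * g) = free_hom \<gamma> f \<diamondop> free_hom \<gamma> g"
proof (induction f rule: poly_mapping_single_induct)
  case (single v a)
  show ?case
  proof (induction g rule: poly_mapping_single_induct)
    case (single w b)
    have "free_hom \<gamma> (Poly_Mapping.single v a * Poly_Mapping.single w b)
        = (single 0 a \<diamondop> single 0 b) \<diamondop> (tprod (map \<gamma> v) \<diamondop> tprod (map \<gamma> w))"
      by (simp add: mult_single free_hom_single plus_list_def tprod_append tmult_single)
    also have "\<dots> = single 0 a \<diamondop> ((single 0 b \<diamondop> tprod (map \<gamma> v)) \<diamondop> tprod (map \<gamma> w))"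
      by (simp add: tmult_assoc)
    also have "\<dots> = (single 0 a \<diamondop> tprod (map \<gamma> v)) \<diamondop> (single 0 b \<diamondop> tprod (map \<gamma> w))"
      unfolding scalar_central[of b "tprod (map \<gamma> v)"] by (simp add: tmult_assoc)
    finally show ?case
      by (simp add: free_hom_single)
  qed (simp_all add: distrib_left free_hom_add tmult_add_right)
qed (simp_all add: distrib_right free_hom_add tmult_add_left)

lemma free_hom_one: "free_hom \<gamma> 1 = 1"
proof -
  have "free_hom \<gamma> (Poly_Mapping.single 0 1) = 1"
    unfolding free_hom_single zero_list_def by simp
  then show ?thesis by simp
qed

lemma free_hom_ring_hom: "ring_hom_ring (free_algebra V) T (free_hom \<gamma>)"
  by (intro ring_hom_ring.intro ring_hom_ring_axioms.intro ring_hom_memI free_algebra_ring T_ring)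
     (simp_all add: free_hom_mult free_hom_add free_hom_one)

end

section \<open>Normal forms modulo an ideal of a free algebra\<close>

text \<open>
  If every two-letter word \<open>a b\<close> with decreasing keys is, modulo the ideal, a combination of
  two-letter words starting with a letter of smaller key, then the words of the same length that
  are not sorted can be rewritten to lexicographically smaller ones.
\<close>

locale sorted_rewriting =
  fixes V :: "'x set" and key :: "'x \<Rightarrow> nat" and I :: "('x list \<Rightarrow>\<^sub>0 'k::field) set"
  assumes I: "ideal I (free_algebra V)"
    and rewrite: "\<lbrakk>a \<in> V; b \<in> V; key b < key a\<rbrakk> \<Longrightarrow> \<exists>h. Poly_Mapping.single [a, b] 1 - h \<in> I \<and>
      (\<forall>w\<in>Poly_Mapping.keys h. \<exists>c\<in>V. \<exists>d\<in>V. w = [c, d] \<and> key c < key a)"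
begin

definition sorted_words :: "'x list set" where
  "sorted_words = {w. set w \<subseteq> V \<and> sorted (map key w)}"

definition spanned :: "('x list \<Rightarrow>\<^sub>0 'k) \<Rightarrow> bool" where
  "spanned f \<longleftrightarrow> (\<exists>g. Poly_Mapping.keys g \<subseteq> sorted_words \<and> f - g \<in> I)"

lemma I_add: "f \<in> I \<Longrightarrow> g \<in> I \<Longrightarrow> f + g \<in> I"
  and I_zero: "0 \<in> I"
  using additive_subgroup.a_closed[OF ideal.axioms(1)[OF I]]
    additive_subgroup.zero_closed[OF ideal.axioms(1)[OF I]] by simp_all

lemma I_mult_left: "f \<in> I \<Longrightarrow> (\<And>w. w \<in> Poly_Mapping.keys x \<Longrightarrow> set w \<subseteq> V) \<Longrightarrow> x * f \<in> I"
  and I_mult_right: "f \<in> I \<Longrightarrow> (\<And>w. w \<in> Poly_Mapping.keys x \<Longrightarrow> set w \<subseteq> V) \<Longrightarrow> f * x \<in> I"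
  using ideal.I_l_closed[OF I, of f x] ideal.I_r_closed[OF I, of f x] by simp_all

lemma spanned_add:
  assumes "spanned f" "spanned f'"
  shows "spanned (f + f')"
proof -
  obtain g g' where g: "Poly_Mapping.keys g \<subseteq> sorted_words" "f - g \<in> I"
      "Poly_Mapping.keys g' \<subseteq> sorted_words" "f' - g' \<in> I"
    using assms unfolding spanned_def by blast
  have "f + f' - (g + g') = (f - g) + (f' - g')" by simp
  then have "f + f' - (g + g') \<in> I"
    using I_add g by metis
  then show ?thesis
    unfolding spanned_def using keys_add[of g g'] g by blast
qed

lemma spanned_scale:
  assumes "spanned f"
  shows "spanned (Poly_Mapping.single [] c * f)"
proof -
  obtain g where g: "Poly_Mapping.keys g \<subseteq> sorted_words" "f - g \<in> I"
    using assms unfolding spanned_def by blast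
  have "Poly_Mapping.single [] c * (f - g) \<in> I"
    using g(2) by (rule I_mult_left) (auto split: if_splits)
  then have "Poly_Mapping.single [] c * f - Poly_Mapping.single [] c * g \<in> I"
    by (simp add: right_diff_distrib)
  moreover have "Poly_Mapping.keys (Poly_Mapping.single [] c * g) \<subseteq> Poly_Mapping.keys g"
    using keys_mult[of "Poly_Mapping.single [] c" g] by (auto simp: plus_list_def split: if_splits)
  ultimately show ?thesis
    unfolding spanned_def using g(1) by blast
qed

lemma spanned_zero: "spanned 0"
  unfolding spanned_def using I_zero by (intro exI[of _ 0]) simp

lemma spanned_sum:
  assumes "\<And>x. x \<in> A \<Longrightarrow> spanned (F x)"
  shows "spanned (\<Sum>x\<in>A. F x)"
  using assms
  by (induction A rule: infinite_finite_induct) (simp_all add: spanned_zero spanned_add)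

lemma spanned_if_words_spanned:
  assumes "\<And>w. w \<in> Poly_Mapping.keys f \<Longrightarrow> spanned (Poly_Mapping.single w 1)"
  shows "spanned f"
proof -
  have eq: "f = (\<Sum>w\<in>Poly_Mapping.keys f.
      Poly_Mapping.single [] (Poly_Mapping.lookup f w) * Poly_Mapping.single w 1)"
    using poly_mapping_sum_singles[of "Poly_Mapping.keys f" f]
    by (simp add: mult_single plus_list_def)
  show ?thesis
    by (subst eq) (intro spanned_sum spanned_scale assms)
qed

lemma spanned_shift:
  assumes "f - h \<in> I" "spanned h"
  shows "spanned f"
proof -
  obtain g where g: "Poly_Mapping.keys g \<subseteq> sorted_words" "h - g \<in> I"
    using assms unfolding spanned_def by blast
  have "f - g = (f - h) + (h - g)" by simp
  then have "f - g \<in> I"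
    using I_add assms(1) g(2) by metis
  then show ?thesis
    unfolding spanned_def using g(1) by blast
qed

text \<open>Well-founded induction for the length-lexicographic order on the lists of keys. After a
  descent \<open>a b\<close> is replaced, the first change is at the position of \<open>a\<close>,
  where a smaller key appears; the second new letter may be anything.\<close>

lemma word_spanned: "set w \<subseteq> V \<Longrightarrow> spanned (Poly_Mapping.single w 1)"
proof (induction w rule: wf_induct_rule[OF wf_inv_image[OF wf_lenlex[OF wf_less_than], of "map key"]])
  case (1 w)
  show ?case
  proof (cases "sorted (map key w)")
    case True
    then have "w \<in> sorted_words"
      using 1(2) by (simp add: sorted_words_def)
    then show ?thesis
      unfolding spanned_def using I_zero by (intro exI[of _ "Poly_Mapping.single w 1"]) simp
  next
    case False
    then obtain i where i: "Suc i < length w" "key (w ! Suc i) < key (w ! i)"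
      by (auto simp: sorted_iff_nth_Suc not_le)
    define u where "u = take i w"
    define v where "v = drop (Suc (Suc i)) w"
    define a where "a = w ! i"
    define b where "b = w ! Suc i"
    have w: "w = u @ [a, b] @ v"
      using i(1) by (simp add: u_def v_def a_def b_def Cons_nth_drop_Suc)
    have V: "a \<in> V" "b \<in> V" "set u \<subseteq> V" "set v \<subseteq> V"
      using 1(2) unfolding w by auto
    from rewrite[OF V(1,2)] i(2) obtain h where h: "Poly_Mapping.single [a, b] 1 - h \<in> I"
        "\<And>w. w \<in> Poly_Mapping.keys h \<Longrightarrow> \<exists>c\<in>V. \<exists>d\<in>V. w = [c, d] \<and> key c < key a"
      unfolding a_def b_def by blast
    let ?u = "Poly_Mapping.single u 1 :: 'x list \<Rightarrow>\<^sub>0 'k" and ?v = "Poly_Mapping.single v 1 :: 'x list \<Rightarrow>\<^sub>0 'k"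
    have "?u * (Poly_Mapping.single [a, b] 1 - h) * ?v \<in> I"
      using h(1) V(3,4) by (intro I_mult_left I_mult_right) auto
    then have "Poly_Mapping.single w 1 - ?u * h * ?v \<in> I"
      by (simp add: right_diff_distrib left_diff_distrib mult_single plus_list_def w)
    moreover have "spanned (?u * h * ?v)"
    proof (rule spanned_if_words_spanned)
      fix w' assume "w' \<in> Poly_Mapping.keys (?u * h * ?v)"
      then obtain k where k: "k \<in> Poly_Mapping.keys h" "w' = u @ k @ v"
        using keys_mult[of "?u * h" ?v] keys_mult[of ?u h] by (fastforce simp: plus_list_def)
      then obtain c d where cd: "c \<in> V" "d \<in> V" "k = [c, d]" "key c < key a"
        using h(2) by blast
      show "spanned (Poly_Mapping.single w' 1)"
      proof (rule 1(1))
        show "set w' \<subseteq> V"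
          using k cd V by simp
        show "(w', w) \<in> inv_image (lenlex less_than) (map key)"
          using cd(4) by (simp add: k cd(3) w lenlex_conv lex_append_leftI)
      qed
    qed
    ultimately show ?thesis
      by (rule spanned_shift)
  qed
qed

lemma spanned_carrier: "f \<in> carrier (free_algebra V) \<Longrightarrow> spanned f"
  by (rule spanned_if_words_spanned) (auto intro: word_spanned)

end

section \<open>The torus of quantum symplectic space\<close>

text \<open>
  The exponent of \<open>Y\<^sub>i\<close> is stored at index \<open>i\<close> and the exponent of
  \<open>W\<^sub>i = \<Omega>\<^sub>i \<Omega>\<^sub>i\<^sub>-\<^sub>1\<inverse>\<close> at index \<open>- i\<close>.
\<close>

abbreviation ya :: "(int \<Rightarrow>\<^sub>0 int) \<Rightarrow> nat \<Rightarrow> int" where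
  "ya u i \<equiv> Poly_Mapping.lookup u (int i)"

abbreviation wb :: "(int \<Rightarrow>\<^sub>0 int) \<Rightarrow> nat \<Rightarrow> int" where
  "wb u i \<equiv> Poly_Mapping.lookup u (- int i)"

definition ey :: "nat \<Rightarrow> int \<Rightarrow>\<^sub>0 int" where
  "ey i = Poly_Mapping.single (int i) 1"

definition ew :: "nat \<Rightarrow> int \<Rightarrow>\<^sub>0 int" where
  "ew i = Poly_Mapping.single (- int i) 1"

text \<open>\<open>Omega_m\<close> telescopes to \<open>W_1 ... W_m\<close>, where
  \<open>W_1\<close> is \<open>Omega_1\<close> itself.\<close>

definition eomega :: "nat \<Rightarrow> int \<Rightarrow>\<^sub>0 int" where
  "eomega m = (\<Sum>l\<in>{1..m}. ew l)"

text \<open>Index \<open>0\<close> is its own negative, so \<open>ya\<close> and \<open>wb\<close>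
  are independent coordinates only from index \<open>1\<close> on. For the same reason the lattice
  \<open>L\<close> below excludes index \<open>0\<close>.\<close>

lemma ya_ey: "ya (ey i) j = (if i = j then 1 else 0)"
  and wb_ey: "j \<ge> 1 \<Longrightarrow> wb (ey i) j = 0"
  and ya_ew: "j \<ge> 1 \<Longrightarrow> ya (ew i) j = 0"
  and wb_ew: "wb (ew i) j = (if i = j then 1 else 0)"
  by (auto simp: ey_def ew_def lookup_single when_def)

lemma ya_eomega: "j \<ge> 1 \<Longrightarrow> ya (eomega m) j = 0"
  by (simp add: eomega_def lookup_sum ya_ew)

lemma wb_eomega: "wb (eomega m) j = (if 1 \<le> j \<and> j \<le> m then 1 else 0)"
  by (simp add: eomega_def lookup_sum wb_ew)

text \<open>\<open>single u 1\<close> stands for the ordered monomial with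
  \<open>Y_1, ..., Y_n\<close> on the left and the \<open>W_j\<close> on the right. The form is the
  exponent of \<open>q\<close> that arises when the product of two such monomials is reordered:
  \<open>Y_i Y_j = q^(-1) Y_j Y_i\<close> for \<open>j < i\<close>, and
  \<open>W_j Y_j = q^(-2) Y_j W_j\<close>. It is bilinear but not antisymmetric.\<close>

definition torus_form :: "nat \<Rightarrow> (int \<Rightarrow>\<^sub>0 int) \<Rightarrow> (int \<Rightarrow>\<^sub>0 int) \<Rightarrow> int" where
  "torus_form n u v = - (\<Sum>j\<in>{1..n}. ((\<Sum>i\<in>{i\<in>{1..n}. j < i}. ya u i) + 2 * wb u j) * ya v j)"

lemma torus_form_add_left: "torus_form n (u + v) w = torus_form n u w + torus_form n v w"
  by (simp add: torus_form_def lookup_add sum.distrib algebra_simps)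

lemma torus_form_add_right: "torus_form n u (v + w) = torus_form n u v + torus_form n u w"
  by (simp add: torus_form_def lookup_add sum.distrib algebra_simps)

lemma torus_form_diff_left: "torus_form n (u - v) w = torus_form n u w - torus_form n v w"
  using torus_form_add_left[of n "u - v" v w] by simp

lemma torus_form_diff_right: "torus_form n u (v - w) = torus_form n u v - torus_form n u w"
  using torus_form_add_right[of n u "v - w" w] by simp

lemma torus_form_ey_right:
  assumes "j \<in> {1..n}"
  shows "torus_form n u (ey j) = - ((\<Sum>i\<in>{i\<in>{1..n}. j < i}. ya u i) + 2 * wb u j)"
proof -
  have "(\<Sum>l\<in>{1..n}. ((\<Sum>i\<in>{i\<in>{1..n}. l < i}. ya u i) + 2 * wb u l) * ya (ey j) l)
      = (\<Sum>l\<in>{1..n}. if l = j then (\<Sum>i\<in>{i\<in>{1..n}. j < i}. ya u i) + 2 * wb u j else 0)"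
    by (intro sum.cong refl) (auto simp: ya_ey)
  then show ?thesis
    using assms unfolding torus_form_def by simp
qed

lemma torus_form_eomega_right: "torus_form n u (eomega m) = 0"
  by (simp add: torus_form_def ya_eomega)

lemma torus_form_ey_ey:
  assumes "i \<in> {1..n}" "j \<in> {1..n}"
  shows "torus_form n (ey i) (ey j) = (if j < i then - 1 else 0)"
  using assms by (simp add: torus_form_ey_right ya_ey wb_ey)

lemma torus_form_eomega_ey:
  assumes "j \<in> {1..n}"
  shows "torus_form n (eomega m) (ey j) = (if j \<le> m then - 2 else 0)"
  using assms by (simp add: torus_form_ey_right ya_eomega wb_eomega)

text \<open>The antisymmetrized form, arranged by the coordinates of \<open>v\<close>, so that the
  conditions for \<open>u\<close> to be in the radical are the coefficients.\<close>

lemma torus_form_commutator: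
  "torus_form n u v - torus_form n v u
     = (\<Sum>j\<in>{1..n}. ya v j * ((\<Sum>i\<in>{i\<in>{1..n}. i < j}. ya u i) - (\<Sum>i\<in>{i\<in>{1..n}. j < i}. ya u i)
         - 2 * wb u j) + wb v j * (2 * ya u j))"
proof -
  have "(\<Sum>j\<in>{1..n}. \<Sum>i\<in>{i\<in>{1..n}. j < i}. ya v i * ya u j)
      = (\<Sum>i\<in>{1..n}. \<Sum>j\<in>{j\<in>{1..n}. j < i}. ya v i * ya u j)"
    by (rule sum.swap_restrict) simp_all
  then show ?thesis
    by (simp add: torus_form_def sum_distrib_left sum_distrib_right sum.distrib sum_subtractf
        algebra_simps sum_negf)
qed

locale symplectic_torus =
  fixes q :: "'k::field" and n r :: nat
  assumes q_nonzero: "q \<noteq> 0" and r_pos: "r \<ge> 1" and q_pow_r: "q ^ r = 1"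
    and r_minimal: "\<And>m. 1 \<le> m \<Longrightarrow> m < r \<Longrightarrow> q ^ m \<noteq> 1"
    and q_square: "q ^ 2 \<noteq> 1"
begin

definition chi :: "(int \<Rightarrow>\<^sub>0 int) \<Rightarrow> (int \<Rightarrow>\<^sub>0 int) \<Rightarrow> 'k" where
  "chi u v = q powi torus_form n u v"

sublocale twisted_group_algebra chi
  by unfold_locales
     (simp_all add: chi_def torus_form_add_left torus_form_add_right power_int_add q_nonzero)

notation tmult (infixl \<open>\<diamondop>\<close> 70)

lemma chi_commute:
  assumes "torus_form n u v = torus_form n v u + e"
  shows "chi u v = q powi e * chi v u"
  unfolding chi_def assms by (simp add: power_int_add q_nonzero)

section \<open>The images of the generators and the defining relations\<close>

definition c :: 'k where
  "c = inverse (inverse (q ^ 2) - 1)"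

lemma c_eq: "(inverse (q ^ 2) - 1) * c = 1"
  using q_square by (simp add: c_def field_simps)

text \<open>\<open>Omega_0\<close> is an empty sum and must be zero, whereas the exponent
  \<open>eomega 0 = 0\<close> would give the monomial 1. Hence the case distinction, here and in
  \<open>tX\<close>.\<close>

definition Om :: "nat \<Rightarrow> (int \<Rightarrow>\<^sub>0 int) \<Rightarrow>\<^sub>0 'k" where
  "Om m = (if m = 0 then 0 else single (eomega m) 1)"

definition tY :: "nat \<Rightarrow> (int \<Rightarrow>\<^sub>0 int) \<Rightarrow>\<^sub>0 'k" where
  "tY i = single (ey i) 1"

text \<open>Solution of \<open>(q_i - p_i) y_i x_i = Omega_i - Omega_(i-1)\<close> for
  \<open>x_i\<close>; the constant \<open>c\<close> is the inverse of
  \<open>q_i - p_i = q^(-2) - 1\<close>, which exists because \<open>q^2\<close> is not 1. No twist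
  appears, as \<open>chi (ey i) (eomega m - ey i) = 1\<close>.\<close>

definition tX :: "nat \<Rightarrow> (int \<Rightarrow>\<^sub>0 int) \<Rightarrow>\<^sub>0 'k" where
  "tX i = single (eomega i - ey i) c - (if i = 1 then 0 else single (eomega (i - 1) - ey i) c)"

fun gen :: "generator \<Rightarrow> (int \<Rightarrow>\<^sub>0 int) \<Rightarrow>\<^sub>0 'k" where
  "gen (Gx i) = tX i"
| "gen (Gy i) = tY i"

lemma keys_X:
  assumes "u \<in> keys (tX i)"
  obtains m where "u = eomega m - ey i" "m = i \<or> m = i - 1"
  using assms keys_diff[of "single (eomega i - ey i) c" "single (eomega (i - 1) - ey i) c"]
  by (auto simp: tX_def split: if_splits)

lemma Y_Y:
  assumes "i \<in> {1..n}" "j \<in> {1..n}"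
  shows "tY i \<diamondop> tY j = single 0 (if i < j then q else if i = j then 1 else inverse q) \<diamondop> (tY j \<diamondop> tY i)"
proof (rule tmult_commute_scalar)
  fix u v assume "u \<in> keys (tY i)" "v \<in> keys (tY j)"
  then have uv: "u = ey i" "v = ey j"
    by (simp_all add: tY_def)
  have "chi u v = q powi (if i < j then 1 else if i = j then 0 else - 1) * chi v u"
    unfolding uv using torus_form_ey_ey[OF assms] torus_form_ey_ey[OF assms(2,1)]
    by (intro chi_commute) simp
  then show "chi u v = (if i < j then q else if i = j then 1 else inverse q) * chi v u"
    by (simp add: power_int_minus split: if_splits)
qed

text \<open>For \<open>m\<close> in \<open>{i - 1, i}\<close> and \<open>m'\<close> in
  \<open>{j - 1, j}\<close> the inequality \<open>i < j\<close> gives \<open>m < j\<close> and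
  \<open>i \<le> m'\<close>, so all pairs of terms commute with the same factor. It equals
  \<open>q_i p_j^(-1) \<gamma>_ij = q^(-2) q\<close>.\<close>

lemma X_X:
  assumes "i \<in> {1..n}" "j \<in> {1..n}" "i < j"
  shows "tX i \<diamondop> tX j = single 0 (inverse q) \<diamondop> (tX j \<diamondop> tX i)"
proof (rule tmult_commute_scalar)
  fix u v assume "u \<in> keys (tX i)" "v \<in> keys (tX j)"
  then obtain m m' where uv: "u = eomega m - ey i" "v = eomega m' - ey j"
    and m: "m = i \<or> m = i - 1" "m' = j \<or> m' = j - 1"
    by (elim keys_X) blast
  have "chi u v = q powi (- 1) * chi v u"
    unfolding uv using assms m
    by (intro chi_commute) (auto simp: torus_form_diff_left torus_form_diff_right
        torus_form_eomega_right torus_form_eomega_ey torus_form_ey_ey)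
  then show "chi u v = inverse q * chi v u"
    by (simp add: power_int_minus)
qed

text \<open>The two defining relations for \<open>i < j\<close> and \<open>i > j\<close> coincide
  for these parameters: \<open>p_j \<gamma>_ji\<close> and \<open>q_j \<gamma>_ji\<close> are both
  \<open>q^(-1)\<close> in their ranges.\<close>

lemma X_Y:
  assumes "i \<in> {1..n}" "j \<in> {1..n}" "i \<noteq> j"
  shows "tX i \<diamondop> tY j = single 0 (inverse q) \<diamondop> (tY j \<diamondop> tX i)"
proof (rule tmult_commute_scalar)
  fix u v assume u: "u \<in> keys (tX i)" and "v \<in> keys (tY j)"
  then have v: "v = ey j"
    by (simp add: tY_def)
  obtain m where m: "u = eomega m - ey i" "m = i \<or> m = i - 1"
    using u by (rule keys_X)
  have "chi u v = q powi (- 1) * chi v u"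
    unfolding m(1) v using assms m(2)
    by (intro chi_commute) (auto simp: torus_form_diff_left torus_form_diff_right
        torus_form_eomega_right torus_form_eomega_ey torus_form_ey_ey)
  then show "chi u v = inverse q * chi v u"
    by (simp add: power_int_minus)
qed

lemma Y_X_diagonal:
  assumes "i \<in> {1..n}"
  shows "tY i \<diamondop> tX i = single 0 c \<diamondop> (Om i - Om (i - 1))"
proof -
  have "chi (ey i) (eomega m - ey i) = 1" for m
    using assms by (simp add: chi_def torus_form_diff_right torus_form_eomega_right torus_form_ey_ey)
  then show ?thesis
    using assms by (auto simp: tY_def tX_def Om_def tmult_diff_right tmult_single)
qed

lemma X_Y_diagonal:
  assumes "i \<in> {1..n}"
  shows "tX i \<diamondop> tY i = single 0 c \<diamondop> (single 0 (inverse (q ^ 2)) \<diamondop> Om i - Om (i - 1))"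
proof -
  have "chi (eomega i - ey i) (ey i) = inverse (q ^ 2)" "chi (eomega (i - 1) - ey i) (ey i) = 1"
    using assms by (auto simp: chi_def torus_form_diff_left torus_form_eomega_ey torus_form_ey_ey
        power_int_minus)
  then show ?thesis
    using assms
    by (auto simp: tY_def tX_def Om_def tmult_diff_right tmult_diff_left tmult_single)
qed

text \<open>Telescoping of \<open>Y_X_diagonal\<close>. Apart from the diagonal relation, it shows
  that \<open>Omega_m\<close> lies in the image of the algebra, see \<open>eomega_C\<close>.\<close>

lemma Om_sum:
  "m \<le> n \<Longrightarrow> Om m = (\<Sum>l\<in>{1..<Suc m}. single 0 (inverse (q ^ 2) - 1) \<diamondop> (tY l \<diamondop> tX l))"
proof (induction m)
  case 0
  then show ?case by (simp add: Om_def)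
next
  case (Suc m)
  have "(\<Sum>l\<in>{1..<Suc (Suc m)}. single 0 (inverse (q ^ 2) - 1) \<diamondop> (tY l \<diamondop> tX l))
      = Om m + single 0 (inverse (q ^ 2) - 1) \<diamondop> (tY (Suc m) \<diamondop> tX (Suc m))"
    using Suc by simp
  also have "single 0 (inverse (q ^ 2) - 1) \<diamondop> (tY (Suc m) \<diamondop> tX (Suc m)) = Om (Suc m) - Om m"
    using Suc.prems c_eq
    by (subst Y_X_diagonal) (simp_all add: tmult_single flip: tmult_assoc)
  finally show ?case by simp
qed

text \<open>The terms of \<open>tX i\<close> pick up the different factors \<open>q^(-2)\<close> and
  1 when passing \<open>tY i\<close>. The excess at \<open>Omega_(i-1)\<close> is
  \<open>q^(-2) c - c = 1\<close>, which is exactly the inhomogeneous sum.\<close>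

lemma X_Y_relation:
  assumes i: "i \<in> {1..n}"
  shows "tX i \<diamondop> tY i = single 0 (inverse (q ^ 2)) \<diamondop> (tY i \<diamondop> tX i)
    + (\<Sum>l\<in>{1..<i}. single 0 (inverse (q ^ 2) - 1) \<diamondop> (tY l \<diamondop> tX l))"
proof -
  have S: "(\<Sum>l\<in>{1..<i}. single 0 (inverse (q ^ 2) - 1) \<diamondop> (tY l \<diamondop> tX l)) = Om (i - 1)"
  proof -
    have "Suc (i - 1) = i" "i - 1 \<le> n"
      using i by auto
    then show ?thesis
      using Om_sum[of "i - 1"] by (simp only:)
  qed
  have "inverse (q ^ 2) * c = c + 1"
    using c_eq by (simp add: algebra_simps)
  then have "single 0 (inverse (q ^ 2)) \<diamondop> (single 0 c \<diamondop> Om (i - 1)) = single 0 c \<diamondop> Om (i - 1) + Om (i - 1)"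
    by (simp add: tmult_single tmult_add_left single_add flip: tmult_assoc)
  moreover have "single 0 (inverse (q ^ 2)) \<diamondop> (single 0 c \<diamondop> Om i) = single 0 c \<diamondop> (single 0 (inverse (q ^ 2)) \<diamondop> Om i)"
    by (simp add: tmult_single mult.commute flip: tmult_assoc)
  ultimately show ?thesis
    unfolding S X_Y_diagonal[OF i] Y_X_diagonal[OF i] by (simp add: tmult_diff_right)
qed

section \<open>The kernel\<close>

abbreviation V where "V \<equiv> generators n"
abbreviation rels :: "(generator list \<Rightarrow>\<^sub>0 'k) set" where
  "rels \<equiv> K_relations n (\<lambda>i. 1) (\<lambda>i. inverse (q ^ 2))
     (\<lambda>i j. if i < j then q else if i = j then 1 else inverse q)"
abbreviation F :: "(generator list \<Rightarrow>\<^sub>0 'k) ring" where "F \<equiv> free_algebra V"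
abbreviation I where "I \<equiv> genideal F rels"
abbreviation \<phi> where "\<phi> \<equiv> free_hom gen"

sublocale F: ring F
  by (rule free_algebra_ring)

lemma generators_cases:
  assumes "g \<in> V"
  obtains i where "g = Gx i" "i \<in> {1..n}" | i where "g = Gy i" "i \<in> {1..n}"
  using assms by (auto simp: generators_def)

lemma Gx_V [simp]: "Gx i \<in> V \<longleftrightarrow> i \<in> {1..n}" and Gy_V [simp]: "Gy i \<in> V \<longleftrightarrow> i \<in> {1..n}"
  by (auto simp: generators_def)

lemma relsE:
  assumes "f \<in> rels"
  obtains (yy) i j where "i \<in> {1..n}" "j \<in> {1..n}"
      "f = 1 \<star> [Gy i, Gy j] - (if i < j then q else if i = j then 1 else inverse q) \<star> [Gy j, Gy i]"
  | (xx) i j where "i \<in> {1..n}" "j \<in> {1..n}" "i < j"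
      "f = 1 \<star> [Gx i, Gx j] - inverse q \<star> [Gx j, Gx i]"
  | (xy) i j where "i \<in> {1..n}" "j \<in> {1..n}" "i \<noteq> j"
      "f = 1 \<star> [Gx i, Gy j] - inverse q \<star> [Gy j, Gx i]"
  | (diagonal) i where "i \<in> {1..n}"
      "f = 1 \<star> [Gx i, Gy i] - (inverse (q ^ 2) \<star> [Gy i, Gx i]
        + (\<Sum>l\<in>{1..<i}. (inverse (q ^ 2) - 1) \<star> [Gy l, Gx l]))"
proof -
  have 1: "inverse (q ^ 2) * inverse 1 * q = inverse q" "inverse (q ^ 2) * q = inverse q"
    using q_nonzero by (simp_all add: power2_eq_square)
  from assms show thesis
    unfolding K_relations_def
  proof (elim UnE CollectE exE conjE)
    fix i j assume "f = 1 \<star> [Gx i, Gx j] - (inverse (q ^ 2) * inverse 1 *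
        (if i < j then q else if i = j then 1 else inverse q)) \<star> [Gx j, Gx i]"
      "i \<in> {1..n}" "j \<in> {1..n}" "i < j"
    then show thesis using 1 xx[of i j] by simp
  next
    fix i j assume "f = 1 \<star> [Gx i, Gy j] - (1 *
        (if j < i then q else if j = i then 1 else inverse q)) \<star> [Gy j, Gx i]"
      "i \<in> {1..n}" "j \<in> {1..n}" "i < j"
    then show thesis using xy[of i j] by simp
  next
    fix i j assume "f = 1 \<star> [Gx i, Gy j] - (inverse (q ^ 2) *
        (if j < i then q else if j = i then 1 else inverse q)) \<star> [Gy j, Gx i]"
      "i \<in> {1..n}" "j \<in> {1..n}" "j < i"
    then show thesis using 1 xy[of i j] by simp
  qed (use yy diagonal in blast)+
qed

lemma relsI:
  "\<lbrakk>i \<in> {1..n}; j \<in> {1..n}\<rbrakk> \<Longrightarrow>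
    1 \<star> [Gy i, Gy j] - (if i < j then q else if i = j then 1 else inverse q) \<star> [Gy j, Gy i] \<in> rels"
  "\<lbrakk>i \<in> {1..n}; j \<in> {1..n}; i < j\<rbrakk> \<Longrightarrow> 1 \<star> [Gx i, Gx j] - inverse q \<star> [Gx j, Gx i] \<in> rels"
  "\<lbrakk>i \<in> {1..n}; j \<in> {1..n}; i \<noteq> j\<rbrakk> \<Longrightarrow> 1 \<star> [Gx i, Gy j] - inverse q \<star> [Gy j, Gx i] \<in> rels"
  "i \<in> {1..n} \<Longrightarrow> 1 \<star> [Gx i, Gy i] - (inverse (q ^ 2) \<star> [Gy i, Gx i]
        + (\<Sum>l\<in>{1..<i}. (inverse (q ^ 2) - 1) \<star> [Gy l, Gx l])) \<in> rels"
proof -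
  have 1: "inverse (q ^ 2) * inverse 1 * q = inverse q" "inverse (q ^ 2) * q = inverse q"
    using q_nonzero by (simp_all add: power2_eq_square)
  show "\<lbrakk>i \<in> {1..n}; j \<in> {1..n}\<rbrakk> \<Longrightarrow>
    1 \<star> [Gy i, Gy j] - (if i < j then q else if i = j then 1 else inverse q) \<star> [Gy j, Gy i] \<in> rels"
    unfolding K_relations_def by blast
  show "i \<in> {1..n} \<Longrightarrow> 1 \<star> [Gx i, Gy i] - (inverse (q ^ 2) \<star> [Gy i, Gx i]
        + (\<Sum>l\<in>{1..<i}. (inverse (q ^ 2) - 1) \<star> [Gy l, Gx l])) \<in> rels"
    unfolding K_relations_def by blast
  show "1 \<star> [Gx i, Gx j] - inverse q \<star> [Gx j, Gx i] \<in> rels"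
    if "i \<in> {1..n}" "j \<in> {1..n}" "i < j"
  proof -
    have "1 \<star> [Gx i, Gx j] - (inverse (q ^ 2) * inverse 1 *
        (if i < j then q else if i = j then 1 else inverse q)) \<star> [Gx j, Gx i] \<in> rels"
      unfolding K_relations_def using that by blast
    then show ?thesis using that 1 by simp
  qed
  show "1 \<star> [Gx i, Gy j] - inverse q \<star> [Gy j, Gx i] \<in> rels"
    if "i \<in> {1..n}" "j \<in> {1..n}" "i \<noteq> j"
  proof (cases "i < j")
    case True
    then have "1 \<star> [Gx i, Gy j] - (1 * (if j < i then q else if j = i then 1 else inverse q))
        \<star> [Gy j, Gx i] \<in> rels"
      unfolding K_relations_def using that by blast
    then show ?thesis using True by simp
  next
    case False
    then have ij: "j < i" using that(3) by simp
    then have "1 \<star> [Gx i, Gy j] - (inverse (q ^ 2) * (if j < i then q else if j = i then 1 else inverse q))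
        \<star> [Gy j, Gx i] \<in> rels"
      unfolding K_relations_def using that by blast
    then show ?thesis using ij 1 by simp
  qed
qed

lemma rels_carrier: "rels \<subseteq> carrier F"
proof
  have word: "Poly_Mapping.single w a \<in> carrier F" if "set w \<subseteq> V" for w and a :: 'k
    using that by (auto split: if_splits)
  have sum: "(\<Sum>l\<in>A. G l) \<in> carrier F" if "\<And>l. l \<in> A \<Longrightarrow> G l \<in> carrier F" for A :: "nat set" and G
    using that keys_sum[of G A] by (fastforce simp: free_algebra_simps)
  have diff: "f - g \<in> carrier F" if "f \<in> carrier F" "g \<in> carrier F" for f g :: "generator list \<Rightarrow>\<^sub>0 'k"
    using that keys_diff[of f g] by auto
  have add: "f + g \<in> carrier F" if "f \<in> carrier F" "g \<in> carrier F" for f g :: "generator list \<Rightarrow>\<^sub>0 'k"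
    using that keys_add[of f g] by auto
  fix f assume "f \<in> rels"
  then show "f \<in> carrier F"
  proof (cases rule: relsE)
    case (yy i j)
    show ?thesis unfolding yy(3) using yy by (intro diff word) simp_all
  next
    case (xx i j)
    show ?thesis unfolding xx(4) using xx by (intro diff word) simp_all
  next
    case (xy i j)
    show ?thesis unfolding xy(4) using xy by (intro diff word) simp_all
  next
    case (diagonal i)
    show ?thesis unfolding diagonal(2) using diagonal(1) by (intro diff add sum word) simp_all
  qed
qed

lemma rels_kernel:
  assumes "f \<in> rels"
  shows "\<phi> f = 0"
  using assms
proof (cases rule: relsE)
  case (yy i j)
  then show ?thesis
    using Y_Y[of i j] by (simp add: free_hom_diff free_hom_single)
next
  case (xx i j)
  then show ?thesis
    using X_X[of i j] by (simp add: free_hom_diff free_hom_single)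
next
  case (xy i j)
  then show ?thesis
    using X_Y[of i j] by (simp add: free_hom_diff free_hom_single)
next
  case (diagonal i)
  then show ?thesis
    using X_Y_relation[of i] by (simp add: free_hom_diff free_hom_add free_hom_sum free_hom_single)
qed

lemma I_ideal: "ideal I F"
  by (rule F.genideal_ideal[OF rels_carrier])

lemma rels_I: "f \<in> rels \<Longrightarrow> f \<in> I"
  using F.genideal_self[OF rels_carrier] by blast

sublocale phi: ring_hom_ring F T \<phi>
  by (rule free_hom_ring_hom)

lemma I_kernel: "I \<subseteq> a_kernel F T \<phi>"
proof (rule F.genideal_minimal[OF phi.kernel_is_ideal], rule subsetI)
  fix f assume f: "f \<in> rels"
  then have "f \<in> carrier F"
    using rels_carrier by (rule rev_subsetD)
  then show "f \<in> a_kernel F T \<phi>"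
    unfolding a_kernel_def' mem_Collect_eq using rels_kernel[OF f] by (simp only: T_simps)
qed

section \<open>Spanning by sorted words\<close>

definition key :: "generator \<Rightarrow> nat" where
  "key g = (case g of Gy i \<Rightarrow> i | Gx i \<Rightarrow> n + i)"

lemma key_simps [simp]: "key (Gy i) = i" "key (Gx i) = n + i"
  by (simp_all add: key_def)

lemma key_inj: "inj_on key V"
  by (auto simp: inj_on_def generators_def)

text \<open>The keys put every \<open>y\<close> before every \<open>x\<close>, each family by index.
  The diagonal relation then rewrites \<open>x_i y_i\<close> into words \<open>y_l x_l\<close>,
  which start with a smaller key; all other relations merely swap two letters up to a
  scalar.\<close>

lemma rewriting: "sorted_rewriting V key I"
proof (rule sorted_rewriting.intro)
  show "ideal I F" by (rule I_ideal)
  fix a b assume ab: "a \<in> V" "b \<in> V" "key b < key a"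
  let ?G = "\<lambda>h. 1 \<star> [a, b] - h \<in> I \<and>
    (\<forall>w\<in>Poly_Mapping.keys h. \<exists>c\<in>V. \<exists>d\<in>V. w = [c, d] \<and> key c < key a)"
  have swap: "\<exists>h. ?G h" if "1 \<star> [a, b] - k \<star> [b, a] \<in> I" for k
    using that ab by (intro exI[of _ "k \<star> [b, a]"]) (simp split: if_splits)
  show "\<exists>h. ?G h"
  proof -
    consider (xx) i j where "a = Gx i" "i \<in> {1..n}" "b = Gx j" "j \<in> {1..n}"
      | (xy) i j where "a = Gx i" "i \<in> {1..n}" "b = Gy j" "j \<in> {1..n}"
      | (yx) i j where "a = Gy i" "i \<in> {1..n}" "b = Gx j" "j \<in> {1..n}"
      | (yy) i j where "a = Gy i" "i \<in> {1..n}" "b = Gy j" "j \<in> {1..n}"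
      using ab(1,2) unfolding generators_def by blast
    then show ?thesis
    proof cases
      case (xx i j)
      note g = xx
      have "1 \<star> [b, a] - inverse q \<star> [a, b] \<in> I"
        using g ab(3) relsI(2)[of j i] by (intro rels_I) simp
      \<comment> \<open>The relation is given for the sorted pair \<open>b a\<close>; multiplication
        by \<open>- q\<close> solves it for the descent \<open>a b\<close>.\<close>
      then have "(- q) \<star> [] * (1 \<star> [b, a] - inverse q \<star> [a, b]) \<in> I"
        using ideal.I_l_closed[OF I_ideal, of _ "(- q) \<star> []"] by (simp split: if_splits)
      moreover have "(- q) \<star> [] * (1 \<star> [b, a] - inverse q \<star> [a, b]) = 1 \<star> [a, b] - q \<star> [b, a]"
        using q_nonzero by (simp add: right_diff_distrib mult_single plus_list_def single_uminus)
      ultimately show ?thesis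
        by (intro swap[of q]) simp
    next
      case (xy i j)
      note g = xy
      show ?thesis
      proof (cases "i = j")
        case False
        then show ?thesis
          using g(2,4) rels_I[OF relsI(3)[of i j]] unfolding g(1,3) by (intro swap[unfolded g(1,3)]) blast
      next
        case True
        let ?h = "inverse (q ^ 2) \<star> [Gy i, Gx i] + (\<Sum>l\<in>{1..<i}. (inverse (q ^ 2) - 1) \<star> [Gy l, Gx l])"
        have "1 \<star> [a, b] - ?h \<in> I"
          unfolding g True[symmetric] by (rule rels_I[OF relsI(4)[OF g(2)]])
        moreover have "\<exists>c\<in>V. \<exists>d\<in>V. w = [c, d] \<and> key c < key a" if w: "w \<in> Poly_Mapping.keys ?h" for w
        proof -
          have "w = [Gy i, Gx i] \<or> w \<in> Poly_Mapping.keys (\<Sum>l\<in>{1..<i}. (inverse (q ^ 2) - 1) \<star> [Gy l, Gx l])"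
            using subsetD[OF keys_add w] by (simp add: q_nonzero)
          then obtain l where "l \<in> {1..i}" "w = [Gy l, Gx l]"
            using keys_sum[of "\<lambda>l. (inverse (q ^ 2) - 1) \<star> [Gy l, Gx l]" "{1..<i}"] g(2)
            by (fastforce split: if_splits)
          then show ?thesis
            using g(1,2) by (intro bexI[of _ "Gy l"] bexI[of _ "Gx l"]) auto
        qed
        ultimately show ?thesis by blast
      qed
    next
      case (yx i j)
      then show ?thesis using ab(3) by simp
    next
      case (yy i j)
      note g = yy
      show ?thesis
        by (rule swap) (use rels_I[OF relsI(1)[OF g(2,4)]] in \<open>simp only: g\<close>)
    qed
  qed
qed

sublocale rw: sorted_rewriting V key I
  by (rule rewriting)

section \<open>Independence of the sorted words\<close>

fun gexp :: "generator \<Rightarrow> int \<Rightarrow>\<^sub>0 int" where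
  "gexp (Gx i) = eomega i - ey i"
| "gexp (Gy i) = ey i"

definition wexp :: "generator list \<Rightarrow> int \<Rightarrow>\<^sub>0 int" where
  "wexp w = sum_list (map gexp w)"

text \<open>Each \<open>W_i\<close> has weight 1, so \<open>Omega_i = W_1 ... W_i\<close> has weight
  \<open>i\<close>, and the \<open>Omega_i\<close>-term of \<open>x_i\<close> outweighs the
  \<open>Omega_(i-1)\<close>-term.\<close>

definition weight :: "(int \<Rightarrow>\<^sub>0 int) \<Rightarrow> int" where
  "weight u = (\<Sum>i\<in>{1..n}. wb u i)"

lemma weight_add: "weight (u + v) = weight u + weight v"
  by (simp add: weight_def lookup_add sum.distrib)

lemma weight_gexp_diff:
  assumes "i \<in> {1..n}"
  shows "weight (eomega (i - 1) - ey i) < weight (eomega i - ey i)"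
proof -
  have wb: "wb (eomega m - ey i) l = (if l \<le> m then 1 else 0)" if "l \<in> {1..n}" for l m
    using that by (simp add: lookup_minus wb_eomega wb_ey)
  have "weight (eomega (i - 1) - ey i) + 1 = weight (eomega i - ey i)"
  proof -
    have "(\<Sum>l\<in>{1..n}. if l \<le> i then 1 else 0 :: int)
        = (\<Sum>l\<in>{1..n}. (if l \<le> i - 1 then 1 else 0) + (if l = i then 1 else 0))"
      using assms by (intro sum.cong refl) auto
    also have "\<dots> = (\<Sum>l\<in>{1..n}. if l \<le> i - 1 then 1 else 0) + 1"
      using assms by (simp add: sum.distrib)
    finally show ?thesis
      unfolding weight_def by (simp add: wb)
  qed
  then show ?thesis by simp
qed

text \<open>Unlike a total order, the weight does not separate all exponents. That one exponent
  strictly outweighs the others is therefore a condition, true of the generators and inherited by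
  products.\<close>

definition leads :: "((int \<Rightarrow>\<^sub>0 int) \<Rightarrow>\<^sub>0 'k) \<Rightarrow> (int \<Rightarrow>\<^sub>0 int) \<Rightarrow> bool" where
  "leads f e \<longleftrightarrow> e \<in> keys f \<and> (\<forall>u\<in>keys f. u \<noteq> e \<longrightarrow> weight u < weight e)"

lemma leads_mult:
  assumes "leads f e" "leads g e'"
  shows "leads (f \<diamondop> g) (e + e')"
proof -
  have e: "e \<in> keys f" "e' \<in> keys g"
    using assms by (auto simp: leads_def)
  have less: "weight (u + v) < weight (e + e')"
    if uv: "u \<in> keys f" "v \<in> keys g" "\<not> (u = e \<and> v = e')" for u v
  proof -
    have "u = e \<or> weight u < weight e" "v = e' \<or> weight v < weight e'"
      using assms uv by (auto simp: leads_def)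
    then show ?thesis
      using uv(3) by (auto simp: weight_add)
  qed
  have "u = e \<and> v = e'" if "u \<in> keys f" "v \<in> keys g" "u + v = e + e'" for u v
    using less[of u v] that by (metis less_irrefl)
  then have "lookup (f \<diamondop> g) (e + e') = lookup f e * lookup g e' * chi e e'"
    by (intro lookup_tmult_unique e)
  then have "e + e' \<in> keys (f \<diamondop> g)"
    using e by (simp add: in_keys_iff)
  moreover have "weight w < weight (e + e')" if w: "w \<in> keys (f \<diamondop> g)" "w \<noteq> e + e'" for w
  proof -
    obtain u v where "u \<in> keys f" "v \<in> keys g" "w = u + v"
      using keys_tmult[of f g] w(1) by blast
    then show ?thesis
      using less[of u v] w(2) by blast
  qed
  ultimately show ?thesis
    by (simp add: leads_def)
qed

lemma leads_gen:
  assumes "g \<in> V"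
  shows "leads (gen g) (gexp g)"
  using assms
proof (cases rule: generators_cases)
  case (1 i)
  have "c \<noteq> 0"
    using c_eq by auto
  moreover have "eomega (i - 1) - ey i \<noteq> eomega i - ey i"
    using weight_gexp_diff[OF 1(2)] by auto
  ultimately have "gexp g \<in> keys (gen g)"
    by (auto simp: 1(1) tX_def in_keys_iff lookup_minus lookup_single when_def)
  moreover have "weight u < weight (gexp g)" if u: "u \<in> keys (gen g)" "u \<noteq> gexp g" for u
  proof -
    have "u \<in> keys (tX i)" "u \<noteq> eomega i - ey i"
      using u by (simp_all add: 1(1))
    then have "u = eomega (i - 1) - ey i"
      by (metis keys_X)
    then show ?thesis
      using weight_gexp_diff[OF 1(2)] by (simp add: 1(1))
  qed
  ultimately show ?thesis by (simp add: leads_def)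
next
  case (2 i)
  then show ?thesis by (simp add: leads_def tY_def)
qed

lemma leads_word: "set w \<subseteq> V \<Longrightarrow> leads (tprod (map gen w)) (wexp w)"
proof (induction w)
  case Nil
  then show ?case by (simp add: leads_def wexp_def)
next
  case (Cons g w)
  then show ?case
    using leads_mult[OF leads_gen[of g], of "tprod (map gen w)" "wexp w"] by (simp add: wexp_def)
qed

text \<open>\<open>x_i\<close> contributes \<open>eomega i - ey i\<close>, so the
  \<open>W_j\<close>-exponent counts the letters \<open>x_i\<close> with \<open>i \<ge> j\<close>
  and consecutive differences isolate \<open>x_j\<close>. The \<open>Y_j\<close>-exponent is the
  number of \<open>y_j\<close> minus the number of \<open>x_j\<close>. Hence a sorted word is
  determined by its leading exponent.\<close>

lemma count_wexp:
  assumes "set w \<subseteq> V" "j \<in> {1..n}"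
  shows "int (count_list w (Gx j)) = wb (wexp w) j - wb (wexp w) (Suc j)"
    and "int (count_list w (Gy j)) = ya (wexp w) j + int (count_list w (Gx j))"
proof -
  have "int (count_list w (Gx j)) = wb (wexp w) j - wb (wexp w) (Suc j) \<and>
    int (count_list w (Gy j)) = ya (wexp w) j + int (count_list w (Gx j))"
    using assms(1)
  proof (induction w)
    case Nil
    then show ?case by (simp add: wexp_def)
  next
    case (Cons g w)
    have j: "j \<ge> 1" "Suc j \<ge> 1" using assms(2) by auto
    have e: "wexp (h # w) = gexp h + wexp w" for h
      by (simp add: wexp_def)
    have IH: "int (count_list w (Gx j)) = wb (wexp w) j - wb (wexp w) (Suc j)"
      "int (count_list w (Gy j)) = ya (wexp w) j + int (count_list w (Gx j))"
      using Cons by simp_all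
    have "g \<in> V" using Cons.prems by simp
    then show ?case
    proof (cases rule: generators_cases)
      case (1 i)
      then show ?thesis
        using IH j wb_ey[of j i] wb_ey[of "Suc j" i] wb_eomega[of i j] wb_eomega[of i "Suc j"]
          ya_eomega[of j i] ya_ey[of i j]
        by (simp add: e lookup_add lookup_minus del: of_nat_Suc)
    next
      case (2 i)
      then show ?thesis
        using IH j wb_ey[of j i] wb_ey[of "Suc j" i] ya_ey[of i j]
        by (simp add: e lookup_add lookup_minus del: of_nat_Suc)
    qed
  qed
  then show "int (count_list w (Gx j)) = wb (wexp w) j - wb (wexp w) (Suc j)"
    "int (count_list w (Gy j)) = ya (wexp w) j + int (count_list w (Gx j))" by auto
qed

lemma wexp_inj:
  assumes "w \<in> rw.sorted_words" "w' \<in> rw.sorted_words" "wexp w = wexp w'"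
  shows "w = w'"
proof -
  have w: "set w \<subseteq> V" "set w' \<subseteq> V" "sorted (map key w)" "sorted (map key w')"
    using assms by (auto simp: rw.sorted_words_def)
  have "count_list w g = count_list w' g" for g
  proof (cases "g \<in> V")
    case True
    then show ?thesis
    proof (cases rule: generators_cases)
      case (1 i)
      then show ?thesis
        using count_wexp(1)[OF w(1) 1(2)] count_wexp(1)[OF w(2) 1(2)] assms(3) by simp
    next
      case (2 i)
      then show ?thesis
        using count_wexp[OF w(1) 2(2)] count_wexp[OF w(2) 2(2)] assms(3) by simp
    qed
  next
    case False
    then show ?thesis
      using w by (metis count_notin subsetD)
  qed
  then have "mset w = mset w'"
    by (intro multiset_eqI) (simp add: count_mset)
  then have "mset (map key w) = mset (map key w')"
    by simp
  then have "map key w = map key w'"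
    using w(3,4) properties_for_sort by metis
  then show ?thesis
    by (rule map_inj_on) (use inj_on_subset[OF key_inj] w in auto)
qed

text \<open>Take a word \<open>w0\<close> of \<open>g\<close> whose leading exponent has maximal
  weight. At that exponent no other word contributes: its leading exponent is different by
  \<open>wexp_inj\<close>, and its remaining exponents have weight below the maximum.\<close>

lemma sorted_independent:
  assumes g: "Poly_Mapping.keys g \<subseteq> rw.sorted_words" and 0: "\<phi> g = 0"
  shows "g = 0"
proof (rule ccontr)
  assume "g \<noteq> 0"
  then have ne: "Poly_Mapping.keys g \<noteq> {}" by simp
  define M where "M = Max ((\<lambda>w. weight (wexp w)) ` Poly_Mapping.keys g)"
  have "M \<in> (\<lambda>w. weight (wexp w)) ` Poly_Mapping.keys g"
    unfolding M_def using ne by (intro Max_in) auto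
  then obtain w0 where w0: "w0 \<in> Poly_Mapping.keys g" "weight (wexp w0) = M" by blast
  have max: "weight (wexp w) \<le> M" if "w \<in> Poly_Mapping.keys g" for w
    unfolding M_def using that by (intro Max_ge) auto
  have V: "set w \<subseteq> V" if "w \<in> Poly_Mapping.keys g" for w
    using g that by (auto simp: rw.sorted_words_def)
  let ?t = "\<lambda>w. lookup (single 0 (Poly_Mapping.lookup g w) \<diamondop> tprod (map gen w)) (wexp w0)"
  have t: "?t w = Poly_Mapping.lookup g w * lookup (tprod (map gen w)) (wexp w0)" for w
    using lookup_single_tmult[of 0 "Poly_Mapping.lookup g w" "tprod (map gen w)" "wexp w0"] by simp
  have other: "?t w = 0" if w: "w \<in> Poly_Mapping.keys g - {w0}" for w
  proof -
    have "wexp w0 \<noteq> wexp w"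
      using wexp_inj[of w0 w] w w0(1) g by auto
    moreover have "\<not> weight (wexp w0) < weight (wexp w)"
      using max[of w] w w0(2) by simp
    ultimately have "wexp w0 \<notin> keys (tprod (map gen w))"
      using leads_word[OF V, of w] w by (auto simp: leads_def)
    then show ?thesis
      unfolding t by (simp add: in_keys_iff)
  qed
  have "lookup (\<phi> g) (wexp w0) = (\<Sum>w\<in>Poly_Mapping.keys g. ?t w)"
    by (simp only: free_hom_def lookup_sum)
  also have "\<dots> = ?t w0 + (\<Sum>w\<in>Poly_Mapping.keys g - {w0}. ?t w)"
    by (rule sum.remove) (use w0 in simp_all)
  also have "(\<Sum>w\<in>Poly_Mapping.keys g - {w0}. ?t w) = 0"
    using other by (rule sum.neutral[OF ballI])
  finally have "Poly_Mapping.lookup g w0 * lookup (tprod (map gen w0)) (wexp w0) = 0"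
    unfolding t 0 by simp
  then show False
    using w0(1) leads_word[OF V[OF w0(1)]] by (auto simp: leads_def in_keys_iff)
qed

lemma kernel_eq: "a_kernel F T \<phi> = I"
proof
  show "I \<subseteq> a_kernel F T \<phi>" by (rule I_kernel)
  show "a_kernel F T \<phi> \<subseteq> I"
  proof
    fix f assume "f \<in> a_kernel F T \<phi>"
    then have f: "f \<in> carrier F" "\<phi> f = 0"
      unfolding a_kernel_def' by (simp_all only: mem_Collect_eq T_simps)
    obtain g where g: "Poly_Mapping.keys g \<subseteq> rw.sorted_words" "f - g \<in> I"
      using rw.spanned_carrier[OF f(1)] unfolding rw.spanned_def by blast
    have "\<phi> (f - g) = 0"
      using I_kernel g(2) unfolding a_kernel_def' by (auto simp only: mem_Collect_eq T_simps)
    then have "\<phi> g = 0"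
      using f(2) by (simp add: free_hom_diff)
    then have "g = 0"
      by (rule sorted_independent[OF g(1)])
    then show "f \<in> I"
      using g(2) by simp
  qed
qed


section \<open>The exponent lattice and the monomials in the image\<close>

definition L :: "(int \<Rightarrow>\<^sub>0 int) set" where
  "L = {u. \<forall>k\<in>Poly_Mapping.keys u. k \<noteq> 0 \<and> \<bar>k\<bar> \<le> int n}"

abbreviation B where "B \<equiv> \<phi> ` carrier F"

text \<open>Defined by the image rather than by generators: closure under addition is then inherited
  from the image, and only the exponents of \<open>y_i\<close> and \<open>Omega_m\<close> have to be
  exhibited.\<close>

definition C :: "(int \<Rightarrow>\<^sub>0 int) set" where
  "C = {u. \<forall>a. single u a \<in> B}"

lemma L_diff: "u \<in> L \<Longrightarrow> v \<in> L \<Longrightarrow> u - v \<in> L"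
  using keys_diff[of u v] by (auto simp: L_def)

lemma L_add: "u \<in> L \<Longrightarrow> v \<in> L \<Longrightarrow> u + v \<in> L"
  using keys_add[of u v] by (auto simp: L_def)

lemma L_zero: "0 \<in> L"
  by (simp add: L_def)

lemma ey_L: "i \<in> {1..n} \<Longrightarrow> ey i \<in> L" and ew_L: "i \<in> {1..n} \<Longrightarrow> ew i \<in> L"
  by (auto simp: L_def ey_def ew_def)

lemma L_sum: "(\<And>i. i \<in> A \<Longrightarrow> G i \<in> L) \<Longrightarrow> (\<Sum>i\<in>A. G i) \<in> L"
  by (induction A rule: infinite_finite_induct) (simp_all add: L_zero L_add)

lemma eomega_L: "m \<le> n \<Longrightarrow> eomega m \<in> L"
  unfolding eomega_def by (intro L_sum ew_L) simp

lemma B_mult: "f \<in> B \<Longrightarrow> g \<in> B \<Longrightarrow> f \<diamondop> g \<in> B"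
proof (elim imageE)
  fix x y assume xy: "f = \<phi> x" "g = \<phi> y" "x \<in> carrier F" "y \<in> carrier F"
  then have "x * y \<in> carrier F" "\<phi> (x * y) = f \<diamondop> g"
    using F.m_closed[OF xy(3,4)] by (simp_all only: free_algebra_simps(2) free_hom_mult)
  then show ?thesis by (metis imageI)
qed

lemma B_add: "f \<in> B \<Longrightarrow> g \<in> B \<Longrightarrow> f + g \<in> B"
proof (elim imageE)
  fix x y assume xy: "f = \<phi> x" "g = \<phi> y" "x \<in> carrier F" "y \<in> carrier F"
  then have "x + y \<in> carrier F" "\<phi> (x + y) = f + g"
    using F.a_closed[OF xy(3,4)] by (simp_all only: free_algebra_simps(5) free_hom_add)
  then show ?thesis by (metis imageI)
qed

lemma B_word: "set w \<subseteq> V \<Longrightarrow> single 0 a \<diamondop> tprod (map gen w) \<in> B"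
  by (rule image_eqI[of _ _ "a \<star> w"]) (auto simp: free_hom_single split: if_splits)

lemma B_scalar: "single 0 a \<in> B"
  using B_word[of "[]" a] by simp

lemma B_gen: "g \<in> V \<Longrightarrow> gen g \<in> B"
  using B_word[of "[g]" 1] by simp

lemma B_zero: "0 \<in> B"
  using B_scalar[of 0] by simp

lemma B_sum: "(\<And>i. i \<in> A \<Longrightarrow> G i \<in> B) \<Longrightarrow> (\<Sum>i\<in>A. G i) \<in> B"
proof (induction A rule: infinite_finite_induct)
  case (infinite A)
  then show ?case by (simp only: sum.infinite B_zero not_False_eq_True)
next
  case empty
  show ?case by (simp only: sum.empty B_zero)
next
  case (insert x A)
  show ?case
    unfolding sum.insert[OF insert.hyps] by (intro B_add insert.IH insert.prems) simp_all
qed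

lemma C_I:
  assumes "single u 1 \<in> B"
  shows "u \<in> C"
proof -
  have "single u a \<in> B" for a
    using B_mult[OF B_scalar[of a] assms] by (simp add: tmult_single)
  then show ?thesis
    unfolding C_def by blast
qed

lemma C_single: "u \<in> C \<Longrightarrow> single u a \<in> B"
  unfolding C_def by blast

lemma C_add:
  assumes "u \<in> C" "v \<in> C"
  shows "u + v \<in> C"
proof (rule C_I)
  have "single u (inverse (chi u v)) \<diamondop> single v 1 \<in> B"
    using assms by (intro B_mult C_single)
  then show "single (u + v) 1 \<in> B"
    by (simp add: tmult_single)
qed

lemma C_zero: "0 \<in> C"
  by (rule C_I[OF B_scalar])

lemma ey_C: "i \<in> {1..n} \<Longrightarrow> ey i \<in> C"
  using B_gen[of "Gy i"] by (intro C_I) (simp add: tY_def)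

lemma eomega_C: "m \<le> n \<Longrightarrow> eomega m \<in> C"
proof (cases "m = 0")
  case True
  then show ?thesis using C_zero by (simp add: eomega_def)
next
  case False
  assume m: "m \<le> n"
  have "Om m \<in> B"
    unfolding Om_sum[OF m]
  proof (intro B_sum B_mult B_scalar)
    fix l assume "l \<in> {1..<Suc m}"
    then have "Gy l \<in> V" "Gx l \<in> V" using m by auto
    then show "tY l \<in> B" "tX l \<in> B"
      using B_gen[of "Gy l"] B_gen[of "Gx l"] by (simp_all only: gen.simps)
  qed
  then show ?thesis
    using False by (intro C_I) (simp add: Om_def)
qed

lemma B_keys:
  assumes "f \<in> B"
  shows "keys f \<subseteq> L"
proof -
  obtain x where x: "x \<in> carrier F" "f = \<phi> x"
    using assms by blast
  have mult: "keys (g \<diamondop> h) \<subseteq> L" if "keys g \<subseteq> L" "keys h \<subseteq> L" for g h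
    using keys_tmult[of g h] that L_add by blast
  have gen: "keys (gen g) \<subseteq> L" if "g \<in> V" for g
    using that
  proof (cases rule: generators_cases)
    case (1 i)
    have "u \<in> L" if "u \<in> keys (tX i)" for u
      using that
    proof (rule keys_X)
      fix m assume "u = eomega m - ey i" "m = i \<or> m = i - 1"
      then show "u \<in> L"
        using 1(2) eomega_L[of m] ey_L[OF 1(2)] by (auto intro: L_diff)
    qed
    then show ?thesis by (auto simp: 1(1))
  next
    case (2 i)
    then show ?thesis using ey_L[of i] by (simp add: tY_def)
  qed
  have word: "keys (tprod (map gen w)) \<subseteq> L" if "set w \<subseteq> V" for w
    using that
  proof (induction w)
    case (Cons g w)
    then show ?case
      using gen[of g] mult[of "gen g" "tprod (map gen w)"] by simp
  qed (simp add: L_zero)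
  have "keys (single 0 a \<diamondop> tprod (map gen w)) \<subseteq> L" if "w \<in> Poly_Mapping.keys x" for a w
    using x(1) that by (intro mult word) (auto simp: L_zero)
  then have "(\<Union>w\<in>Poly_Mapping.keys x. keys (single 0 (Poly_Mapping.lookup x w) \<diamondop> tprod (map gen w))) \<subseteq> L"
    by blast
  then show ?thesis
    unfolding x(2) free_hom_def by (rule order.trans[OF keys_sum])
qed

lemma C_L: "u \<in> C \<Longrightarrow> u \<in> L"
  using B_keys[OF C_single[of u 1]] by simp

definition differences :: "(int \<Rightarrow>\<^sub>0 int) set" where
  "differences = {v - w | v w. v \<in> C \<and> w \<in> C}"

lemma differences_diff:
  assumes "u \<in> differences" "u' \<in> differences"
  shows "u - u' \<in> differences"
proof -
  obtain v w v' w' where vw: "v \<in> C" "w \<in> C" "u = v - w" "v' \<in> C" "w' \<in> C" "u' = v' - w'"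
    using assms unfolding differences_def by blast
  have "u - u' = (v + w') - (w + v')"
    by (simp add: vw)
  then show ?thesis
    unfolding differences_def using vw C_add by blast
qed

lemma differences_C: "u \<in> C \<Longrightarrow> u \<in> differences"
proof -
  assume "u \<in> C"
  moreover have "u = u - 0" by simp
  ultimately show ?thesis
    unfolding differences_def using C_zero by blast
qed

lemma differences_zero: "0 \<in> differences"
  by (rule differences_C[OF C_zero])

lemma differences_add: "u \<in> differences \<Longrightarrow> v \<in> differences \<Longrightarrow> u + v \<in> differences"
  using differences_diff[of u "0 - v"] differences_diff[OF differences_zero, of v] by simp

lemma differences_multiple:
  assumes "Poly_Mapping.single k (1::int) \<in> differences"
  shows "Poly_Mapping.single k m \<in> differences"
proof -
  have nat: "Poly_Mapping.single k (int j) \<in> differences" for j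
  proof (induction j)
    case 0
    then show ?case using differences_zero by simp
  next
    case (Suc j)
    have "Poly_Mapping.single k (int (Suc j)) = Poly_Mapping.single k 1 + Poly_Mapping.single k (int j)"
      by (simp add: single_add)
    then show ?case
      using differences_add[OF assms Suc] by simp
  qed
  show ?thesis
  proof (cases "m \<ge> 0")
    case True
    then show ?thesis using nat[of "nat m"] by simp
  next
    case False
    then have "Poly_Mapping.single k m = 0 - Poly_Mapping.single k (int (nat (- m)))"
      by (simp add: single_uminus)
    then show ?thesis
      by (simp only: differences_diff[OF differences_zero nat])
  qed
qed

text \<open>The lattice is generated by the \<open>ey i\<close> and by
  \<open>ew i = eomega i - eomega (i - 1)\<close>, and \<open>C\<close> contains \<open>ey i\<close>
  and \<open>eomega m\<close>.\<close>

lemma L_differences: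
  assumes "u \<in> L"
  shows "u \<in> differences"
proof -
  have "Poly_Mapping.single k (Poly_Mapping.lookup u k) \<in> differences" if "k \<in> Poly_Mapping.keys u" for k
  proof (rule differences_multiple)
    have k: "k \<noteq> 0" "\<bar>k\<bar> \<le> int n"
      using assms that by (auto simp: L_def)
    show "Poly_Mapping.single k 1 \<in> differences"
    proof (cases "k > 0")
      case True
      then have "Poly_Mapping.single k 1 = ey (nat k)" "nat k \<in> {1..n}"
        using k by (auto simp: ey_def)
      then show ?thesis
        using ey_C differences_C by simp
    next
      case False
      define i where "i = nat (- k)"
      have i: "1 \<le> i" "i \<le> n" "k = - int i"
        using False k by (auto simp: i_def)
      have "{1..i} = insert i {1..i - 1}"
        using i(1) by auto
      then have "eomega i = ew i + eomega (i - 1)"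
        using i(1) by (simp add: eomega_def)
      then have "Poly_Mapping.single k 1 = eomega i - eomega (i - 1)"
        by (simp add: ew_def i(3))
      then show ?thesis
        using i by (simp add: differences_diff differences_C eomega_C)
    qed
  qed
  note * = this
  have "(\<Sum>k\<in>A. Poly_Mapping.single k (Poly_Mapping.lookup u k)) \<in> differences"
    if "finite A" "A \<subseteq> Poly_Mapping.keys u" for A
    using that by (induction A rule: finite_induct) (simp_all add: differences_zero differences_add *)
  from this[of "Poly_Mapping.keys u"] show ?thesis
    using poly_mapping_sum_singles[of "Poly_Mapping.keys u" u] by simp
qed

section \<open>The radical of the commutation form\<close>

lemma powi_eq_one_iff: "q powi k = 1 \<longleftrightarrow> int r dvd k"
proof -
  define s where "s = nat (k mod int r)"
  have s: "int s = k mod int r" "s < r"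
    using r_pos by (simp_all add: s_def nat_less_iff)
  have "q powi k = q powi (int r * (k div int r) + int s)"
    by (simp add: s(1))
  also have "\<dots> = (q powi int r) powi (k div int r) * q powi int s"
    by (simp only: power_int_add power_int_mult q_nonzero simp_thms)
  also have "\<dots> = q ^ s"
    by (simp add: q_pow_r)
  finally have "q powi k = q ^ s" .
  moreover have "q ^ s = 1 \<longleftrightarrow> s = 0"
    using r_minimal[of s] s(2) by (cases "s = 0") auto
  ultimately show ?thesis
    using s(1) by (metis dvd_eq_mod_eq_0 of_nat_0 of_nat_eq_iff)
qed

text \<open>The exponent of \<open>q\<close> produced when the monomial in the \<open>y_i\<close>
  with exponents \<open>x i\<close> is moved past \<open>y_j\<close>.\<close>

definition skew :: "(nat \<Rightarrow> int) \<Rightarrow> nat \<Rightarrow> int" where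
  "skew x j = (\<Sum>i\<in>{i\<in>{1..n}. i < j}. x i) - (\<Sum>i\<in>{i\<in>{1..n}. j < i}. x i)"

lemma chi_eq_iff:
  "chi u v = chi v u \<longleftrightarrow> int r dvd
     (\<Sum>j\<in>{1..n}. ya v j * (skew (ya u) j - 2 * wb u j) + wb v j * (2 * ya u j))"
proof -
  have "chi u v = q powi (torus_form n u v - torus_form n v u) * chi v u"
    by (rule chi_commute) simp
  then have "chi u v = chi v u \<longleftrightarrow> q powi (torus_form n u v - torus_form n v u) = 1"
    by simp
  then show ?thesis
    unfolding powi_eq_one_iff torus_form_commutator skew_def .
qed

text \<open>Testing against \<open>ew j\<close> yields the first divisibility, testing against
  \<open>ey j\<close> the second; conversely the commutation exponent is a combination of these
  quantities.\<close>

lemma rad_iff: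
  assumes "u \<in> L"
  shows "u \<in> rad L \<longleftrightarrow>
    (\<forall>j\<in>{1..n}. int r dvd 2 * ya u j \<and> int r dvd skew (ya u) j - 2 * wb u j)"
proof
  assume "u \<in> rad L"
  then have rad: "chi u v = chi v u" if "v \<in> L" for v
    using that by (simp add: rad_def)
  show "\<forall>j\<in>{1..n}. int r dvd 2 * ya u j \<and> int r dvd skew (ya u) j - 2 * wb u j"
  proof (intro ballI conjI)
    fix j assume j: "j \<in> {1..n}"
    have "(\<Sum>l\<in>{1..n}. ya (ew j) l * (skew (ya u) l - 2 * wb u l) + wb (ew j) l * (2 * ya u l))
        = (\<Sum>l\<in>{1..n}. if l = j then 2 * ya u j else 0)"
      by (intro sum.cong refl) (auto simp: ya_ew wb_ew)
    then show "int r dvd 2 * ya u j"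
      using rad[OF ew_L[OF j]] j unfolding chi_eq_iff by simp
    have "(\<Sum>l\<in>{1..n}. ya (ey j) l * (skew (ya u) l - 2 * wb u l) + wb (ey j) l * (2 * ya u l))
        = (\<Sum>l\<in>{1..n}. if l = j then skew (ya u) j - 2 * wb u j else 0)"
      by (intro sum.cong refl) (auto simp: ya_ey wb_ey)
    then show "int r dvd skew (ya u) j - 2 * wb u j"
      using rad[OF ey_L[OF j]] j unfolding chi_eq_iff by simp
  qed
next
  assume *: "\<forall>j\<in>{1..n}. int r dvd 2 * ya u j \<and> int r dvd skew (ya u) j - 2 * wb u j"
  have "chi u v = chi v u" for v
    unfolding chi_eq_iff
  proof (intro dvd_sum dvd_add)
    fix j assume j: "j \<in> {1..n}"
    show "int r dvd ya v j * (skew (ya u) j - 2 * wb u j)"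
      using * j by (intro dvd_mult) blast
    show "int r dvd wb v j * (2 * ya u j)"
      by (rule dvd_mult) (use * j in blast)
  qed
  then show "u \<in> rad L"
    using assms by (simp add: rad_def)
qed

lemma multiple_sum:
  fixes v :: "int \<Rightarrow>\<^sub>0 int"
  shows "Poly_Mapping.lookup (\<Sum>i\<in>{..<m::nat}. v) k = int m * Poly_Mapping.lookup v k"
  by (induction m) (simp_all add: lookup_add distrib_right del: sum_constant)

lemma multiple_rad:
  assumes "v \<in> L"
  shows "(\<Sum>i\<in>{..<r}. v) \<in> rad L"
proof -
  have "(\<Sum>i\<in>{..<r}. v) \<in> L"
    using assms by (intro L_sum)
  moreover have "skew (ya (\<Sum>i\<in>{..<r}. v)) j = int r * skew (ya v) j" for j
    unfolding skew_def multiple_sum by (simp add: sum_distrib_left right_diff_distrib)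
  then have "int r dvd skew (ya (\<Sum>i\<in>{..<r}. v)) j - 2 * wb (\<Sum>i\<in>{..<r}. v) j" for j
    unfolding multiple_sum by simp
  moreover have "int r dvd 2 * ya (\<Sum>i\<in>{..<r}. v) j" for j
    unfolding multiple_sum by simp
  ultimately show ?thesis
    using rad_iff by blast
qed

text \<open>All radical conditions are linear divisibilities by \<open>r\<close>, so the
  \<open>r\<close>-fold multiple of \<open>v\<close> is in the radical; \<open>r - 1\<close> further
  copies of \<open>v\<close> complete it inside \<open>C\<close>.\<close>

lemma torsion:
  assumes "v \<in> C"
  shows "\<exists>w\<in>C. v + w \<in> rad L"
proof
  have "(\<Sum>i\<in>{..<m::nat}. v) \<in> C" for m
    by (induction m) (simp_all add: C_zero C_add assms del: sum_constant)
  then show "(\<Sum>i\<in>{..<r - 1}. v) \<in> C" .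
  have "v + (\<Sum>i\<in>{..<r - 1}. v) = (\<Sum>i\<in>{..<Suc (r - 1)}. v)"
    by (simp add: add.commute del: sum_constant)
  then show "v + (\<Sum>i\<in>{..<r - 1}. v) \<in> rad L"
    using multiple_rad[OF C_L[OF assms]] r_pos by (simp del: sum_constant)
qed

section \<open>The embedding of quantum symplectic space into the torus\<close>

abbreviation A where "A \<equiv> quantum_symplectic_space n q"
abbreviation \<psi> where "\<psi> \<equiv> \<lambda>U. the_elem (\<phi> ` U)"

lemma A_eq: "A = F Quot I"
  unfolding quantum_symplectic_space_def K_algebra_def ..

text \<open>The first isomorphism theorem for \<open>\<phi>\<close>, whose kernel is the defining
  ideal by \<open>kernel_eq\<close>.\<close>

lemma A_iso: "\<psi> \<in> ring_iso A (T\<lparr>carrier := B\<rparr>)"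
  using phi.FactRing_iso_set_aux unfolding kernel_eq A_eq .

lemma psi_image: "\<psi> ` carrier A = B" and psi_inj: "inj_on \<psi> (carrier A)"
  using A_iso by (auto simp: ring_iso_def bij_betw_def)

lemma psi_hom: "\<psi> \<in> ring_hom A T"
proof -
  have "\<psi> \<in> ring_hom A (T\<lparr>carrier := B\<rparr>)"
    using A_iso by (simp add: ring_iso_def)
  from ring_hom_memE[OF this] show ?thesis
    by (intro ring_hom_memI) simp_all
qed

lemma embedding:
  assumes "finite D" "D \<subseteq> L" "\<And>u. u \<in> L \<Longrightarrow> \<exists>!\<delta>. \<delta> \<in> D \<and> u - \<delta> \<in> rad L"
  shows "torus_embedding chi A \<psi> L C D"
proof (rule torus_embedding.intro)
  show "twisted_group_algebra chi" ..
  show "ring A"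
    unfolding A_eq by (rule ideal.quotient_is_ring[OF I_ideal])
  show "torus_embedding_axioms chi A \<psi> L C D"
  proof (rule torus_embedding_axioms.intro)
    show "keys (\<psi> a) \<subseteq> L" if "a \<in> carrier A" for a
      using that psi_image by (intro B_keys) blast
    show "single u a \<in> \<psi> ` carrier A" if "u \<in> C" for u a
      unfolding psi_image by (rule C_single[OF that])
    show "\<exists>v\<in>C. \<exists>w\<in>C. u = v - w" if "u \<in> L" for u
      using L_differences[OF that] unfolding differences_def by blast
    show "\<exists>!\<delta>. \<delta> \<in> D \<and> u - \<delta> \<in> rad L" if "u \<in> L" for u
      by (rule assms(3)[OF that])
    show "\<exists>w\<in>C. v + w \<in> rad L" if "v \<in> C" for v
      by (rule torsion[OF that])
  qed (fact psi_hom psi_inj L_zero L_diff C_zero C_add assms(1,2))+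
qed

end

section \<open>A transversal of the radical\<close>

context symplectic_torus
begin

lemma skew_diff: "skew (\<lambda>i. x i - y i) j = skew x j - skew y j"
  by (simp add: skew_def sum_subtractf)

text \<open>The \<open>y\<close>-parts of radical exponents: the witnesses \<open>y\<close> supply a
  matching \<open>W\<close>-part, one coordinate at a time.\<close>

definition admissible :: "(nat \<Rightarrow> int) \<Rightarrow> bool" where
  "admissible x \<longleftrightarrow> (\<forall>j\<in>{1..n}. int r dvd 2 * x j \<and> (\<exists>y. int r dvd skew x j - 2 * y))"

definition exponent_box :: "(nat \<Rightarrow> int) \<Rightarrow> int \<Rightarrow> (int \<Rightarrow>\<^sub>0 int) set" where
  "exponent_box M h = {u \<in> L. \<forall>j\<in>{1..n}. ya u j \<in> {0..<M j} \<and> wb u j \<in> {0..<h}}"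

definition expvec :: "(nat \<Rightarrow> int) \<Rightarrow> (nat \<Rightarrow> int) \<Rightarrow> int \<Rightarrow>\<^sub>0 int" where
  "expvec a b = (\<Sum>i\<in>{1..n}. Poly_Mapping.single (int i) (a i) + Poly_Mapping.single (- int i) (b i))"

lemma expvec_L: "expvec a b \<in> L"
  unfolding expvec_def by (intro L_sum L_add) (auto simp: L_def split: if_splits)

lemma ya_expvec:
  assumes "j \<in> {1..n}"
  shows "ya (expvec a b) j = a j"
proof -
  have "ya (expvec a b) j = (\<Sum>i\<in>{1..n}. if i = j then a j else 0)"
    unfolding expvec_def lookup_sum lookup_add lookup_single when_def
    by (intro sum.cong refl) auto
  then show ?thesis using assms by simp
qed

lemma wb_expvec:
  assumes "j \<in> {1..n}"
  shows "wb (expvec a b) j = b j"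
proof -
  have "wb (expvec a b) j = (\<Sum>i\<in>{1..n}. if i = j then b j else 0)"
    unfolding expvec_def lookup_sum lookup_add lookup_single when_def
    by (intro sum.cong refl) auto
  then show ?thesis using assms by simp
qed

lemma L_eqI:
  assumes "u \<in> L" "v \<in> L" "\<And>j. j \<in> {1..n} \<Longrightarrow> ya u j = ya v j" "\<And>j. j \<in> {1..n} \<Longrightarrow> wb u j = wb v j"
  shows "u = v"
proof (rule poly_mapping_eqI)
  fix k :: int
  consider "k = 0 \<or> \<bar>k\<bar> > int n" | "0 < k" "k \<le> int n" | "k < 0" "- k \<le> int n"
    by linarith
  then show "Poly_Mapping.lookup u k = Poly_Mapping.lookup v k"
  proof cases
    case 1
    then have "k \<notin> Poly_Mapping.keys u" "k \<notin> Poly_Mapping.keys v"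
      using assms(1,2) by (auto simp: L_def)
    then show ?thesis by (simp add: in_keys_iff)
  next
    case 2
    then have "nat k \<in> {1..n}" "int (nat k) = k"
      by (simp_all add: Suc_le_eq nat_le_iff)
    then show ?thesis using assms(3)[of "nat k"] by simp
  next
    case 3
    then have "nat (- k) \<in> {1..n}" "- int (nat (- k)) = k"
      by (simp_all add: Suc_le_eq nat_le_iff)
    then show ?thesis using assms(4)[of "nat (- k)"] by simp
  qed
qed

lemma skew_cong:
  assumes "\<And>i. i \<in> {1..n} \<Longrightarrow> x i = y i"
  shows "skew x j = skew y j"
  unfolding skew_def using assms by (intro arg_cong2[of _ _ _ _ minus] sum.cong) auto

text \<open>The radical is treated as an extension. Its projection to the
  \<open>y\<close>-coordinates consists of the admissible vectors, for which the sides
  \<open>M j\<close> must form a fundamental box (\<open>ex\<close>, \<open>un\<close>). Over the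
  \<open>y\<close>-part zero only \<open>r dvd 2 b_j\<close> remains, that is
  \<open>h dvd b_j\<close>, so the \<open>W\<close>-coordinates run modulo \<open>h\<close>.\<close>

lemma transversal:
  assumes h: "h > 0" "int r dvd 2 * h" "\<And>y. int r dvd 2 * y \<Longrightarrow> h dvd y"
    and ex: "\<And>a. \<exists>\<alpha>. (\<forall>j\<in>{1..n}. \<alpha> j \<in> {0..<M j}) \<and> admissible (\<lambda>j. a j - \<alpha> j)"
    and un: "\<And>x. admissible x \<Longrightarrow> \<forall>j\<in>{1..n}. \<bar>x j\<bar> < M j \<Longrightarrow> \<forall>j\<in>{1..n}. x j = 0"
    and u: "u \<in> L"
  shows "\<exists>!\<delta>. \<delta> \<in> exponent_box M h \<and> u - \<delta> \<in> rad L"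
proof (rule ex_ex1I)
  obtain \<alpha> where \<alpha>: "\<And>j. j \<in> {1..n} \<Longrightarrow> \<alpha> j \<in> {0..<M j}" "admissible (\<lambda>j. ya u j - \<alpha> j)"
    using ex[of "ya u"] by blast
  then have "\<forall>j\<in>{1..n}. \<exists>y. int r dvd skew (\<lambda>j. ya u j - \<alpha> j) j - 2 * y"
    by (auto simp: admissible_def)
  then obtain y where y: "\<And>j. j \<in> {1..n} \<Longrightarrow> int r dvd skew (\<lambda>j. ya u j - \<alpha> j) j - 2 * y j"
    by metis
  \<comment> \<open>\<open>u - \<delta>\<close> must have the \<open>W\<close>-part
    \<open>y j\<close> modulo \<open>h\<close> to match its \<open>y\<close>-part, which fixes the
    residue of \<open>\<beta> j\<close>.\<close>
  define \<beta> where "\<beta> j = (wb u j - y j) mod h" for j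
  define \<delta> where "\<delta> = expvec \<alpha> \<beta>"
  have \<delta>: "\<delta> \<in> L" "\<And>j. j \<in> {1..n} \<Longrightarrow> ya \<delta> j = \<alpha> j" "\<And>j. j \<in> {1..n} \<Longrightarrow> wb \<delta> j = \<beta> j"
    by (simp_all add: \<delta>_def expvec_L ya_expvec wb_expvec)
  have "\<delta> \<in> exponent_box M h"
    unfolding exponent_box_def using \<delta> \<alpha>(1) h(1) by (auto simp: \<beta>_def)
  moreover have "u - \<delta> \<in> rad L"
    unfolding rad_iff[OF L_diff[OF u \<delta>(1)]]
  proof (intro ballI conjI)
    fix j assume j: "j \<in> {1..n}"
    have ya: "ya (u - \<delta>) i = ya u i - \<alpha> i" if "i \<in> {1..n}" for i
      using \<delta>(2)[OF that] by (simp add: lookup_minus)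
    show "int r dvd 2 * ya (u - \<delta>) j"
      using \<alpha>(2) j unfolding admissible_def ya[OF j] by blast
    have "h dvd (wb u j - \<beta> j) - y j"
    proof -
      have "(wb u j - \<beta> j) - y j = (wb u j - y j) - (wb u j - y j) mod h"
        by (simp add: \<beta>_def)
      then show ?thesis
        by (simp only: dvd_minus_mod)
    qed
    then have "2 * h dvd 2 * ((wb u j - \<beta> j) - y j)"
      by (rule mult_dvd_mono[OF dvd_refl])
    then have "int r dvd 2 * ((wb u j - \<beta> j) - y j)"
      using h(2) by (rule dvd_trans[rotated])
    then have "int r dvd (skew (\<lambda>j. ya u j - \<alpha> j) j - 2 * y j) - 2 * ((wb u j - \<beta> j) - y j)"
      using y[OF j] by (rule dvd_diff[rotated])
    then have "int r dvd skew (\<lambda>j. ya u j - \<alpha> j) j - 2 * (wb u j - \<beta> j)"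
      by (simp add: algebra_simps)
    moreover have "skew (ya (u - \<delta>)) j = skew (\<lambda>j. ya u j - \<alpha> j) j"
      using ya by (rule skew_cong)
    moreover have "wb (u - \<delta>) j = wb u j - \<beta> j"
      using \<delta>(3)[OF j] by (simp add: lookup_minus)
    ultimately show "int r dvd skew (ya (u - \<delta>)) j - 2 * wb (u - \<delta>) j"
      by simp
  qed
  ultimately show "\<exists>\<delta>. \<delta> \<in> exponent_box M h \<and> u - \<delta> \<in> rad L" by blast
next
  fix \<delta> \<epsilon>
  assume \<delta>: "\<delta> \<in> exponent_box M h \<and> u - \<delta> \<in> rad L" and \<epsilon>: "\<epsilon> \<in> exponent_box M h \<and> u - \<epsilon> \<in> rad L"
  have L: "\<delta> \<in> L" "\<epsilon> \<in> L"
    using \<delta> \<epsilon> by (auto simp: exponent_box_def)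
  have R: "int r dvd 2 * (ya \<delta> j - ya \<epsilon> j) \<and>
      int r dvd skew (\<lambda>i. ya \<delta> i - ya \<epsilon> i) j - 2 * (wb \<delta> j - wb \<epsilon> j)" if j: "j \<in> {1..n}" for j
  proof -
    have r: "int r dvd 2 * (ya u j - ya \<delta> j)" "int r dvd 2 * (ya u j - ya \<epsilon> j)"
      "int r dvd (skew (ya u) j - skew (ya \<delta>) j) - 2 * (wb u j - wb \<delta> j)"
      "int r dvd (skew (ya u) j - skew (ya \<epsilon>) j) - 2 * (wb u j - wb \<epsilon> j)"
      using \<delta> \<epsilon> j rad_iff[OF L_diff[OF u L(1)]] rad_iff[OF L_diff[OF u L(2)]]
      by (auto simp: lookup_minus skew_diff)
    show ?thesis
      using dvd_diff[OF r(2,1)] dvd_diff[OF r(4,3)] by (simp add: skew_diff algebra_simps)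
  qed
  have "admissible (\<lambda>j. ya \<delta> j - ya \<epsilon> j)"
    unfolding admissible_def using R by blast
  moreover have "\<forall>j\<in>{1..n}. \<bar>ya \<delta> j - ya \<epsilon> j\<bar> < M j"
  proof
    fix j assume "j \<in> {1..n}"
    then have "ya \<delta> j \<in> {0..<M j}" "ya \<epsilon> j \<in> {0..<M j}"
      using \<delta> \<epsilon> unfolding exponent_box_def by blast+
    then show "\<bar>ya \<delta> j - ya \<epsilon> j\<bar> < M j"
      unfolding atLeastLessThan_iff by linarith
  qed
  ultimately have a0: "\<forall>j\<in>{1..n}. ya \<delta> j - ya \<epsilon> j = 0"
    by (rule un)
  have b0: "wb \<delta> j = wb \<epsilon> j" if j: "j \<in> {1..n}" for j
  proof -
    have "skew (\<lambda>i. ya \<delta> i - ya \<epsilon> i) j = skew (\<lambda>i. 0) j"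
      by (rule skew_cong) (use a0 in blast)
    also have "\<dots> = 0"
      by (simp add: skew_def)
    finally have "int r dvd 2 * (wb \<delta> j - wb \<epsilon> j)"
      using R[OF j] by (simp only: diff_0 dvd_minus_iff)
    then have "h dvd wb \<delta> j - wb \<epsilon> j"
      by (rule h(3))
    moreover have "wb \<delta> j \<in> {0..<h}" "wb \<epsilon> j \<in> {0..<h}"
      using \<delta> \<epsilon> j unfolding exponent_box_def by blast+
    then have "\<bar>wb \<delta> j - wb \<epsilon> j\<bar> < h"
      unfolding atLeastLessThan_iff by linarith
    ultimately show ?thesis
      using zdvd_not_zless[of "\<bar>wb \<delta> j - wb \<epsilon> j\<bar>" h] by (cases "wb \<delta> j = wb \<epsilon> j") auto
  qed
  show "\<delta> = \<epsilon>"
    by (rule L_eqI[OF L]) (use a0 b0 in auto)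
qed

lemma exponent_box_card:
  "finite (exponent_box M h)"
  "card (exponent_box M h) = (\<Prod>j\<in>{1..n}. nat (M j)) * nat h ^ n"
proof -
  let ?P = "(PiE {1..n} (\<lambda>j. {0..<M j})) \<times> (PiE {1..n} (\<lambda>j. {0..<h}))"
  let ?f = "\<lambda>(a, b). expvec a b"
  have image: "?f ` ?P = exponent_box M h"
  proof
    show "?f ` ?P \<subseteq> exponent_box M h"
      by (auto simp: exponent_box_def expvec_L ya_expvec wb_expvec PiE_iff)
    show "exponent_box M h \<subseteq> ?f ` ?P"
    proof
      fix u assume u: "u \<in> exponent_box M h"
      have "u = ?f (restrict (ya u) {1..n}, restrict (wb u) {1..n})"
        unfolding prod.case
        by (rule L_eqI) (use u in \<open>simp_all add: exponent_box_def expvec_L ya_expvec wb_expvec\<close>)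
      moreover have "(restrict (ya u) {1..n}, restrict (wb u) {1..n}) \<in> ?P"
        using u by (auto simp: exponent_box_def)
      ultimately show "u \<in> ?f ` ?P" by blast
    qed
  qed
  have inj: "inj_on ?f ?P"
  proof (rule inj_onI)
    fix p p' assume "p \<in> ?P" "p' \<in> ?P" and eq: "?f p = ?f p'"
    then obtain a b a' b' where p: "p = (a, b)" "p' = (a', b')"
      "a \<in> PiE {1..n} (\<lambda>j. {0..<M j})" "a' \<in> PiE {1..n} (\<lambda>j. {0..<M j})"
      "b \<in> PiE {1..n} (\<lambda>j. {0..<h})" "b' \<in> PiE {1..n} (\<lambda>j. {0..<h})"
      by blast
    have e: "expvec a b = expvec a' b'"
      using eq by (simp add: p)
    have "a = a'"
    proof (rule PiE_ext[OF p(3,4)])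
      fix j assume j: "j \<in> {1..n}"
      show "a j = a' j"
        using ya_expvec[OF j, of a b] ya_expvec[OF j, of a' b'] e by simp
    qed
    moreover have "b = b'"
    proof (rule PiE_ext[OF p(5,6)])
      fix j assume j: "j \<in> {1..n}"
      show "b j = b' j"
        using wb_expvec[OF j, of a b] wb_expvec[OF j, of a' b'] e by simp
    qed
    ultimately show "p = p'"
      by (simp add: p)
  qed
  have "finite ?P"
    by (intro finite_cartesian_product finite_PiE) simp_all
  then show "finite (exponent_box M h)"
    unfolding image[symmetric] by (rule finite_imageI)
  have "card (exponent_box M h) = card ?P"
    unfolding image[symmetric] by (rule card_image[OF inj])
  then show "card (exponent_box M h) = (\<Prod>j\<in>{1..n}. nat (M j)) * nat h ^ n"
    by (simp add: card_cartesian_product card_PiE)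
qed

lemma quantum_symplectic_space_PI:
  assumes "h > 0" "int r dvd 2 * h" "\<And>y. int r dvd 2 * y \<Longrightarrow> h dvd y"
    and "\<And>a. \<exists>\<alpha>. (\<forall>j\<in>{1..n}. \<alpha> j \<in> {0..<M j}) \<and> admissible (\<lambda>j. a j - \<alpha> j)"
    and "\<And>x. admissible x \<Longrightarrow> \<forall>j\<in>{1..n}. \<bar>x j\<bar> < M j \<Longrightarrow> \<forall>j\<in>{1..n}. x j = 0"
    and d: "(\<Prod>j\<in>{1..n}. nat (M j)) * nat h ^ n = d ^ 2"
  shows "prime_ring A \<and> PI_ring A \<and> PI_degree A = d"
proof -
  interpret E: torus_embedding chi A \<psi> L C "exponent_box M h"
  proof (rule embedding[OF exponent_box_card(1)])
    show "exponent_box M h \<subseteq> L"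
      by (auto simp: exponent_box_def)
    show "\<exists>!\<delta>. \<delta> \<in> exponent_box M h \<and> u - \<delta> \<in> rad L" if "u \<in> L" for u
      by (rule transversal[OF assms(1-5) that])
  qed
  show ?thesis
    using E.R.prime_ring E.PI_ring E.PI_degree[of d] d exponent_box_card(2) by simp
qed

section \<open>The index of the radical in the three cases\<close>

lemma skew_multiple: "(\<And>j. j \<in> {1..n} \<Longrightarrow> m dvd x j) \<Longrightarrow> m dvd skew x j"
  unfolding skew_def by (intro dvd_diff dvd_sum) auto

text \<open>Modulo 2 the signs in \<open>skew\<close> disappear, leaving the sum of all entries
  except \<open>x j\<close>.\<close>

lemma skew_parity:
  assumes "j \<in> {1..n}"
  shows "even (skew x j) \<longleftrightarrow> even ((\<Sum>i\<in>{1..n}. x i) - x j)"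
proof -
  let ?A = "{i\<in>{1..n}. i < j}" and ?B = "{i\<in>{1..n}. j < i}"
  have "{1..n} = insert j (?A \<union> ?B)"
    using assms by auto
  then have "(\<Sum>i\<in>{1..n}. x i) = (\<Sum>i\<in>insert j (?A \<union> ?B). x i)"
    by (rule arg_cong)
  also have "\<dots> = x j + (\<Sum>i\<in>?A \<union> ?B. x i)"
    by (rule sum.insert) simp_all
  also have "(\<Sum>i\<in>?A \<union> ?B. x i) = (\<Sum>i\<in>?A. x i) + (\<Sum>i\<in>?B. x i)"
    by (rule sum.union_disjoint) auto
  finally have "(\<Sum>i\<in>{1..n}. x i) = x j + ((\<Sum>i\<in>?A. x i) + (\<Sum>i\<in>?B. x i))" .
  then show ?thesis
    by (simp add: skew_def)
qed

lemma small_multiple_zero: "\<lbrakk>(m::int) dvd x; \<bar>x\<bar> < m\<rbrakk> \<Longrightarrow> x = 0"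
  using zdvd_not_zless[of "\<bar>x\<bar>" m] by (cases "x = 0") auto

text \<open>As 2 is invertible modulo \<open>r\<close>, the radical conditions say that all
  \<open>2 n\<close> coordinates are divisible by \<open>r\<close>. The index is
  \<open>r^(2 n)\<close>.\<close>

lemma PI_odd:
  assumes "odd r"
  shows "prime_ring A \<and> PI_ring A \<and> PI_degree A = r ^ n"
proof (rule quantum_symplectic_space_PI[of "int r" "\<lambda>j. int r"])
  have two: "int r dvd y" if "int r dvd 2 * y" for y
    using that assms by (simp add: coprime_dvd_mult_right_iff)
  show "int r > 0" using r_pos by simp
  show "int r dvd 2 * int r" by simp
  show "int r dvd y" if "int r dvd 2 * y" for y
    using that by (rule two)
  show "\<exists>\<alpha>. (\<forall>j\<in>{1..n}. \<alpha> j \<in> {0..<int r}) \<and> admissible (\<lambda>j. a j - \<alpha> j)" for a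
  proof (intro exI[of _ "\<lambda>j. a j mod int r"] conjI ballI)
    show "a j mod int r \<in> {0..<int r}" for j
      using r_pos by simp
    have r: "int r dvd a j - a j mod int r" for j
      by (rule dvd_minus_mod)
    show "admissible (\<lambda>j. a j - a j mod int r)"
      unfolding admissible_def
    proof (intro ballI conjI exI[of _ 0])
      show "int r dvd 2 * (a j - a j mod int r)" for j
        by (rule dvd_mult[OF r])
      show "int r dvd skew (\<lambda>j. a j - a j mod int r) j - 2 * 0" for j
        using skew_multiple[of "int r" "\<lambda>j. a j - a j mod int r" j] r by simp
    qed
  qed
  show "\<forall>j\<in>{1..n}. x j = 0" if "admissible x" "\<forall>j\<in>{1..n}. \<bar>x j\<bar> < int r" for x
  proof
    fix j assume "j \<in> {1..n}"
    then have "int r dvd 2 * x j" "\<bar>x j\<bar> < int r"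
      using that unfolding admissible_def by blast+
    then show "x j = 0"
      using two small_multiple_zero by blast
  qed
qed (simp add: power2_eq_square)

lemma half:
  assumes "r = 2 * h"
  shows "int h > 0" "int r dvd 2 * int h" "int r dvd 2 * y \<Longrightarrow> int h dvd y"
  using assms r_pos by auto

text \<open>For \<open>r = 2 h\<close> with \<open>h\<close> even, \<open>h dvd x_j\<close> for all
  \<open>j\<close> makes every \<open>skew x j\<close> even, so the second condition can always be
  solved. All sides of the box are \<open>h\<close>, and the index is
  \<open>h^(2 n)\<close>.\<close>

lemma PI_four:
  assumes "4 dvd r"
  shows "prime_ring A \<and> PI_ring A \<and> PI_degree A = r ^ n div 2 ^ n"
proof -
  define h where "h = r div 2"
  have r: "r = 2 * h" and h: "even h"
    using assms by (auto simp: h_def)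
  have "prime_ring A \<and> PI_ring A \<and> PI_degree A = h ^ n"
  proof (rule quantum_symplectic_space_PI[of "int h" "\<lambda>j. int h", OF half[OF r]])
    show "\<exists>\<alpha>. (\<forall>j\<in>{1..n}. \<alpha> j \<in> {0..<int h}) \<and> admissible (\<lambda>j. a j - \<alpha> j)" for a
    proof (intro exI[of _ "\<lambda>j. a j mod int h"] conjI ballI)
      show "a j mod int h \<in> {0..<int h}" for j
        using half(1)[OF r] by simp
      have d: "int h dvd a j - a j mod int h" for j
        by (rule dvd_minus_mod)
      show "admissible (\<lambda>j. a j - a j mod int h)"
        unfolding admissible_def
      proof (intro ballI conjI)
        show "int r dvd 2 * (a j - a j mod int h)" for j
          unfolding r of_nat_mult of_nat_numeral by (rule mult_dvd_mono[OF dvd_refl d])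
        have "even (skew (\<lambda>j. a j - a j mod int h) j)" for j
          using skew_multiple[of "int h" "\<lambda>j. a j - a j mod int h" j] d h
          by (meson dvd_trans even_of_nat)
        then show "\<exists>y. int r dvd skew (\<lambda>j. a j - a j mod int h) j - 2 * y" for j
          \<comment> \<open>Half of the even number \<open>skew\<close> makes the difference exactly
            zero.\<close>
          by (intro exI[of _ "skew (\<lambda>j. a j - a j mod int h) j div 2"]) simp
      qed
    qed
    show "\<forall>j\<in>{1..n}. x j = 0" if "admissible x" "\<forall>j\<in>{1..n}. \<bar>x j\<bar> < int h" for x
    proof
      fix j assume "j \<in> {1..n}"
      then have "int r dvd 2 * x j" "\<bar>x j\<bar> < int h"
        using that unfolding admissible_def by blast+
      then show "x j = 0"
        using half(3)[OF r] small_multiple_zero by blast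
    qed
  qed (simp_all add: power2_eq_square)
  moreover have "r ^ n div 2 ^ n = h ^ n"
    by (simp add: r power_mult_distrib)
  ultimately show ?thesis by simp
qed

text \<open>Since \<open>r\<close> is even, \<open>skew x j\<close> is congruent to an even number
  modulo \<open>r\<close> iff it is itself even; \<open>skew_parity\<close> rewrites this.\<close>

lemma admissible_parity:
  assumes "r = 2 * h" "odd h"
  shows "admissible x \<longleftrightarrow> (\<forall>j\<in>{1..n}. int h dvd x j \<and> even ((\<Sum>i\<in>{1..n}. x i) - x j))"
proof -
  have "(\<exists>y. int r dvd s - 2 * y) \<longleftrightarrow> even s" for s
  proof
    assume "\<exists>y. int r dvd s - 2 * y"
    then obtain y where "int r dvd s - 2 * y" by blast
    moreover have "2 dvd int r"
      using assms(1) by simp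
    ultimately have "even (s - 2 * y)"
      using dvd_trans by blast
    then show "even s" by simp
  next
    assume "even s"
    then show "\<exists>y. int r dvd s - 2 * y"
      by (intro exI[of _ "s div 2"]) simp
  qed
  moreover have "int r dvd 2 * y \<longleftrightarrow> int h dvd y" for y
    using assms(1) by simp
  ultimately show ?thesis
    unfolding admissible_def using skew_parity by simp
qed

text \<open>Here all \<open>x_j\<close> must share the parity of their sum \<open>s\<close>. For
  even \<open>n\<close> this forces \<open>s\<close> and all \<open>x_j\<close> to be even, so the
  \<open>y\<close>-sides of the box are \<open>r\<close>. For odd \<open>n\<close> the common parity
  is free, so one of these sides shrinks to \<open>h\<close>. The index is \<open>r^n h^n\<close> or
  \<open>h r^(n-1) h^n\<close>, in both cases the square of \<open>2^(n div 2) h^n\<close>.\<close>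

lemma PI_two:
  assumes "n \<ge> 1" "even r" "\<not> 4 dvd r"
  shows "prime_ring A \<and> PI_ring A \<and> PI_degree A = r ^ n div 2 ^ ((n + 1) div 2)"
proof -
  define h where "h = r div 2"
  have r: "r = 2 * h"
    using assms(2) by (auto simp: h_def)
  have h: "odd h"
  proof
    assume "even h"
    then obtain m where "h = 2 * m" by blast
    then show False
      using assms(3) by (simp add: r)
  qed
  note adm = admissible_parity[OF r h]
  let ?M = "\<lambda>j. if odd n \<and> j = 1 then int h else int r"
  have even_multiple: "int r dvd y" if "int h dvd y" "even y" for y
  proof -
    have "coprime 2 (int h)"
      using h by simp
    then have "2 * int h dvd y"
      using that by (intro divides_mult) auto
    then show ?thesis by (simp add: r)
  qed
  have "prime_ring A \<and> PI_ring A \<and> PI_degree A = 2 ^ (n div 2) * h ^ n"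
  proof (rule quantum_symplectic_space_PI[of "int h" ?M, OF half[OF r]])
    show "\<exists>\<alpha>. (\<forall>j\<in>{1..n}. \<alpha> j \<in> {0..<?M j}) \<and> admissible (\<lambda>j. a j - \<alpha> j)" for a
    proof -
      \<comment> \<open>For odd \<open>n\<close> reducing the first coordinate modulo
        \<open>h\<close> subtracts \<open>k h\<close>. Its parity must be shared by the other
        coordinates, so these are reduced to be congruent to \<open>k h\<close> modulo
        \<open>r\<close>, not to zero. For even \<open>n\<close> the common parity has to be even,
        hence \<open>k = 0\<close>.\<close>
      define k where "k = (if odd n then a 1 div int h else 0)"
      define \<alpha> where "\<alpha> j = (if odd n \<and> j = 1 then a 1 mod int h else (a j - k * int h) mod int r)" for j
      have \<alpha>: "\<alpha> j \<in> {0..<?M j}" for j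
        using half(1)[OF r] r_pos by (simp add: \<alpha>_def)
      have x: "int r dvd (a j - \<alpha> j) - k * int h" for j
      proof (cases "odd n \<and> j = 1")
        case True
        then have "(a j - \<alpha> j) - k * int h = 0"
          by (simp add: \<alpha>_def k_def minus_mod_eq_div_mult)
        then show ?thesis by simp
      next
        case False
        then have "(a j - \<alpha> j) - k * int h = (a j - k * int h) - (a j - k * int h) mod int r"
          by (auto simp: \<alpha>_def)
        then show ?thesis
          by (simp only: dvd_minus_mod)
      qed
      have hx: "int h dvd a j - \<alpha> j" for j
      proof -
        have "int h dvd (a j - \<alpha> j) - k * int h"
          by (rule dvd_trans[OF _ x]) (simp add: r)
        then show ?thesis
          using dvd_add[of "int h" "(a j - \<alpha> j) - k * int h" "k * int h"] by simp
      qed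
      have par: "even (a j - \<alpha> j) \<longleftrightarrow> even k" for j
      proof -
        have "even ((a j - \<alpha> j) - k * int h)"
          by (rule dvd_trans[OF _ x]) (simp add: r)
        then show ?thesis using h by simp
      qed
      have "even ((\<Sum>i\<in>{1..n}. a i - \<alpha> i) - (a j - \<alpha> j))" for j
      proof -
        have "even (\<Sum>i\<in>{1..n}. (a i - \<alpha> i) - k)"
          using par by (intro dvd_sum) simp
        then have "even ((\<Sum>i\<in>{1..n}. a i - \<alpha> i) - int n * k)"
          by (simp add: sum_subtractf)
        \<comment> \<open>Either \<open>n\<close> is odd and \<open>n - 1\<close> is even, or
          \<open>k = 0\<close>.\<close>
        moreover have "even (int n * k - k)"
          by (auto simp: k_def)
        ultimately show ?thesis
          using par[of j] by (simp add: even_diff_iff)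
      qed
      then have "admissible (\<lambda>j. a j - \<alpha> j)"
        unfolding adm using hx by blast
      then show ?thesis
        using \<alpha> by blast
    qed
    show "\<forall>j\<in>{1..n}. x j = 0" if x: "admissible x" "\<forall>j\<in>{1..n}. \<bar>x j\<bar> < ?M j" for x
    proof -
      let ?s = "\<Sum>i\<in>{1..n}. x i"
      have hx: "int h dvd x j" "even (?s - x j)" if "j \<in> {1..n}" for j
        using x(1) that unfolding adm by blast+
      have "even ?s"
      proof (cases "odd n")
        case True
        have "1 \<in> {1..n}" using assms(1) by simp
        then have "int h dvd x 1" "\<bar>x 1\<bar> < int h"
          using hx(1)[of 1] bspec[OF x(2), of 1] True by simp_all
        then have "x 1 = 0"
          by (rule small_multiple_zero)
        then show ?thesis
          using hx(2)[OF \<open>1 \<in> {1..n}\<close>] by simp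
      next
        case False
        \<comment> \<open>Adding the \<open>n\<close> parity conditions gives
          \<open>(n - 1) s\<close> even, and \<open>n - 1\<close> is odd here.\<close>
        have "even (\<Sum>j\<in>{1..n}. ?s - x j)"
          using hx(2) by (rule dvd_sum)
        then have "even (int n * ?s - ?s)"
          by (simp add: sum_subtractf)
        then show ?thesis
          using False by simp
      qed
      show ?thesis
      proof
        fix j assume j: "j \<in> {1..n}"
        have "int r dvd x j"
          using hx[OF j] \<open>even ?s\<close> by (intro even_multiple) simp_all
        moreover have "\<bar>x j\<bar> < int r"
          using x(2) j half(1)[OF r] r by (fastforce split: if_splits)
        ultimately show "x j = 0"
          by (rule small_multiple_zero)
      qed
    qed
    show "(\<Prod>j\<in>{1..n}. nat (?M j)) * nat (int h) ^ n = (2 ^ (n div 2) * h ^ n) ^ 2"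
    proof (cases "odd n")
      case True
      then obtain m where m: "n = Suc (2 * m)"
        by (auto elim: oddE)
      have "(\<Prod>j\<in>{1..n}. nat (?M j)) = h * (\<Prod>j\<in>{2..n}. r)"
        using True assms(1) by (subst prod.atLeast_Suc_atMost) (auto simp: numeral_2_eq_2)
      also have "\<dots> = h * r ^ (2 * m)"
        by (simp add: m)
      finally show ?thesis
        by (simp add: r m power_mult_distrib power_mult power2_eq_square algebra_simps flip: power_add)
    next
      case False
      then obtain m where m: "n = 2 * m" by auto
      have "(\<Prod>j\<in>{1..n}. nat (?M j)) = r ^ n"
        using False by simp
      then show ?thesis
        unfolding nat_int by (simp add: r m power_mult_distrib power_mult power2_eq_square algebra_simps)
    qed
  qed
  moreover have "r ^ n div 2 ^ ((n + 1) div 2) = 2 ^ (n div 2) * h ^ n"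
  proof -
    have "n = n div 2 + (n + 1) div 2"
      by presburger
    then have "r ^ n = (2 ^ (n div 2) * h ^ n) * 2 ^ ((n + 1) div 2)"
      unfolding r power_mult_distrib by (metis (no_types, lifting) mult.assoc mult.commute power_add)
    then show ?thesis by simp
  qed
  ultimately show ?thesis by simp
qed

end

theorem mainTheorem13:
  fixes q :: "'k::field" and n r :: nat
  assumes "n \<ge> 1"
    and "q \<noteq> 0"
    and "r \<ge> 1" and "q ^ r = 1" and "\<And>m. 1 \<le> m \<Longrightarrow> m < r \<Longrightarrow> q ^ m \<noteq> 1"
    and "q ^ 2 \<noteq> 1"
  shows "prime_ring (quantum_symplectic_space n q)
    \<and> PI_ring (quantum_symplectic_space n q)
    \<and> PI_degree (quantum_symplectic_space n q) =
        (if odd r then r ^ n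
         else if \<not> 4 dvd r then r ^ n div 2 ^ ((n + 1) div 2)
         else r ^ n div 2 ^ n)"
proof -
  interpret symplectic_torus q n r
    by (rule symplectic_torus.intro) (fact assms)+
  show ?thesis
    using PI_odd PI_two[OF assms(1)] PI_four by simp
qed

end
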